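(* Let $J$ be the drag or lift coefficient $$J=\frac{1}{C_\infty}\int_{\Gamma_W}(pn-\tau n)\cdot\psi\,ds ,$$ where $C_\infty$ is a constant, $\psi=(\cos\alpha,\sin\alpha)^\top$ (drag) or $\psi=(-\sin\alpha,\cos\alpha)^\top$ (lift), and the flow state $\mathbf u$ on $\Omega$ solves the compressible Navier--Stokes equations in variational form with the wall boundary conditions given in the context. Let $\mathbf z=(\mathbf z_1,\dots,\mathbf z_4)\in\mathcal H$ be a solution of the variational adjoint Navier--Stokes problem given in the context, satisfying the adjoint boundary conditions $$\mathbf z_{2,3}=\tfrac{1}{C_\infty}\psi \ \text{ on }\Gamma_W,\qquad \mathbf z_4=0\ \text{ on }\Gamma_{iso},\qquad \nabla \mathbf z_4\cdot n=0\ \text{ on }\Gamma_{adia}.$$ Let $V$ be a perturbation field vanishing in a neighbourhood of $\Gamma_\infty$. (i) (Variational approach.) If the local shape derivative $\mathbf u'$ is determined by shape differentiation of the variational form of the Navier--Stokes equations (problem (VSD) in the context), then the shape derivative of $J$ has the Hadamard form $$ \begin{aligned} dJ(\Omega;V)=&\int_{\Gamma_W}(V\cdot n)\frac{\partial v}{\partial n}\cdot(n\cdot\Sigma)\,ds -\int_{\Gamma_{iso}}(V\cdot n)\frac{\partial (T_W-T)}{\partial n}\,\kappa\, n\cdot\nabla \mathbf z_4\,ds\\ &+\int_{\Gamma_W}(V\cdot n)\frac{\partial v}{\partial n}\cdot\bigl(\rho n\,\mathbf z_1+(\rho H n-\tau n)\mathbf z_4\bigr)\,ds\\ &-\int_{\Gamma_{adia}}(V\cdot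 n)\Bigl(\frac{\partial^2T}{\partial n^2}\kappa \mathbf z_4+\operatorname{div}_\Gamma(\nabla T\,\kappa\, \mathbf z_4)\Bigr)ds\\ &-\int_{\Gamma_W}(V\cdot n)\,\rho\,(\nabla\cdot v)\,\mathbf z_1\,ds -\int_{\Gamma_{adia}}(V\cdot n)\Bigl(\rho H(\nabla\cdot v)-\sum_{i,j}\tau_{ij}\frac{\partial v_j}{\partial x_i}-\kappa\Delta T\Bigr)\mathbf z_4\,ds . \end{aligned} $$ (ii) (Pointwise approach.) If instead $\mathbf u$ satisfies the Navier--Stokes equations in strong (pointwise) form and $\mathbf u'$ is determined by the pointwise linearized equation (PSD) in the context, then $dJ(\Omega;V)$ is given by the same formula with the two integrals in the last line omitted.
   Context: Setting ($d=2$). $\Omega\subset D\subset\mathbb R^2$ is the fluid domain with boundary $\Gamma=\Gamma_W\cup\Gamma_\infty$ (wall and far field), $\Gamma_W=\Gamma_{iso}\cup\Gamma_{adia}$ disjoint, and unit normal $n$. $\rho$, $v=(v_1,v_2)^\top$, $p$, $E$, $T$, $H=E+p/\rho$ are density, velocity, pressure, total energy, temperature and (total) enthalpy; $\mu$ is the viscosity, $\kappa$ the thermal conductivity, $\gamma$ the adiabatic exponent, $Pr$ the Prandtl number, with $\mu$ and $\kappa$ treated as constants. Perfect gas: $p=\rho RT$, $E=c_vT+\frac12\|v\|^2$, and $T\kappa=\frac{\mu\gamma}{Pr}(E-\frac12\|v\|^2)$. $\tau=\mu(\nabla v+(\nabla v)^\top-\frac23(\nabla\cdot v)I)$. State and fluxes: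 $\mathbf u=(\rho,\rho v_1,\rho v_2,\rho E)^\top$; $\mathcal F^c=(f_1^c,f_2^c)$ with $f_1^c=(\rho v_1,\rho v_1^2+p,\rho v_1v_2,\rho Hv_1)^\top$, $f_2^c=(\rho v_2,\rho v_1v_2,\rho v_2^2+p,\rho Hv_2)^\top$; $\mathcal F^v=(f_1^v,f_2^v)$ with $f_k^v=(0,\tau_{1k},\tau_{2k},\sum_j\tau_{kj}v_j+\kappa\,\partial T/\partial x_k)^\top$. Subscripts $\mathbf u$, $\nabla\mathbf u$ denote partial derivatives; write $G_{kl}=\partial f_k^v/\partial(\partial\mathbf u/\partial x_l)$ for the $4\times4$ blocks of $\mathcal F^v_{\nabla\mathbf u}$. Notation: $(\cdot,\cdot)_\Omega$, $(\cdot,\cdot)_\Gamma$, etc. are the $L^2$ pairings; $n\cdot\mathcal F=\sum_kn_kf_k$; $(\mathcal F,\nabla\mathbf v)_\Omega=\int_\Omega\sum_kf_k\cdot\partial_k\mathbf v\,dx$; $\mathcal F\cdot\mathbf v$ is the vector field with components $f_k\cdot\mathbf v$; $(\mathcal F_{\mathbf u})^\top\nabla\mathbf v=\sum_k(\partial_{\mathbf u}f_k)^\top\partial_k\mathbf v$; $\mathcal F^v_{\nabla\mathbf u}\nabla\mathbf w$ has $k$-th column $\sum_lG_{kl}\partial_l\mathbf w$; $(\mathcal F^v_{\nabla\mathbf u})^\top\nabla\mathbf v$ has $l$-th column $\sum_kG_{kl}^\top\partial_k\mathbf v$; $(n\cdot\mathcal F_{\mathbf u})^\top\mathbf v=\sum_kn_k(\partial_{\mathbf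 u}f_k)^\top\mathbf v$; $(n\cdot\mathcal F^v_{\nabla\mathbf u})^\top\mathbf v$ has $l$-th column $\sum_kn_kG_{kl}^\top\mathbf v$; $\mathbf z_{2,3}=(\mathbf z_2,\mathbf z_3)^\top$. Strong form: $\nabla\cdot(\mathcal F^c(\mathbf u)-\mathcal F^v(\mathbf u,\nabla\mathbf u))=0$ in $\Omega$. Variational form: $\mathbf u\in\mathcal H$ with $-(\mathcal F^c-\mathcal F^v,\nabla\mathbf v)_\Omega+(n\cdot(\mathcal F^c-\mathcal F^v),\mathbf v)_\Gamma=0$ for all $\mathbf v\in\mathcal H$, where $\mathcal H=H^1\times H^2\times H^3\times H^4$ is a product of suitable Hilbert spaces of functions on $\Omega$. Wall conditions: $v=0$ on $\Gamma_W$, $\nabla T\cdot n=0$ on $\Gamma_{adia}$, $T=T_W$ on $\Gamma_{iso}$ ($T_W$ is defined near the wall and independent of the shape). These hold on all perturbed domains too. Shape calculus: $\Omega_t=\{x+tV(x):x\in\Omega\}$ with $V\in C_0^k(D;\mathbb R^2)$; $dJ(\Omega;V)=\lim_{t\searrow0}(J(\Omega_t)-J(\Omega))/t$. For $f(t,x)$, $f'=\partial_tf(t,x)|_{t=0}$ is the local shape derivative. Standing assumptions: the boundary and all functions are sufficiently regular for all expressions to exist, and $V=(V\cdot n)n$ on $\Gamma_W$ (only the normal component matters). Tangential divergence: $\operatorname{div}_\Gamma W=\operatorname{div}W-DW\,n\cdot n$. Adjoint stress tensor: $\Sigma=\mu(\nabla\mathbf z_{2,3}+(\nabla\mathbf z_{2,3})^\top-\frac23(\nabla\cdot\mathbf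 z_{2,3})I)$. (PSD): $\nabla\cdot(\mathcal F^c_{\mathbf u}\mathbf u'-\mathcal F^v_{\mathbf u}\mathbf u'-\mathcal F^v_{\nabla\mathbf u}\nabla\mathbf u')=0$ in $\Omega$. (VSD): $\mathbf u'\in\mathcal H$ satisfies, for all $\mathbf v\in\mathcal H$, $$\begin{aligned}0=&-(\mathbf u',[\mathcal F^c_{\mathbf u}-\mathcal F^v_{\mathbf u}]^\top\nabla\mathbf v)_\Omega-((V\cdot n)[\mathcal F^c-\mathcal F^v],\nabla\mathbf v)_{\Gamma_W}-(\mathbf u',\nabla\cdot[(\mathcal F^v_{\nabla\mathbf u})^\top\nabla\mathbf v])_\Omega+(\mathbf u',n\cdot[(\mathcal F^v_{\nabla\mathbf u})^\top\nabla\mathbf v])_\Gamma\\&+(\mathbf u',[n\cdot(\mathcal F^c_{\mathbf u}-\mathcal F^v_{\mathbf u})]^\top\mathbf v)_{\Gamma\setminus\Gamma_W}-(\nabla\mathbf u',(n\cdot\mathcal F^v_{\nabla\mathbf u})^\top\mathbf v)_{\Gamma\setminus\Gamma_W}+(n\cdot(\mathcal F^c-\mathcal F^v)',\mathbf v)_{\Gamma_W}\\&+\int_{\Gamma_W}(V\cdot n)\nabla\cdot([\mathcal F^c-\mathcal F^v]\cdot\mathbf v)\,ds.\end{aligned}$$ Adjoint problem: $\mathbf z\in\mathcal H$ satisfies, for all $\mathbf w\in\mathcal H$, $$\begin{aligned}&-(\mathbf w,(\mathcal F^c_{\mathbf u}-\mathcal F^v_{\mathbf u})^\top\nabla\mathbf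 z)_\Omega-(\mathbf w,\nabla\cdot((\mathcal F^v_{\nabla\mathbf u})^\top\nabla\mathbf z))_\Omega+(\mathbf w,n\cdot((\mathcal F^v_{\nabla\mathbf u})^\top\nabla\mathbf z))_\Gamma\\&+(\mathbf w,(n\cdot(\mathcal F^c_{\mathbf u}-\mathcal F^v_{\mathbf u}))^\top\mathbf z)_\Gamma-(\nabla\mathbf w,(n\cdot\mathcal F^v_{\nabla\mathbf u})^\top\mathbf z)_\Gamma=J'[\mathbf u](\mathbf w),\end{aligned}$$ with $J'[\mathbf u](\mathbf w)=(\frac1{C_\infty}(p_{\mathbf u}n-\tau_{\mathbf u}n)\cdot\psi,\mathbf w)_{\Gamma_W}-(\frac1{C_\infty}(\tau_{\nabla\mathbf u}n)\cdot\psi,\nabla\mathbf w)_{\Gamma_W}$; in particular its volume part holds for test functions compactly supported in $\Omega$ and its far-field part for test functions supported near $\Gamma\setminus\Gamma_W$ (with zero right-hand side in both cases). *)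

theory Defs
  imports "HOL-Analysis.Analysis"
begin

lemma vector_4:
  "(vector [a, b, c, e] :: 'a::zero^4) $ 1 = a"
  "(vector [a, b, c, e] :: 'a::zero^4) $ 2 = b"
  "(vector [a, b, c, e] :: 'a::zero^4) $ 3 = c"
  "(vector [a, b, c, e] :: 'a::zero^4) $ 4 = e"
  unfolding vector_def by simp_all


section \<open>Differential operators and regularity\<close>

text \<open>Only meant for open sets; on those, continuity of all directional derivatives is
  continuity of the derivative, the domain being finite-dimensional.\<close>

primrec Ck_on :: "nat \<Rightarrow> ('a::euclidean_space \<Rightarrow> 'b::real_normed_vector) \<Rightarrow> 'a set \<Rightarrow> bool" where
  "Ck_on 0 f S = continuous_on S f"
| "Ck_on (Suc k) f S =
     ((\<forall>x\<in>S. f differentiable (at x)) \<and> (\<forall>h. Ck_on k (\<lambda>x. frechet_derivative f (at x) h) S))"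

text \<open>Functions of class \<open>C\<^sup>k\<close> up to the boundary are represented by functions that are
  of class \<open>C\<^sup>k\<close> on a neighbourhood, so that boundary derivatives are ordinary derivatives.\<close>

definition Ck_near :: "nat \<Rightarrow> ('a::euclidean_space \<Rightarrow> 'b::real_normed_vector) \<Rightarrow> 'a set \<Rightarrow> bool" where
  "Ck_near k f S \<longleftrightarrow> (\<exists>N. open N \<and> S \<subseteq> N \<and> Ck_on k f N)"

definition pd :: "2 \<Rightarrow> (real^2 \<Rightarrow> 'b::real_normed_vector) \<Rightarrow> real^2 \<Rightarrow> 'b" where
  "pd k f x = frechet_derivative f (at x) (axis k 1)"

definition grad :: "(real^2 \<Rightarrow> real) \<Rightarrow> real^2 \<Rightarrow> real^2" where
  "grad f x = (\<chi> k. pd k f x)"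

abbreviation Dm :: "(real^'n \<Rightarrow> real^'m) \<Rightarrow> real^'n \<Rightarrow> real^'n^'m" where
  "Dm f x \<equiv> jacobian f (at x)"

definition divg :: "(real^2 \<Rightarrow> real^2) \<Rightarrow> real^2 \<Rightarrow> real" where
  "divg X x = (\<Sum>k\<in>UNIV. pd k X x $ k)"

text \<open>A flux \<open>(f\<^sub>1, f\<^sub>2)\<close> is the \<open>4 \<times> 2\<close> matrix with columns \<open>f\<^sub>1, f\<^sub>2\<close>. Hence \<open>n \<cdot> F\<close> is
  \<open>F *v n\<close>, the field \<open>F \<cdot> v\<close> is \<open>v v* F\<close>, and \<open>\<Sum>\<^sub>k f\<^sub>k \<cdot> \<partial>\<^sub>k v\<close> is \<open>F \<bullet> Dm v x\<close>.\<close>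

definition divm :: "(real^2 \<Rightarrow> real^2^4) \<Rightarrow> real^2 \<Rightarrow> real^4" where
  "divm F x = (\<Sum>k\<in>UNIV. pd k (\<lambda>y. column k (F y)) x)"

definition div_tan :: "(real^2 \<Rightarrow> real^2) \<Rightarrow> real^2 \<Rightarrow> real^2 \<Rightarrow> real" where
  "div_tan W x n = divg W x - (Dm W x *v n) \<bullet> n"


section \<open>Domains with boundary, boundary integrals and perturbations\<close>

text \<open>The boundary is given by finitely many 1-periodic closed curves.\<close>

record fluid_domain =
  dom :: "(real^2) set"
  curves :: "(real \<Rightarrow> real^2) list"
  iso :: "(real^2) set"
  adia :: "(real^2) set"
  farfield :: "(real^2) set"

definition wall :: "fluid_domain \<Rightarrow> (real^2) set" where
  "wall d = iso d \<union> adia d"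

definition bdry :: "fluid_domain \<Rightarrow> (real^2) set" where
  "bdry d = (\<Union>\<gamma>\<in>set (curves d). range \<gamma>)"

definition curve_normal :: "(real \<Rightarrow> real^2) \<Rightarrow> real \<Rightarrow> real^2" where
  "curve_normal \<gamma> s = (let \<tau> = vector_derivative \<gamma> (at s)
     in (1 / norm \<tau>) *\<^sub>R vector [\<tau> $ 2, - (\<tau> $ 1)])"

text \<open>Arc-length integral over a part \<open>S\<close> of the boundary; the integrand may depend on the
  point and on the unit normal there.\<close>

definition bint :: "fluid_domain \<Rightarrow> (real^2) set \<Rightarrow> (real^2 \<Rightarrow> real^2 \<Rightarrow> real) \<Rightarrow> real" where
  "bint d S f = (\<Sum>\<gamma>\<leftarrow>curves d. set_lebesgue_integral lborel {0..1}
     (\<lambda>s. indicator S (\<gamma> s) * f (\<gamma> s) (curve_normal \<gamma> s) * norm (vector_derivative \<gamma> (at s))))"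

definition on_bdry :: "fluid_domain \<Rightarrow> (real^2) set \<Rightarrow> (real^2 \<Rightarrow> real^2 \<Rightarrow> bool) \<Rightarrow> bool" where
  "on_bdry d S P \<longleftrightarrow> (\<forall>\<gamma>\<in>set (curves d). \<forall>s. \<gamma> s \<in> S \<longrightarrow> P (\<gamma> s) (curve_normal \<gamma> s))"

text \<open>The last condition on each curve says that the domain lies locally on exactly one side,
  and that \<^const>\<open>curve_normal\<close> is the outward unit normal.\<close>

definition regular_domain :: "nat \<Rightarrow> fluid_domain \<Rightarrow> bool" where
  "regular_domain k d \<longleftrightarrow>
     open (dom d) \<and> connected (dom d) \<and> bounded (dom d) \<and> dom d \<noteq> {} \<and>
     frontier (dom d) = bdry d \<and>
     (\<forall>\<gamma>\<in>set (curves d).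
        Ck_on k \<gamma> UNIV \<and> (\<forall>s. \<gamma> (s + 1) = \<gamma> s) \<and> inj_on \<gamma> {0..<1} \<and>
        (\<forall>s. vector_derivative \<gamma> (at s) \<noteq> 0) \<and>
        (\<forall>s. \<exists>\<delta>>0. \<forall>r. 0 < r \<and> r < \<delta> \<longrightarrow>
           \<gamma> s - r *\<^sub>R curve_normal \<gamma> s \<in> dom d \<and> \<gamma> s + r *\<^sub>R curve_normal \<gamma> s \<notin> dom d)) \<and>
     (\<forall>i<length (curves d). \<forall>j<length (curves d). i \<noteq> j \<longrightarrow>
        range (curves d ! i) \<inter> range (curves d ! j) = {}) \<and>
     bdry d = wall d \<union> farfield d \<and> closed (wall d) \<and> closed (farfield d) \<and>
     wall d \<inter> farfield d = {} \<and>
     iso d \<inter> adia d = {} \<and> iso d \<in> sets borel \<and> adia d \<in> sets borel"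

definition perturb :: "(real^2 \<Rightarrow> real^2) \<Rightarrow> real \<Rightarrow> fluid_domain \<Rightarrow> fluid_domain" where
  "perturb V t d = (let \<Phi> = (\<lambda>x. x + t *\<^sub>R V x) in
     \<lparr> dom = \<Phi> ` dom d, curves = map (\<lambda>\<gamma>. \<Phi> \<circ> \<gamma>) (curves d),
       iso = \<Phi> ` iso d, adia = \<Phi> ` adia d, farfield = \<Phi> ` farfield d \<rparr>)"


section \<open>Function spaces\<close>

text \<open>A Hilbert space of functions on \<open>\<Omega>\<close>. Elements are represented by functions on the
  plane, so \<open>ip\<close> is definite only up to equality on \<open>\<Omega>\<close>.\<close>

definition hilbert_function_space ::
  "(real^2) set \<Rightarrow> ((real^2 \<Rightarrow> real) \<Rightarrow> (real^2 \<Rightarrow> real) \<Rightarrow> real) \<Rightarrow> (real^2 \<Rightarrow> real) set \<Rightarrow> bool" where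
  "hilbert_function_space \<Omega> ip X \<longleftrightarrow>
     (\<lambda>x. 0) \<in> X \<and>
     (\<forall>f\<in>X. \<forall>g\<in>X. (\<lambda>x. f x + g x) \<in> X) \<and>
     (\<forall>f\<in>X. \<forall>c. (\<lambda>x. c * f x) \<in> X) \<and>
     (\<forall>f\<in>X. \<forall>g\<in>X. ip f g = ip g f) \<and>
     (\<forall>f\<in>X. \<forall>g\<in>X. \<forall>h\<in>X. ip (\<lambda>x. f x + g x) h = ip f h + ip g h) \<and>
     (\<forall>f\<in>X. \<forall>g\<in>X. \<forall>c. ip (\<lambda>x. c * f x) g = c * ip f g) \<and>
     (\<forall>f\<in>X. 0 \<le> ip f f) \<and>
     (\<forall>f\<in>X. ip f f = 0 \<longleftrightarrow> (\<forall>x\<in>\<Omega>. f x = 0)) \<and>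
     (\<forall>F :: nat \<Rightarrow> real^2 \<Rightarrow> real. (\<forall>i. F i \<in> X) \<and>
        (\<forall>e>0. \<exists>M. \<forall>m\<ge>M. \<forall>n\<ge>M. ip (\<lambda>x. F m x - F n x) (\<lambda>x. F m x - F n x) < e)
        \<longrightarrow> (\<exists>f\<in>X. (\<lambda>n. ip (\<lambda>x. F n x - f x) (\<lambda>x. F n x - f x)) \<longlonglongrightarrow> 0))"

text \<open>Suitability: the elements are regular enough for the variational forms below to exist
  classically, membership depends only on the values on \<open>\<Omega>\<close>, test functions with compact
  support in \<open>\<Omega>\<close> belong to the space, and smooth cut-offs do not leave it. Sobolev spaces
  \<open>H\<^sup>s(\<Omega>)\<close> of high enough order are of this kind.\<close>

definition suitable_space :: "(real^2) set \<Rightarrow> (real^2 \<Rightarrow> real) set \<Rightarrow> bool" where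
  "suitable_space \<Omega> X \<longleftrightarrow>
     (\<forall>f\<in>X. Ck_near 2 f (closure \<Omega>)) \<and>
     (\<forall>f\<in>X. \<forall>g. Ck_near 2 g (closure \<Omega>) \<and> (\<forall>x\<in>\<Omega>. g x = f x) \<longrightarrow> g \<in> X) \<and>
     (\<forall>\<phi>. (\<forall>k. Ck_on k \<phi> UNIV) \<and> compact (closure {x. \<phi> x \<noteq> 0}) \<and>
        closure {x. \<phi> x \<noteq> 0} \<subseteq> \<Omega> \<longrightarrow> \<phi> \<in> X) \<and>
     (\<forall>f\<in>X. \<forall>\<phi>. (\<forall>k. Ck_on k \<phi> UNIV) \<longrightarrow> (\<lambda>x. \<phi> x * f x) \<in> X)"

definition prod_space :: "(4 \<Rightarrow> (real^2 \<Rightarrow> real) set) \<Rightarrow> (real^2 \<Rightarrow> real^4) set" where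
  "prod_space X = {w. \<forall>i. (\<lambda>x. w x $ i) \<in> X i}"


section \<open>Perfect gas and fluxes\<close>

record gas =
  gasR :: real
  cv :: real
  visc :: real
  cond :: real
  adiab :: real
  Prandtl :: real

text \<open>The state \<open>U\<close> is \<open>(\<rho>, \<rho> v\<^sub>1, \<rho> v\<^sub>2, \<rho> E)\<close>.\<close>

definition rho :: "real^4 \<Rightarrow> real" where "rho U = U $ 1"
definition vel :: "real^4 \<Rightarrow> real^2" where "vel U = vector [U $ 2 / U $ 1, U $ 3 / U $ 1]"
definition energy :: "real^4 \<Rightarrow> real" where "energy U = U $ 4 / U $ 1"
definition temp :: "gas \<Rightarrow> real^4 \<Rightarrow> real" where
  "temp g U = (energy U - (norm (vel U))\<^sup>2 / 2) / cv g"
definition pres :: "gas \<Rightarrow> real^4 \<Rightarrow> real" where "pres g U = rho U * gasR g * temp g U"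
definition enth :: "gas \<Rightarrow> real^4 \<Rightarrow> real" where "enth g U = energy U + pres g U / rho U"

definition perfect_gas :: "gas \<Rightarrow> bool" where
  "perfect_gas g \<longleftrightarrow> 0 < gasR g \<and> 0 < cv g \<and> 0 < visc g \<and> 0 < Prandtl g \<and>
     adiab g = (cv g + gasR g) / cv g \<and>
     (\<forall>U. 0 < rho U \<longrightarrow>
        temp g U * cond g = visc g * adiab g / Prandtl g * (energy U - (norm (vel U))\<^sup>2 / 2))"

definition stress :: "real \<Rightarrow> real^2^2 \<Rightarrow> real^2^2" where
  "stress \<mu> A = \<mu> *\<^sub>R (A + transpose A - (2/3 * trace A) *\<^sub>R mat 1)"

text \<open>\<open>A\<close> stands for the gradient of the state (column \<open>l\<close> is its \<open>l\<close>-th partial derivative);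
  gradients of velocity and temperature are expressed in \<open>U\<close> and \<open>A\<close> by the chain rule.\<close>

definition tau :: "gas \<Rightarrow> real^4 \<Rightarrow> real^2^4 \<Rightarrow> real^2^2" where
  "tau g U A = stress (visc g) (Dm vel U ** A)"

definition temp_grad :: "gas \<Rightarrow> real^4 \<Rightarrow> real^2^4 \<Rightarrow> real^2" where
  "temp_grad g U A = (\<chi> l. frechet_derivative (temp g) (at U) (column l A))"

definition fc :: "gas \<Rightarrow> 2 \<Rightarrow> real^4 \<Rightarrow> real^4" where
  "fc g k U = vector
     [rho U * vel U $ k,
      rho U * vel U $ 1 * vel U $ k + (if k = 1 then pres g U else 0),
      rho U * vel U $ 2 * vel U $ k + (if k = 2 then pres g U else 0),
      rho U * enth g U * vel U $ k]"

definition fv :: "gas \<Rightarrow> 2 \<Rightarrow> real^4 \<Rightarrow> real^2^4 \<Rightarrow> real^4" where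
  "fv g k U A = vector
     [0, tau g U A $ k $ 1, tau g U A $ k $ 2,
      (\<Sum>j\<in>UNIV. tau g U A $ k $ j * vel U $ j) + cond g * temp_grad g U A $ k]"

text \<open>The total flux \<open>F\<^sup>c - F\<^sup>v\<close>.\<close>

definition flux :: "gas \<Rightarrow> real^4 \<Rightarrow> real^2^4 \<Rightarrow> real^2^4" where
  "flux g U A = (\<chi> i k. (fc g k U - fv g k U A) $ i)"

definition flux_at :: "gas \<Rightarrow> (real^2 \<Rightarrow> real^4) \<Rightarrow> real^2 \<Rightarrow> real^2^4" where
  "flux_at g u x = flux g (u x) (Dm u x)"


section \<open>Linearised fluxes and their transposes\<close>

text \<open>\<open>flux_u g u k x\<close> is \<open>\<partial>\<^sub>u (f\<^sub>k\<^sup>c - f\<^sub>k\<^sup>v)\<close>, and \<open>visc_G g u k l x\<close> is \<open>G\<^sub>k\<^sub>l\<close>, both along \<open>u\<close>.\<close>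

definition flux_u :: "gas \<Rightarrow> (real^2 \<Rightarrow> real^4) \<Rightarrow> 2 \<Rightarrow> real^2 \<Rightarrow> real^4^4" where
  "flux_u g u k x = Dm (fc g k) (u x) - Dm (\<lambda>U. fv g k U (Dm u x)) (u x)"

definition visc_G :: "gas \<Rightarrow> (real^2 \<Rightarrow> real^4) \<Rightarrow> 2 \<Rightarrow> 2 \<Rightarrow> real^2 \<Rightarrow> real^4^4" where
  "visc_G g u k l x = matrix (\<lambda>h.
     frechet_derivative (fv g k (u x)) (at (Dm u x)) (\<chi> i j. if j = l then h $ i else 0))"

definition flux_uT_grad :: "gas \<Rightarrow> (real^2 \<Rightarrow> real^4) \<Rightarrow> (real^2 \<Rightarrow> real^4) \<Rightarrow> real^2 \<Rightarrow> real^4" where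
  "flux_uT_grad g u v x = (\<Sum>k\<in>UNIV. transpose (flux_u g u k x) *v pd k v x)"

definition n_flux_uT :: "gas \<Rightarrow> (real^2 \<Rightarrow> real^4) \<Rightarrow> (real^2 \<Rightarrow> real^4) \<Rightarrow> real^2 \<Rightarrow> real^2 \<Rightarrow> real^4" where
  "n_flux_uT g u v x n = (\<Sum>k\<in>UNIV. n $ k *\<^sub>R (transpose (flux_u g u k x) *v v x))"

definition visc_GT_grad :: "gas \<Rightarrow> (real^2 \<Rightarrow> real^4) \<Rightarrow> (real^2 \<Rightarrow> real^4) \<Rightarrow> real^2 \<Rightarrow> real^2^4" where
  "visc_GT_grad g u v x = (\<chi> i l. (\<Sum>k\<in>UNIV. transpose (visc_G g u k l x) *v pd k v x) $ i)"

definition n_visc_GT :: "gas \<Rightarrow> (real^2 \<Rightarrow> real^4) \<Rightarrow> (real^2 \<Rightarrow> real^4) \<Rightarrow> real^2 \<Rightarrow> real^2 \<Rightarrow> real^2^4" where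
  "n_visc_GT g u v x n = (\<chi> i l. (\<Sum>k\<in>UNIV. n $ k *\<^sub>R (transpose (visc_G g u k l x) *v v x)) $ i)"

definition lin_flux :: "gas \<Rightarrow> (real^2 \<Rightarrow> real^4) \<Rightarrow> (real^2 \<Rightarrow> real^4) \<Rightarrow> real^2 \<Rightarrow> real^2^4" where
  "lin_flux g u w x = (\<chi> i k.
     (flux_u g u k x *v w x - (\<Sum>l\<in>UNIV. visc_G g u k l x *v pd l w x)) $ i)"


section \<open>Navier--Stokes, linearised and adjoint problems\<close>

definition NS_variational ::
  "gas \<Rightarrow> fluid_domain \<Rightarrow> (real^2 \<Rightarrow> real^4) set \<Rightarrow> (real^2 \<Rightarrow> real^4) \<Rightarrow> bool" where
  "NS_variational g d H u \<longleftrightarrow> u \<in> H \<and> (\<forall>v\<in>H.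
     - set_lebesgue_integral lborel (dom d) (\<lambda>x. flux_at g u x \<bullet> Dm v x)
     + bint d (bdry d) (\<lambda>x n. (flux_at g u x *v n) \<bullet> v x) = 0)"

definition NS_strong :: "gas \<Rightarrow> fluid_domain \<Rightarrow> (real^2 \<Rightarrow> real^4) \<Rightarrow> bool" where
  "NS_strong g d u \<longleftrightarrow> (\<forall>x\<in>dom d. divm (flux_at g u) x = 0)"

definition wall_conditions ::
  "gas \<Rightarrow> fluid_domain \<Rightarrow> (real^2 \<Rightarrow> real) \<Rightarrow> (real^2 \<Rightarrow> real^4) \<Rightarrow> bool" where
  "wall_conditions g d TW u \<longleftrightarrow>
     on_bdry d (wall d) (\<lambda>x n. vel (u x) = 0) \<and>
     on_bdry d (adia d) (\<lambda>x n. grad (\<lambda>y. temp g (u y)) x \<bullet> n = 0) \<and>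
     on_bdry d (iso d) (\<lambda>x n. temp g (u x) = TW x)"

definition PSD ::
  "gas \<Rightarrow> fluid_domain \<Rightarrow> (real^2 \<Rightarrow> real^4) \<Rightarrow> (real^2 \<Rightarrow> real^4) \<Rightarrow> bool" where
  "PSD g d u u' \<longleftrightarrow> (\<forall>x\<in>dom d. divm (lin_flux g u u') x = 0)"

definition shape_deriv :: "(real \<Rightarrow> 'b::real_normed_vector) \<Rightarrow> 'b" where
  "shape_deriv f = vector_derivative f (at 0)"

text \<open>In \<open>VSD\<close> the whole family \<open>u\<close> of states is needed for the local shape derivative of the
  flux on the wall.\<close>

definition VSD ::
  "gas \<Rightarrow> fluid_domain \<Rightarrow> (real^2 \<Rightarrow> real^4) set \<Rightarrow> (real^2 \<Rightarrow> real^2) \<Rightarrow>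
   (real \<Rightarrow> real^2 \<Rightarrow> real^4) \<Rightarrow> (real^2 \<Rightarrow> real^4) \<Rightarrow> bool" where
  "VSD g d H V u u' \<longleftrightarrow> u' \<in> H \<and> (\<forall>v\<in>H.
     0 = - set_lebesgue_integral lborel (dom d) (\<lambda>x. u' x \<bullet> flux_uT_grad g (u 0) v x)
         - bint d (wall d) (\<lambda>x n. ((V x \<bullet> n) *\<^sub>R flux_at g (u 0) x) \<bullet> Dm v x)
         - set_lebesgue_integral lborel (dom d) (\<lambda>x. u' x \<bullet> divm (visc_GT_grad g (u 0) v) x)
         + bint d (bdry d) (\<lambda>x n. u' x \<bullet> (visc_GT_grad g (u 0) v x *v n))
         + bint d (bdry d - wall d) (\<lambda>x n. u' x \<bullet> n_flux_uT g (u 0) v x n)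
         - bint d (bdry d - wall d) (\<lambda>x n. Dm u' x \<bullet> n_visc_GT g (u 0) v x n)
         + bint d (wall d) (\<lambda>x n. (shape_deriv (\<lambda>t. flux_at g (u t) x) *v n) \<bullet> v x)
         + bint d (wall d) (\<lambda>x n. (V x \<bullet> n) * divg (\<lambda>y. v y v* flux_at g (u 0) y) x))"

definition drag_lift ::
  "gas \<Rightarrow> real \<Rightarrow> real^2 \<Rightarrow> fluid_domain \<Rightarrow> (real^2 \<Rightarrow> real^4) \<Rightarrow> real" where
  "drag_lift g C \<psi> d u =
     1 / C * bint d (wall d) (\<lambda>x n. (pres g (u x) *\<^sub>R n - tau g (u x) (Dm u x) *v n) \<bullet> \<psi>)"

definition drag_lift_deriv ::
  "gas \<Rightarrow> real \<Rightarrow> real^2 \<Rightarrow> fluid_domain \<Rightarrow> (real^2 \<Rightarrow> real^4) \<Rightarrow> (real^2 \<Rightarrow> real^4) \<Rightarrow> real" where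
  "drag_lift_deriv g C \<psi> d u w =
     bint d (wall d) (\<lambda>x n. 1 / C *
       ((frechet_derivative (pres g) (at (u x)) (w x) *\<^sub>R n
         - frechet_derivative (\<lambda>U. tau g U (Dm u x)) (at (u x)) (w x) *v n) \<bullet> \<psi>))
     - bint d (wall d) (\<lambda>x n. 1 / C *
       ((frechet_derivative (tau g (u x)) (at (Dm u x)) (Dm w x) *v n) \<bullet> \<psi>))"

text \<open>Test spaces \<open>W\<close> of the adjoint problem. The choice \<open>W = H\<close> is included; smaller \<open>W\<close>
  may constrain the variations on the wall (tested with all wall traces, the adjoint problem
  together with its boundary conditions is overdetermined), but test functions with compact
  support in \<open>\<Omega>\<close> and those supported near the far field are always admitted.\<close>

definition adjoint_test_space ::
  "fluid_domain \<Rightarrow> (real^2 \<Rightarrow> real^4) set \<Rightarrow> (real^2 \<Rightarrow> real^4) set \<Rightarrow> bool" where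
  "adjoint_test_space d H W \<longleftrightarrow> W \<subseteq> H \<and>
     (\<forall>w\<in>H. (\<exists>O'. open O' \<and> wall d \<subseteq> O' \<and> (\<forall>x\<in>O'. w x = 0)) \<longrightarrow> w \<in> W)"

definition adjoint_problem ::
  "gas \<Rightarrow> real \<Rightarrow> real^2 \<Rightarrow> fluid_domain \<Rightarrow> (real^2 \<Rightarrow> real^4) set \<Rightarrow>
   (real^2 \<Rightarrow> real^4) set \<Rightarrow> (real^2 \<Rightarrow> real^4) \<Rightarrow> (real^2 \<Rightarrow> real^4) \<Rightarrow> bool" where
  "adjoint_problem g C \<psi> d H W u z \<longleftrightarrow> z \<in> H \<and> (\<forall>w\<in>W.
     - set_lebesgue_integral lborel (dom d) (\<lambda>x. w x \<bullet> flux_uT_grad g u z x)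
     - set_lebesgue_integral lborel (dom d) (\<lambda>x. w x \<bullet> divm (visc_GT_grad g u z) x)
     + bint d (bdry d) (\<lambda>x n. w x \<bullet> (visc_GT_grad g u z x *v n))
     + bint d (bdry d) (\<lambda>x n. w x \<bullet> n_flux_uT g u z x n)
     - bint d (bdry d) (\<lambda>x n. Dm w x \<bullet> n_visc_GT g u z x n)
     = drag_lift_deriv g C \<psi> d u w)"

definition z23 :: "(real^2 \<Rightarrow> real^4) \<Rightarrow> real^2 \<Rightarrow> real^2" where
  "z23 z x = vector [z x $ 2, z x $ 3]"

definition adjoint_conditions ::
  "real \<Rightarrow> real^2 \<Rightarrow> fluid_domain \<Rightarrow> (real^2 \<Rightarrow> real^4) \<Rightarrow> bool" where
  "adjoint_conditions C \<psi> d z \<longleftrightarrow>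
     on_bdry d (wall d) (\<lambda>x n. z23 z x = (1 / C) *\<^sub>R \<psi>) \<and>
     on_bdry d (iso d) (\<lambda>x n. z x $ 4 = 0) \<and>
     on_bdry d (adia d) (\<lambda>x n. grad (\<lambda>y. z y $ 4) x \<bullet> n = 0)"

definition normal_deriv :: "(real^2 \<Rightarrow> 'b::real_normed_vector) \<Rightarrow> real^2 \<Rightarrow> real^2 \<Rightarrow> 'b" where
  "normal_deriv f x n = frechet_derivative f (at x) n"

definition normal_deriv2 :: "(real^2 \<Rightarrow> real) \<Rightarrow> real^2 \<Rightarrow> real^2 \<Rightarrow> real" where
  "normal_deriv2 f x n = (Dm (grad f) x *v n) \<bullet> n"

text \<open>The perturbation fields: \<open>C\<^sup>k\<close> with compact support in the hold-all \<open>D\<close>, vanishing near the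
  far field, and normal on the wall.\<close>

definition perturbation_field ::
  "nat \<Rightarrow> (real^2) set \<Rightarrow> fluid_domain \<Rightarrow> (real^2 \<Rightarrow> real^2) \<Rightarrow> bool" where
  "perturbation_field k D d V \<longleftrightarrow>
     Ck_on k V UNIV \<and> compact (closure {x. V x \<noteq> 0}) \<and> closure {x. V x \<noteq> 0} \<subseteq> D \<and>
     (\<exists>W. open W \<and> farfield d \<subseteq> W \<and> (\<forall>x\<in>W. V x = 0)) \<and>
     on_bdry d (wall d) (\<lambda>x n. V x = (V x \<bullet> n) *\<^sub>R n)"

text \<open>The states \<open>u t\<close> on the perturbed domains, extended regularly to a common neighbourhood
  \<open>N\<close> and in \<open>t\<close> to both sides of \<open>0\<close>, so that \<open>u'\<close> is an ordinary partial derivative.\<close>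

definition regular_family ::
  "real \<Rightarrow> (real^2) set \<Rightarrow> fluid_domain \<Rightarrow> (real^2 \<Rightarrow> real^2) \<Rightarrow> (real \<Rightarrow> real^2 \<Rightarrow> real^4) \<Rightarrow> bool" where
  "regular_family \<epsilon> N d V u \<longleftrightarrow> 0 < \<epsilon> \<and> open N \<and>
     (\<forall>t\<in>{0..<\<epsilon>}. closure (dom (perturb V t d)) \<subseteq> N) \<and>
     Ck_on 3 (\<lambda>(t, x). u t x) ({-\<epsilon><..<\<epsilon>} \<times> N) \<and>
     (\<forall>t\<in>{-\<epsilon><..<\<epsilon>}. \<forall>x\<in>N. 0 < rho (u t x))"

end

theory Submission
  imports Defs
begin

text \<open>
  The states extend smoothly in time and space, so the drag coefficient of the perturbed domain is
  a sum of parameter integrals over fixed intervals. Its derivative is the wall integral of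
  \<open>Y' \<cdot> n + (V \<cdot> n) div Y\<close>, where \<open>Y \<cdot> n\<close> is the density of the coefficient
  (\<open>flux_shape_derivative\<close>). Because \<open>v = 0\<close> on the wall, \<open>Y\<close> is there, to first order, the momentum
  flux paired with \<open>\<psi>/C\<close>, that is with the wall values of \<open>z\<^sub>2\<^sub>,\<^sub>3\<close>. It remains to compute the
  momentum part of the integral of \<open>F' n \<cdot> z\<close>, where \<open>F'\<close> is the local shape derivative of the flux.

  Pairing the linearised equation with \<open>z\<close> gives exactly one relation on the wall:
  \<open>F' n \<cdot> z + u' \<cdot> (G\<^sup>T \<nabla>z) n + (V \<cdot> n) z \<cdot> div F\<close> has integral zero (\<open>wall_term\<close>). In the variational
  approach this is the equation for \<open>u'\<close> tested with \<open>z\<close>; in the pointwise approach it is the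
  divergence theorem for the field \<open>z \<cdot> F' + u' \<cdot> G\<^sup>T \<nabla>z\<close>, together with \<open>div F = 0\<close> on the wall. In both
  cases the volume and far-field terms cancel by the adjoint problem, tested with \<open>u'\<close> times
  functions that vanish near the wall (\<open>adjoint_far_field\<close>).

  The relation contains \<open>v'\<close>, \<open>T'\<close> and \<open>\<nabla>T'\<close> on the wall. Differentiating the boundary conditions
  along the moving wall expresses \<open>v'\<close> and \<open>T'\<close> by normal derivatives. For \<open>\<nabla>T' \<cdot> n\<close> also the normal
  moves, and an integration by parts along the wall produces the tangential divergence
  (\<open>adiabatic_by_parts\<close>). Collecting terms (\<open>wall_identity\<close>) gives the formula with its last line,
  which is the residual \<open>(V \<cdot> n) z \<cdot> div F\<close> without its momentum part, and which therefore vanishes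
  when the flow equations hold pointwise.

  The boundary is merely \<open>C\<^sup>1\<close>, so the divergence theorem and all integrations by parts work with
  parametrised curves. The common tool is the planar identity \<open>trace_identity\<close>.
\<close>

section \<open>Calculus of \<open>C\<^sup>k\<close> functions\<close>

lemma Ck_on_subset: "Ck_on k f S \<Longrightarrow> T \<subseteq> S \<Longrightarrow> Ck_on k f T"
  by (induction k arbitrary: f) (auto intro: continuous_on_subset)

lemma Ck_on_imp_continuous_on: "Ck_on k f S \<Longrightarrow> continuous_on S f"
  by (cases k) (auto intro!: continuous_at_imp_continuous_on differentiable_imp_continuous_within)

lemma Ck_on_SucD: "Ck_on (Suc k) f S \<Longrightarrow> Ck_on k f S"
proof (induction k arbitrary: f)
  case 0
  then show ?case using Ck_on_imp_continuous_on[OF 0] by simp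
qed auto

lemma Ck_on_le: "Ck_on k f S \<Longrightarrow> j \<le> k \<Longrightarrow> Ck_on j f S"
  by (induction k) (auto simp: le_Suc_eq dest: Ck_on_SucD simp del: Ck_on.simps(2))

lemma Ck_on_has_derivative:
  "Ck_on (Suc k) f S \<Longrightarrow> x \<in> S \<Longrightarrow> (f has_derivative frechet_derivative f (at x)) (at x)"
  using frechet_derivative_works by auto

lemma Ck_on_derivative:
  "Ck_on (Suc k) f S \<Longrightarrow> Ck_on k (\<lambda>x. frechet_derivative f (at x) h) S"
  by auto

lemma Ck_on_cong_imp:
  assumes "open S" "\<And>x. x \<in> S \<Longrightarrow> f x = g x" "Ck_on k f S"
  shows "Ck_on k g S"
  using assms(2,3)
proof (induction k arbitrary: f g)
  case 0
  then show ?case using continuous_on_cong by force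
next
  case (Suc k)
  have der: "(g has_derivative frechet_derivative f (at x)) (at x)" if "x \<in> S" for x
    using has_derivative_transform_within_open[OF Ck_on_has_derivative[OF Suc.prems(2) that] assms(1) that]
      Suc.prems(1) by auto
  have eq: "frechet_derivative f (at x) = frechet_derivative g (at x)" if "x \<in> S" for x
    using frechet_derivative_at[OF der[OF that]] .
  have "Ck_on k (\<lambda>x. frechet_derivative g (at x) h) S" for h
    by (rule Suc.IH[OF _ Ck_on_derivative[OF Suc.prems(2)]]) (simp add: eq)
  then show ?case using der by (auto simp: differentiable_def)
qed

lemma Ck_on_SucI:
  assumes "open S" "\<And>x. x \<in> S \<Longrightarrow> (f has_derivative f' x) (at x)" "\<And>h. Ck_on k (\<lambda>x. f' x h) S"
  shows "Ck_on (Suc k) f S"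
proof -
  have "Ck_on k (\<lambda>x. frechet_derivative f (at x) h) S" for h
    by (rule Ck_on_cong_imp[OF assms(1) _ assms(3)[of h]])
      (simp add: frechet_derivative_at[OF assms(2), symmetric])
  then show ?thesis using assms(2) by (auto simp: differentiable_def)
qed

lemma Ck_on_const: "open S \<Longrightarrow> Ck_on k (\<lambda>x. c) S"
proof (induction k arbitrary: c)
  case (Suc k)
  then show ?case by (intro Ck_on_SucI[where f'="\<lambda>x h. 0"]) auto
qed auto

lemma Ck_on_linear:
  assumes L: "bounded_linear L" and S: "open S" and f: "Ck_on k f S"
  shows "Ck_on k (\<lambda>x. L (f x)) S"
  using f
proof (induction k arbitrary: f)
  case 0
  then show ?case using continuous_on_compose2[OF linear_continuous_on[OF L, of UNIV]] by auto
next
  case (Suc k)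
  show ?case
    by (rule Ck_on_SucI[OF S bounded_linear.has_derivative[OF L Ck_on_has_derivative[OF Suc.prems]]])
      (simp_all add: Suc.IH[OF Ck_on_derivative[OF Suc.prems]])
qed

lemma Ck_on_ident: "open S \<Longrightarrow> Ck_on k (\<lambda>x. x) S"
proof (cases k)
  case (Suc k)
  assume "open S"
  then show ?thesis unfolding Suc
    by (intro Ck_on_SucI[where f'="\<lambda>x h. h"]) (auto intro: Ck_on_const)
qed auto

lemma Ck_on_bounded_linear: "bounded_linear L \<Longrightarrow> open S \<Longrightarrow> Ck_on k L S"
  using Ck_on_linear[OF _ _ Ck_on_ident] by blast

lemma Ck_on_add:
  assumes S: "open S" and f: "Ck_on k f S" and g: "Ck_on k g S"
  shows "Ck_on k (\<lambda>x. f x + g x) S"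
  using f g
proof (induction k arbitrary: f g)
  case 0
  then show ?case by (auto intro: continuous_intros)
next
  case (Suc k)
  show ?case
    by (rule Ck_on_SucI[OF S has_derivative_add[OF Ck_on_has_derivative[OF Suc.prems(1)]
            Ck_on_has_derivative[OF Suc.prems(2)]]])
      (simp_all add: Suc.IH[OF Ck_on_derivative[OF Suc.prems(1)] Ck_on_derivative[OF Suc.prems(2)]])
qed

lemma Ck_on_bilinear:
  assumes B: "bounded_bilinear B" and S: "open S" and f: "Ck_on k f S" and g: "Ck_on k g S"
  shows "Ck_on k (\<lambda>x. B (f x) (g x)) S"
  using f g
proof (induction k arbitrary: f g)
  case 0
  then show ?case by (auto intro: bounded_bilinear.continuous_on[OF B])
next
  case (Suc k)
  show ?case
    by (rule Ck_on_SucI[OF S bounded_bilinear.FDERIV[OF B Ck_on_has_derivative[OF Suc.prems(1)]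
            Ck_on_has_derivative[OF Suc.prems(2)]]])
      (simp_all add: Ck_on_add[OF S Suc.IH[OF Ck_on_SucD[OF Suc.prems(1)] Ck_on_derivative[OF Suc.prems(2)]]
           Suc.IH[OF Ck_on_derivative[OF Suc.prems(1)] Ck_on_SucD[OF Suc.prems(2)]]])
qed

lemmas Ck_on_mult = Ck_on_bilinear[OF bounded_bilinear_mult]
lemmas Ck_on_scaleR = Ck_on_bilinear[OF bounded_bilinear_scaleR]
lemmas Ck_on_inner = Ck_on_bilinear[OF bounded_bilinear_inner]
lemmas Ck_on_minus = Ck_on_linear[OF bounded_linear_minus[OF bounded_linear_ident]]
lemmas Ck_on_nth = Ck_on_linear[OF bounded_linear_vec_nth]

lemma Ck_on_diff: "open S \<Longrightarrow> Ck_on k f S \<Longrightarrow> Ck_on k g S \<Longrightarrow> Ck_on k (\<lambda>x. f x - g x) S"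
  using Ck_on_add[of S k f "\<lambda>x. - g x"] Ck_on_minus[of S k g] by simp

lemma Ck_on_sum:
  "open S \<Longrightarrow> (\<And>i. i \<in> I \<Longrightarrow> Ck_on k (f i) S) \<Longrightarrow> Ck_on k (\<lambda>x. \<Sum>i\<in>I. f i x) S"
  by (induction I rule: infinite_finite_induct) (auto intro!: Ck_on_const Ck_on_add)

text \<open>The predicate \<^const>\<open>Ck_on\<close> speaks of directional derivatives only, so the chain rule is
  expanded in a basis; then every factor is covered by the induction hypothesis.\<close>

lemma Ck_on_compose:
  assumes S: "open S" and T: "f ` S \<subseteq> T" and f: "Ck_on k f S" and g: "Ck_on k g T"
  shows "Ck_on k (\<lambda>x. g (f x)) S"
  using f g
proof (induction k arbitrary: g)
  case 0
  then show ?case using T by (auto intro: continuous_on_compose2)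
next
  case (Suc k)
  let ?D = "\<lambda>x h. \<Sum>b\<in>Basis. (frechet_derivative f (at x) h \<bullet> b) *\<^sub>R frechet_derivative g (at (f x)) b"
  have "((\<lambda>x. g (f x)) has_derivative ?D x) (at x)" if x: "x \<in> S" for x
  proof -
    have fx: "f x \<in> T" using T x by auto
    have lin: "linear (frechet_derivative g (at (f x)))"
      using Ck_on_has_derivative[OF Suc.prems(2) fx] has_derivative_linear by blast
    have "frechet_derivative g (at (f x)) (frechet_derivative f (at x) h) = ?D x h" for h
      by (subst euclidean_representation[of "frechet_derivative f (at x) h", symmetric])
        (simp add: linear_sum[OF lin] linear_cmul[OF lin])
    then show ?thesis
      using has_derivative_compose[OF Ck_on_has_derivative[OF Suc.prems(1) x] Ck_on_has_derivative[OF Suc.prems(2) fx]]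
      by simp
  qed
  then show ?case
  proof (rule Ck_on_SucI[OF S])
    show "Ck_on k (\<lambda>x. ?D x h) S" for h
      by (intro Ck_on_sum S Ck_on_scaleR Ck_on_inner Ck_on_const Suc.IH Ck_on_derivative Ck_on_SucD[OF Suc.prems(1)]
          Suc.prems)
  qed
qed

lemma Ck_on_inverse_real: "Ck_on k inverse {x::real. x \<noteq> 0}"
proof (induction k)
  case 0
  then show ?case by (auto intro: continuous_intros)
next
  case (Suc k)
  have op: "open {x::real. x \<noteq> 0}" by (simp add: open_Collect_neq)
  show ?case
  proof (rule Ck_on_SucI[OF op])
    show "(inverse has_derivative (\<lambda>h. - (inverse x * h * inverse x))) (at x)" if "x \<in> {x::real. x \<noteq> 0}" for x
      using that has_derivative_inverse' by fastforce
    show "Ck_on k (\<lambda>x::real. - (inverse x * h * inverse x)) {x. x \<noteq> 0}" for h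
      by (intro Ck_on_minus Ck_on_mult op Ck_on_const Suc.IH)
  qed
qed

lemma Ck_on_divide:
  fixes f g :: "_ \<Rightarrow> real"
  assumes "open S" "Ck_on k f S" "Ck_on k g S" "\<And>x. x \<in> S \<Longrightarrow> g x \<noteq> 0"
  shows "Ck_on k (\<lambda>x. f x / g x) S"
  unfolding divide_inverse
  by (intro Ck_on_mult assms Ck_on_compose[OF _ _ _ Ck_on_inverse_real]) (use assms(4) in auto)

lemma Ck_on_power:
  fixes f :: "_ \<Rightarrow> real"
  shows "open S \<Longrightarrow> Ck_on k f S \<Longrightarrow> Ck_on k (\<lambda>x. f x ^ n) S"
  by (induction n) (auto intro: Ck_on_const Ck_on_mult)

lemma Ck_on_prod:
  fixes f :: "_ \<Rightarrow> _ \<Rightarrow> real"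
  shows "open S \<Longrightarrow> (\<And>i. i \<in> I \<Longrightarrow> Ck_on k (f i) S) \<Longrightarrow> Ck_on k (\<lambda>x. \<Prod>i\<in>I. f i x) S"
  by (induction I rule: infinite_finite_induct) (auto intro!: Ck_on_const Ck_on_mult)

lemma Ck_on_componentwise:
  fixes f :: "'a::euclidean_space \<Rightarrow> 'b::euclidean_space"
  assumes "open S" "\<And>b. b \<in> Basis \<Longrightarrow> Ck_on k (\<lambda>x. f x \<bullet> b) S"
  shows "Ck_on k f S"
proof -
  have "Ck_on k (\<lambda>x. \<Sum>b\<in>Basis. (f x \<bullet> b) *\<^sub>R b) S"
    by (intro Ck_on_sum assms Ck_on_scaleR Ck_on_const)
  then show ?thesis by (simp add: euclidean_representation)
qed

lemma Ck_on_vec: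
  fixes f :: "'a::euclidean_space \<Rightarrow> ('b::euclidean_space)^'n"
  assumes S: "open S" and f: "\<And>i. Ck_on k (\<lambda>x. f x $ i) S"
  shows "Ck_on k f S"
proof (rule Ck_on_componentwise[OF S])
  fix b :: "'b^'n" assume "b \<in> Basis"
  then obtain i c where b: "b = axis i c" unfolding Basis_vec_def by auto
  have "Ck_on k (\<lambda>x. f x $ i \<bullet> c) S"
    by (intro Ck_on_inner S f Ck_on_const)
  then show "Ck_on k (\<lambda>x. f x \<bullet> b) S" by (simp add: b inner_axis)
qed

lemmas Ck_on_intros = Ck_on_const Ck_on_add Ck_on_diff Ck_on_mult Ck_on_scaleR Ck_on_inner Ck_on_sum
  Ck_on_power Ck_on_divide Ck_on_minus

text \<open>For \<open>C\<^sup>1\<close> functions the derivative is jointly continuous in base point and direction,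
  because it is a combination of finitely many directional derivatives.\<close>

lemma Ck_on_continuous_derivative:
  assumes f: "Ck_on (Suc k) f S" and a: "continuous_on A a" "a ` A \<subseteq> S"
    and h: "continuous_on A (h :: _ \<Rightarrow> 'a::euclidean_space)"
  shows "continuous_on A (\<lambda>y. frechet_derivative f (at (a y)) (h y))"
proof -
  have eq: "frechet_derivative f (at (a y)) (h y) = (\<Sum>b\<in>Basis. (h y \<bullet> b) *\<^sub>R frechet_derivative f (at (a y)) b)"
    if "y \<in> A" for y
  proof -
    have lin: "linear (frechet_derivative f (at (a y)))"
      using Ck_on_has_derivative[OF f, of "a y"] that a(2) has_derivative_linear by blast
    show ?thesis
      by (subst euclidean_representation[of "h y", symmetric])
        (simp add: linear_sum[OF lin] linear_cmul[OF lin])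
  qed
  have "continuous_on A (\<lambda>y. frechet_derivative f (at (a y)) b)" for b
    by (rule continuous_on_compose2[OF Ck_on_imp_continuous_on[OF Ck_on_derivative[OF f]] a])
  then have "continuous_on A (\<lambda>y. \<Sum>b\<in>Basis. (h y \<bullet> b) *\<^sub>R frechet_derivative f (at (a y)) b)"
    by (intro continuous_intros h)
  then show ?thesis using eq by (simp cong: continuous_on_cong)
qed

section \<open>Fluxes through translated curves\<close>

text \<open>The clockwise quarter turn. It sends the velocity of a boundary curve to the outward normal
  times the speed, so arc-length integrals of normal components become parameter integrals in
  which neither a square root nor a quotient occurs.\<close>

definition rot :: "real^2 \<Rightarrow> real^2" where
  "rot a = vector [a $ 2, - (a $ 1)]"

lemma rot_nth [simp]: "rot a $ 1 = a $ 2" "rot a $ 2 = - (a $ 1)"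
  by (simp_all add: rot_def)

lemma inner_2: "(a :: real^2) \<bullet> b = a $ 1 * b $ 1 + a $ 2 * b $ 2"
  by (simp add: inner_vec_def sum_2)

lemma vec_eq_2: "(a :: 'a^2) = b \<longleftrightarrow> a $ 1 = b $ 1 \<and> a $ 2 = b $ 2"
  by (simp add: vec_eq_iff forall_2)

lemma bounded_linear_rot: "bounded_linear rot"
  unfolding linear_conv_bounded_linear[symmetric]
  by (rule linearI) (simp_all add: vec_eq_2)

lemma inner_rot_rot: "rot a \<bullet> rot b = a \<bullet> b"
  by (simp add: inner_2)

lemma norm_rot: "norm (rot a) = norm a"
  by (simp add: norm_eq_sqrt_inner inner_rot_rot)

lemma rot_scaleR: "rot (c *\<^sub>R a) = c *\<^sub>R rot a" by (simp add: vec_eq_2)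
lemma curve_normal_eq: "curve_normal \<gamma> s = (1 / norm (vector_derivative \<gamma> (at s))) *\<^sub>R rot (vector_derivative \<gamma> (at s))"
  by (simp add: curve_normal_def Let_def rot_def)

lemma norm_curve_normal:
  "norm (vector_derivative \<gamma> (at s)) *\<^sub>R curve_normal \<gamma> s = rot (vector_derivative \<gamma> (at s))"
  by (auto simp: curve_normal_eq vec_eq_2)

lemma linear_decomp_2:
  fixes D :: "real^2 \<Rightarrow> 'b::real_vector"
  assumes "linear D" shows "D h = h $ 1 *\<^sub>R D (axis 1 1) + h $ 2 *\<^sub>R D (axis 2 1)"
proof -
  have "h = h $ 1 *\<^sub>R axis 1 1 + h $ 2 *\<^sub>R axis 2 1" by (simp add: vec_eq_2 axis_def)
  then have "D h = D (h $ 1 *\<^sub>R axis 1 1 + h $ 2 *\<^sub>R axis 2 1)" by simp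
  then show ?thesis by (simp add: linear_add[OF assms] linear_cmul[OF assms])
qed

lemma divg_eq:
  assumes "(Y has_derivative D) (at x)"
  shows "divg Y x = D (axis 1 1) $ 1 + D (axis 2 1) $ 2"
  by (simp add: divg_def sum_2 pd_def frechet_derivative_at[OF assms, symmetric])

text \<open>In the plane \<open>a \<bullet> rot b = det (a, b)\<close>, and \<open>det (D a, b) + det (a, D b) = tr D det (a, b)\<close>.
  With \<open>b\<close> tangential this exchanges the divergence for a derivative along the curve, and it
  replaces all geometry (curvature, tangential divergence) below.\<close>

lemma trace_identity:
  assumes D: "(Y has_derivative D) (at x)"
  shows "D a \<bullet> rot b = divg Y x * (a \<bullet> rot b) + D b \<bullet> rot a"
proof -
  have lin: "linear D" using D has_derivative_linear by blast
  show ?thesis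
    by (subst (1 2) linear_decomp_2[OF lin]) (simp add: divg_eq[OF D] inner_2 algebra_simps)
qed

lemma C1_curve:
  fixes \<gamma> :: "real \<Rightarrow> 'b::real_normed_vector"
  assumes "Ck_on (Suc k) \<gamma> S" "s \<in> S"
  shows "(\<gamma> has_vector_derivative vector_derivative \<gamma> (at s)) (at s)"
  using assms by (simp add: vector_derivative_works)

lemma C1_curve_continuous:
  fixes \<gamma> :: "real \<Rightarrow> 'b::real_normed_vector"
  assumes "Ck_on (Suc k) \<gamma> S" "A \<subseteq> S"
  shows "continuous_on A (\<lambda>s. vector_derivative \<gamma> (at s))"
proof -
  have "vector_derivative \<gamma> (at s) = frechet_derivative \<gamma> (at s) 1" if "s \<in> A" for s
    by (metis assms C1_curve frechet_derivative_at has_vector_derivative_def scaleR_one subsetD that)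
  moreover have "continuous_on A (\<lambda>s. frechet_derivative \<gamma> (at s) 1)"
    using Ck_on_imp_continuous_on[OF Ck_on_derivative[OF assms(1)]] assms(2) continuous_on_subset by blast
  ultimately show ?thesis by (simp cong: continuous_on_cong)
qed

lemma C1_continuous_divg:
  assumes "Ck_on (Suc k) Y N" "A \<subseteq> N" shows "continuous_on A (divg Y)"
proof -
  have "continuous_on A (\<lambda>x. frechet_derivative Y (at x) (axis k 1))" for k
    by (rule continuous_on_subset[OF Ck_on_imp_continuous_on[OF Ck_on_derivative[OF assms(1)]] assms(2)])
  then show ?thesis unfolding divg_def pd_def by (intro continuous_intros)
qed

text \<open>Translate a curve in a transversal direction \<open>e\<close> and differentiate the flux through it: by the
  trace identity the derivative is the integral of the divergence plus that of a total derivative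
  along the curve. Working in the parameter of the curve, this covers \<open>C\<^sup>1\<close> curves in any
  position.\<close>

lemma strip_integral:
  fixes \<gamma> :: "real \<Rightarrow> real^2" and Y :: "real^2 \<Rightarrow> real^2" and e :: "real^2"
  assumes \<gamma>: "Ck_on (Suc 0) \<gamma> UNIV" and Y: "Ck_on (Suc 0) Y N" and "a \<le> b" "c \<le> R"
    and N: "\<And>s r. s \<in> {a..b} \<Longrightarrow> r \<in> {c..R} \<Longrightarrow> \<gamma> s + r *\<^sub>R e \<in> N"
    and sides: "\<And>r. r \<in> {c..R} \<Longrightarrow> Y (\<gamma> a + r *\<^sub>R e) = 0" "\<And>r. r \<in> {c..R} \<Longrightarrow> Y (\<gamma> b + r *\<^sub>R e) = 0"
    and top: "\<And>s. s \<in> {a..b} \<Longrightarrow> Y (\<gamma> s + R *\<^sub>R e) = 0"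
  shows "integral {c..R} (\<lambda>r. integral {a..b} (\<lambda>s. - (e \<bullet> rot (vector_derivative \<gamma> (at s))) * divg Y (\<gamma> s + r *\<^sub>R e)))
       = integral {a..b} (\<lambda>s. Y (\<gamma> s + c *\<^sub>R e) \<bullet> rot (vector_derivative \<gamma> (at s)))"
proof -
  define \<gamma>' where "\<gamma>' s = vector_derivative \<gamma> (at s)" for s
  define D where "D x = frechet_derivative Y (at x)" for x
  have d\<gamma>: "(\<gamma> has_vector_derivative \<gamma>' s) (at s)" for s
    unfolding \<gamma>'_def using C1_curve[OF \<gamma>] by simp
  have c\<gamma>: "continuous_on A \<gamma>" for A
    using Ck_on_imp_continuous_on[OF \<gamma>] continuous_on_subset by blast
  have c\<gamma>': "continuous_on A \<gamma>'" for A
    unfolding \<gamma>'_def using C1_curve_continuous[OF \<gamma>] by auto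
  have dY: "(Y has_derivative D x) (at x)" if "x \<in> N" for x
    unfolding D_def using Ck_on_has_derivative[OF Y that] .
  have linD: "linear (D x)" if "x \<in> N" for x using dY[OF that] has_derivative_linear by blast
  have cY: "continuous_on N Y" using Ck_on_imp_continuous_on[OF Y] .
  have crot: "continuous_on A (\<lambda>s. rot (f s))" if "continuous_on A f" for A and f :: "'z::topological_space \<Rightarrow> _"
    by (rule bounded_linear.continuous_on[OF bounded_linear_rot that])
  define G where "G r = integral {a..b} (\<lambda>s. Y (\<gamma> s + r *\<^sub>R e) \<bullet> rot (\<gamma>' s))" for r
  have leib: "(G has_vector_derivative integral {a..b} (\<lambda>s. D (\<gamma> s + r *\<^sub>R e) e \<bullet> rot (\<gamma>' s)))
      (at r within {c..R})" if r: "r \<in> {c..R}" for r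
    unfolding G_def cbox_interval[symmetric]
  proof (rule leibniz_rule_vector_derivative)
    fix x s assume "x \<in> cbox c R" "s \<in> cbox a b"
    then have N': "\<gamma> s + x *\<^sub>R e \<in> N" using N by auto
    have "((\<lambda>x. \<gamma> s + x *\<^sub>R e) has_derivative (\<lambda>h. h *\<^sub>R e)) (at x within cbox c R)"
      by (auto intro!: derivative_eq_intros)
    from has_derivative_compose[OF this dY[OF N']]
    have "((\<lambda>x. Y (\<gamma> s + x *\<^sub>R e) \<bullet> rot (\<gamma>' s)) has_derivative (\<lambda>h. D (\<gamma> s + x *\<^sub>R e) (h *\<^sub>R e) \<bullet> rot (\<gamma>' s))) (at x within cbox c R)"
      by (rule has_derivative_inner_left)
    then show "((\<lambda>x. Y (\<gamma> s + x *\<^sub>R e) \<bullet> rot (\<gamma>' s)) has_vector_derivative D (\<gamma> s + x *\<^sub>R e) e \<bullet> rot (\<gamma>' s))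
          (at x within cbox c R)"
      by (simp add: has_vector_derivative_def linear_cmul[OF linD[OF N']])
  next
    fix x assume "x \<in> cbox c R"
    then have "continuous_on (cbox a b) (\<lambda>s. Y (\<gamma> s + x *\<^sub>R e) \<bullet> rot (\<gamma>' s))"
      using N by (intro continuous_intros crot c\<gamma>' continuous_on_compose2[OF cY] c\<gamma>) auto
    then show "(\<lambda>s. Y (\<gamma> s + x *\<^sub>R e) \<bullet> rot (\<gamma>' s)) integrable_on cbox a b"
      by (rule integrable_continuous)
  next
    have 1: "continuous_on (cbox c R \<times> cbox a b) (\<lambda>y. \<gamma> (snd y) + fst y *\<^sub>R e)"
      by (intro continuous_intros continuous_on_compose2[OF c\<gamma>[of UNIV]]) auto
    have "continuous_on (cbox c R \<times> cbox a b) (\<lambda>y. D (\<gamma> (snd y) + fst y *\<^sub>R e) e)"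
      unfolding D_def
      by (rule Ck_on_continuous_derivative[OF Y 1]) (use N in \<open>auto\<close>)
    then have "continuous_on (cbox c R \<times> cbox a b) (\<lambda>y. D (\<gamma> (snd y) + fst y *\<^sub>R e) e \<bullet> rot (\<gamma>' (snd y)))"
      by (intro continuous_intros crot continuous_on_compose2[OF c\<gamma>'[of UNIV]]) auto
    then show "continuous_on (cbox c R \<times> cbox a b) (\<lambda>(x, s). D (\<gamma> s + x *\<^sub>R e) e \<bullet> rot (\<gamma>' s))"
      by (simp add: case_prod_beta)
  qed (use r in auto)
  have inner: "integral {a..b} (\<lambda>s. D (\<gamma> s + r *\<^sub>R e) e \<bullet> rot (\<gamma>' s))
       = integral {a..b} (\<lambda>s. (e \<bullet> rot (\<gamma>' s)) * divg Y (\<gamma> s + r *\<^sub>R e))" if r: "r \<in> {c..R}" for r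
  proof -
    have "((\<lambda>s. D (\<gamma> s + r *\<^sub>R e) (\<gamma>' s) \<bullet> rot e) has_integral
        Y (\<gamma> b + r *\<^sub>R e) \<bullet> rot e - Y (\<gamma> a + r *\<^sub>R e) \<bullet> rot e) {a..b}"
    proof (rule fundamental_theorem_of_calculus[OF \<open>a \<le> b\<close>])
      fix s assume s: "s \<in> {a..b}"
      note N' = N[OF s r]
      have "((\<lambda>s. \<gamma> s + r *\<^sub>R e) has_derivative (\<lambda>h. h *\<^sub>R \<gamma>' s)) (at s within {a..b})"
        using d\<gamma>[of s] unfolding has_vector_derivative_def
        by (auto intro!: derivative_eq_intros intro: has_derivative_at_withinI)
      from has_derivative_compose[OF this dY[OF N']]
      have "((\<lambda>s. Y (\<gamma> s + r *\<^sub>R e) \<bullet> rot e) has_derivative (\<lambda>h. D (\<gamma> s + r *\<^sub>R e) (h *\<^sub>R \<gamma>' s) \<bullet> rot e)) (at s within {a..b})"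
        by (rule has_derivative_inner_left)
      then show "((\<lambda>s. Y (\<gamma> s + r *\<^sub>R e) \<bullet> rot e) has_vector_derivative D (\<gamma> s + r *\<^sub>R e) (\<gamma>' s) \<bullet> rot e)
          (at s within {a..b})"
        by (simp add: has_vector_derivative_def linear_cmul[OF linD[OF N']])
    qed
    then have 0: "((\<lambda>s. D (\<gamma> s + r *\<^sub>R e) (\<gamma>' s) \<bullet> rot e) has_integral 0) {a..b}"
      using sides r by simp
    have "continuous_on {a..b} (\<lambda>s. divg Y (\<gamma> s + r *\<^sub>R e))"
      by (rule continuous_on_compose2[OF C1_continuous_divg[OF Y order_refl]])
        (use N[OF _ r] in \<open>auto intro!: continuous_intros c\<gamma>\<close>)
    then have "(\<lambda>s. (e \<bullet> rot (\<gamma>' s)) * divg Y (\<gamma> s + r *\<^sub>R e)) integrable_on {a..b}"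
      by (intro integrable_continuous_real continuous_intros crot c\<gamma>')
    from has_integral_add[OF integrable_integral[OF this] 0]
    have "((\<lambda>s. (e \<bullet> rot (\<gamma>' s)) * divg Y (\<gamma> s + r *\<^sub>R e) + D (\<gamma> s + r *\<^sub>R e) (\<gamma>' s) \<bullet> rot e) has_integral
      integral {a..b} (\<lambda>s. (e \<bullet> rot (\<gamma>' s)) * divg Y (\<gamma> s + r *\<^sub>R e))) {a..b}" by simp
    then have "((\<lambda>s. D (\<gamma> s + r *\<^sub>R e) e \<bullet> rot (\<gamma>' s)) has_integral
      integral {a..b} (\<lambda>s. (e \<bullet> rot (\<gamma>' s)) * divg Y (\<gamma> s + r *\<^sub>R e))) {a..b}"
      by (rule has_integral_eq[rotated]) (subst trace_identity[OF dY[OF N[OF _ r]]], auto simp: mult.commute)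
    then show ?thesis by (rule integral_unique)
  qed
  have "((\<lambda>r. integral {a..b} (\<lambda>s. (e \<bullet> rot (\<gamma>' s)) * divg Y (\<gamma> s + r *\<^sub>R e))) has_integral (G R - G c)) {c..R}"
    by (rule fundamental_theorem_of_calculus[OF \<open>c \<le> R\<close>]) (use leib inner in auto)
  moreover have "G R = 0" unfolding G_def by (rule integral_unique[OF has_integral_is_0]) (simp add: top)
  ultimately have "((\<lambda>r. integral {a..b} (\<lambda>s. (e \<bullet> rot (\<gamma>' s)) * divg Y (\<gamma> s + r *\<^sub>R e))) has_integral - G c) {c..R}"
    by simp
  from has_integral_neg[OF this]
  have "((\<lambda>r. integral {a..b} (\<lambda>s. - (e \<bullet> rot (\<gamma>' s)) * divg Y (\<gamma> s + r *\<^sub>R e))) has_integral G c) {c..R}"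
    by simp
  from integral_unique[OF this] show ?thesis unfolding G_def \<gamma>'_def .
qed

lemma integral_plane_iterated:
  fixes f :: "real^2 \<Rightarrow> real"
  assumes "continuous_on (cbox (vector [a, c]) (vector [b, d])) f"
  shows "integral (cbox (vector [a, c]) (vector [b, d])) f = integral {c..d} (\<lambda>r. integral {a..b} (\<lambda>s. f (vector [s, r])))"
proof -
  let ?g = "\<lambda>x::real^2. (x $ 2, x $ 1)" and ?h = "\<lambda>y::real\<times>real. vector [snd y, fst y] :: real^2"
  have him: "?h ` cbox u v = cbox (?h u) (?h v)" for u v
  proof -
    have "?h ` cbox u v \<subseteq> cbox (?h u) (?h v)" by (cases u; cases v) (auto simp: mem_box_cart forall_2)
    moreover have "y \<in> ?h ` cbox u v" if "y \<in> cbox (?h u) (?h v)" for y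
      by (rule image_eqI[of _ _ "?g y"]) (use that in \<open>cases u; cases v; auto simp: mem_box_cart forall_2 vec_eq_2\<close>)+
    ultimately show ?thesis by blast
  qed
  have gim: "?g ` cbox u v = cbox (?g u) (?g v)" for u v
  proof -
    have "?g ` cbox u v \<subseteq> cbox (?g u) (?g v)" by (auto simp: mem_box_cart forall_2)
    moreover have "y \<in> ?g ` cbox u v" if "y \<in> cbox (?g u) (?g v)" for y
      by (rule image_eqI[of _ _ "?h y"]) (use that in \<open>cases y; auto simp: mem_box_cart forall_2\<close>)+
    ultimately show ?thesis by blast
  qed
  have ch: "continuous_on A ?h" for A
    by (subst continuous_on_componentwise) (auto simp: Basis_vec_def inner_axis forall_2 intro!: continuous_intros)
  have cont: "continuous_on (cbox (c, a) (d, b)) (\<lambda>y. f (?h y))"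
    by (rule continuous_on_compose2[OF assms ch]) (auto simp: mem_box_cart forall_2)
  have "((\<lambda>y. f (?h y)) has_integral (1 / 1) *\<^sub>R integral (cbox (vector [a, c]) (vector [b, d])) f)
      (?g ` cbox (vector [a, c]) (vector [b, d]))"
  proof (rule has_integral_twiddle)
    show "continuous (at x) ?h" for x using ch[of UNIV] continuous_on_eq_continuous_at[OF open_UNIV] by blast
    show "measure lborel (?h ` cbox u v) = 1 * measure lborel (cbox u v)" for u v
    proof (cases "cbox u v = {}")
      case False
      obtain u1 u2 v1 v2 where uv: "u = (u1, u2)" "v = (v1, v2)" by (cases u; cases v)
      have le: "u1 \<le> v1" "u2 \<le> v2" using False by (simp_all add: uv cbox_Pair_eq)
      have "(vector [u2, u1] :: real^2) \<in> cbox (?h u) (?h v)"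
        using le by (simp add: uv mem_box_cart forall_2)
      then have "measure lborel (cbox (?h u) (?h v)) = (v2 - u2) * (v1 - u1)"
        by (subst content_cbox_cart) (auto simp: uv UNIV_2)
      moreover have "measure lborel (cbox u v) = (v1 - u1) * (v2 - u2)"
        unfolding uv content_Pair using le by simp
      ultimately show ?thesis unfolding him by simp
    qed simp
    show "\<exists>w z. ?h ` cbox u v = cbox w z" for u v using him by blast
    show "\<exists>w z. ?g ` cbox u v = cbox w z" for u v using gim by blast
    show "(f has_integral integral (cbox (vector [a, c]) (vector [b, d])) f) (cbox (vector [a, c]) (vector [b, d]))"
      using integrable_integral[OF integrable_continuous[OF assms]] .
  qed (simp_all add: vec_eq_2)
  then have "integral (cbox (c, a) (d, b)) (\<lambda>y. f (?h y)) = integral (cbox (vector [a, c]) (vector [b, d])) f"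
    unfolding gim by (simp add: integral_unique)
  with integral_prod_continuous[OF cont] show ?thesis by simp
qed

text \<open>The chart \<open>(s, r) \<mapsto> \<gamma> s + r e\<close> has the Jacobian \<open>- (e \<bullet> rot \<gamma>')\<close>, which is the weight in the
  preceding iterated integral.\<close>

lemma strip_area:
  fixes \<gamma> :: "real \<Rightarrow> real^2" and Y :: "real^2 \<Rightarrow> real^2" and e :: "real^2"
  assumes \<gamma>: "Ck_on (Suc 0) \<gamma> UNIV" and Y: "Ck_on (Suc 0) Y N" and "a < b" "c < R"
    and N: "\<And>s r. s \<in> {a..b} \<Longrightarrow> r \<in> {c..R} \<Longrightarrow> \<gamma> s + r *\<^sub>R e \<in> N"
    and sides: "\<And>r. r \<in> {c..R} \<Longrightarrow> Y (\<gamma> a + r *\<^sub>R e) = 0" "\<And>r. r \<in> {c..R} \<Longrightarrow> Y (\<gamma> b + r *\<^sub>R e) = 0"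
    and top: "\<And>s. s \<in> {a..b} \<Longrightarrow> Y (\<gamma> s + R *\<^sub>R e) = 0"
    and neg: "\<And>s. s \<in> {a..b} \<Longrightarrow> e \<bullet> rot (vector_derivative \<gamma> (at s)) < 0"
    and inj: "inj_on (\<lambda>w::real^2. \<gamma> (w $ 1) + w $ 2 *\<^sub>R e) (box (vector [a, c]) (vector [b, R]))"
  shows "(divg Y has_integral integral {a..b} (\<lambda>s. Y (\<gamma> s + c *\<^sub>R e) \<bullet> rot (vector_derivative \<gamma> (at s))))
      ((\<lambda>w::real^2. \<gamma> (w $ 1) + w $ 2 *\<^sub>R e) ` box (vector [a, c]) (vector [b, R]))"
proof -
  define \<gamma>' where "\<gamma>' s = vector_derivative \<gamma> (at s)" for s
  define \<Psi> where "\<Psi> w = \<gamma> (w $ 1) + w $ 2 *\<^sub>R e" for w :: "real^2"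
  define S where "S = box (vector [a, c]) (vector [b, R] :: real^2)"
  define J where "J w = - (e \<bullet> rot (\<gamma>' (w $ 1)))" for w :: "real^2"
  let ?cb = "cbox (vector [a, c]) (vector [b, R] :: real^2)"
  have d\<gamma>: "(\<gamma> has_vector_derivative \<gamma>' s) (at s)" for s
    unfolding \<gamma>'_def using C1_curve[OF \<gamma>] by simp
  have c\<gamma>: "continuous_on A \<gamma>" for A
    using Ck_on_imp_continuous_on[OF \<gamma>] continuous_on_subset by blast
  have c\<gamma>': "continuous_on A \<gamma>'" for A
    unfolding \<gamma>'_def using C1_curve_continuous[OF \<gamma>] by auto
  have c\<Psi>: "continuous_on ?cb \<Psi>" unfolding \<Psi>_def
    by (intro continuous_intros continuous_on_compose2[OF c\<gamma>[of UNIV]]) auto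
  have \<Psi>N: "\<Psi> w \<in> N" if "w \<in> ?cb" for w
    using that N unfolding \<Psi>_def by (auto simp: mem_box_cart forall_2)
  have cJ: "continuous_on ?cb (\<lambda>w. J w * divg Y (\<Psi> w))"
    unfolding J_def
    by (intro continuous_intros bounded_linear.continuous_on[OF bounded_linear_rot]
        continuous_on_compose2[OF c\<gamma>'[of UNIV]] continuous_on_compose2[OF C1_continuous_divg[OF Y order_refl] c\<Psi>])
      (use \<Psi>N in auto)
  have der: "(\<Psi> has_derivative (\<lambda>h. h $ 1 *\<^sub>R \<gamma>' (w $ 1) + h $ 2 *\<^sub>R e)) (at w within S)" for w
  proof -
    have 1: "((\<lambda>w::real^2. w $ 1) has_derivative (\<lambda>h. h $ 1)) (at w within S)"
      by (rule bounded_linear_imp_has_derivative[OF bounded_linear_vec_nth])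
    have 2: "((\<lambda>w::real^2. w $ 2) has_derivative (\<lambda>h. h $ 2)) (at w within S)"
      by (rule bounded_linear_imp_has_derivative[OF bounded_linear_vec_nth])
    show ?thesis unfolding \<Psi>_def
      using has_derivative_add[OF has_derivative_compose[OF 1 d\<gamma>[unfolded has_vector_derivative_def]]
          has_derivative_scaleR_left[OF 2]] by simp
  qed
  have J: "det (matrix (\<lambda>h::real^2. h $ 1 *\<^sub>R \<gamma>' (w $ 1) + h $ 2 *\<^sub>R e)) = J w" for w
    by (simp add: det_2 matrix_def J_def inner_2 axis_def)
  have Jabs: "\<bar>J w\<bar> = J w" if "w \<in> S" for w
    using neg[of "w $ 1"] that by (auto simp: J_def S_def mem_box_cart forall_2 \<gamma>'_def)
  let ?I = "integral {a..b} (\<lambda>s. Y (\<gamma> s + c *\<^sub>R e) \<bullet> rot (\<gamma>' s))"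
  have "integral S (\<lambda>w. J w * divg Y (\<Psi> w)) = integral ?cb (\<lambda>w. J w * divg Y (\<Psi> w))"
    unfolding S_def by (rule integral_open_interval)
  also have "\<dots> = integral {c..R} (\<lambda>r. integral {a..b} (\<lambda>s. J (vector [s, r]) * divg Y (\<Psi> (vector [s, r]))))"
    by (rule integral_plane_iterated[OF cJ])
  also have "\<dots> = ?I"
    unfolding J_def \<Psi>_def vector_2 \<gamma>'_def
    by (rule strip_integral[OF \<gamma> Y _ _ N sides top]) (use assms(3,4) in auto)
  finally have int: "integral S (\<lambda>w. J w * divg Y (\<Psi> w)) = ?I" .
  have ai: "(\<lambda>w. J w * divg Y (\<Psi> w)) absolutely_integrable_on S"
    by (rule set_integrable_subset[OF absolutely_integrable_continuous[OF cJ]])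
      (auto simp: S_def box_subset_cbox)
  have "(\<lambda>x. \<bar>det (matrix (\<lambda>h::real^2. h $ 1 *\<^sub>R \<gamma>' (x $ 1) + h $ 2 *\<^sub>R e))\<bar> *\<^sub>R (vec (divg Y (\<Psi> x)) :: real^1)) absolutely_integrable_on S \<and>
     integral S (\<lambda>x. \<bar>det (matrix (\<lambda>h::real^2. h $ 1 *\<^sub>R \<gamma>' (x $ 1) + h $ 2 *\<^sub>R e))\<bar> *\<^sub>R (vec (divg Y (\<Psi> x)) :: real^1)) = vec ?I
     \<longleftrightarrow> (\<lambda>x. vec (divg Y x) :: real^1) absolutely_integrable_on (\<Psi> ` S) \<and> integral (\<Psi> ` S) (\<lambda>x. vec (divg Y x) :: real^1) = vec ?I"
    by (rule has_absolute_integral_change_of_variables[OF _ der])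
      (use inj in \<open>auto simp: \<Psi>_def[abs_def] S_def\<close>)
  moreover have "(\<lambda>x. \<bar>J x\<bar> * divg Y (\<Psi> x)) absolutely_integrable_on S"
    using ai by (rule set_integrable_cong[THEN iffD1, rotated -1]) (auto simp: Jabs)
  moreover have "integral S (\<lambda>x. \<bar>J x\<bar> * divg Y (\<Psi> x)) = ?I"
    unfolding int[symmetric] by (rule integral_cong) (simp add: Jabs)
  ultimately have "(divg Y) absolutely_integrable_on (\<Psi> ` S)" "integral (\<Psi> ` S) (divg Y) = ?I"
    by (simp_all add: absolutely_integrable_on_1_iff integral_on_1_eq J)
  then show ?thesis
    unfolding \<Psi>_def S_def \<gamma>'_def
    using set_lebesgue_integral_eq_integral(1) has_integral_iff by blast
qed

section \<open>The divergence theorem for domains bounded by \<open>C\<^sup>1\<close> curves\<close>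

lemma has_integral_zero_off:
  fixes f :: "'a::euclidean_space \<Rightarrow> real"
  assumes "(f has_integral I) A" "A \<subseteq> B" "\<And>x. x \<in> B \<Longrightarrow> x \<notin> A \<Longrightarrow> f x = 0"
  shows "(f has_integral I) B"
proof -
  have "(\<lambda>x. if x \<in> B then f x else 0) = (\<lambda>x. if x \<in> A then f x else 0)"
    using assms(2,3) by (auto simp: fun_eq_iff)
  then show ?thesis using assms(1) has_integral_restrict_UNIV by metis
qed

lemma divg_zero_open:
  assumes "open S" "\<And>y. y \<in> S \<Longrightarrow> Y y = 0" "x \<in> S"
  shows "divg Y x = 0"
proof -
  have "(Y has_derivative (\<lambda>h. 0)) (at x)"
    by (rule has_derivative_transform_within_open[OF has_derivative_const assms(1,3)]) (simp add: assms(2))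
  then show ?thesis using divg_eq by fastforce
qed

definition flux_int :: "(real \<Rightarrow> real^2) \<Rightarrow> (real^2 \<Rightarrow> real^2) \<Rightarrow> real" where
  "flux_int \<gamma> Y = integral {0..1} (\<lambda>s. Y (\<gamma> s) \<bullet> rot (vector_derivative \<gamma> (at s)))"

lemma integral_periodic_shift:
  fixes f :: "real \<Rightarrow> real"
  assumes f: "continuous_on UNIV f" and per: "\<And>s. f (s + 1) = f s" and c: "0 \<le> c" "c \<le> 1"
  shows "integral {c..c + 1} f = integral {0..1} f"
proof -
  have int: "f integrable_on {a..b}" for a b
    using f continuous_on_subset integrable_continuous_real by blast
  have "(f has_integral integral {1..c+1} f) (cbox 1 (c + 1))" using int by (simp add: integrable_integral)
  from has_integral_affinity[OF this, of 1 1]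
  have "((\<lambda>x. f (x + 1)) has_integral integral {1..c+1} f) ((\<lambda>x. x - 1) ` {1..c+1})" by simp
  moreover have "(\<lambda>x. x - 1) ` {1..c+1} = {0..c}"
    using image_diff_atLeastAtMost[of 1 1 "c + 1"] by simp
  ultimately have "integral {0..c} f = integral {1..c+1} f"
    using per by (simp add: integral_unique)
  moreover have "integral {0..1} f = integral {0..c} f + integral {c..1} f"
    by (rule Henstock_Kurzweil_Integration.integral_combine[symmetric]) (use c int in auto)
  moreover have "integral {c..c+1} f = integral {c..1} f + integral {1..c+1} f"
    by (rule Henstock_Kurzweil_Integration.integral_combine[symmetric]) (use c int in auto)
  ultimately show ?thesis by simp
qed

lemma periodic_int:
  fixes \<gamma> :: "real \<Rightarrow> 'a"
  assumes per: "\<And>s. \<gamma> (s + 1) = \<gamma> s" shows "\<gamma> (s + of_int m) = \<gamma> s"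
proof (induction m rule: int_induct[where k=0])
  case (step1 i)
  then show ?case using per[of "s + of_int i"] by (simp add: algebra_simps)
next
  case (step2 i)
  then show ?case using per[of "s + of_int (i - 1)"] by (simp add: algebra_simps)
qed simp

lemma closed_curve_eqD:
  fixes \<gamma> :: "real \<Rightarrow> 'a"
  assumes per: "\<And>s. \<gamma> (s + 1) = \<gamma> s" and inj: "inj_on \<gamma> {0..<1}" and eq: "\<gamma> s = \<gamma> s'" and "\<bar>s - s'\<bar> < 1"
  shows "s = s'"
proof -
  have fr: "\<gamma> (frac t) = \<gamma> t" for t
    using periodic_int[of \<gamma> "frac t" "\<lfloor>t\<rfloor>", OF per] by (simp add: frac_def)
  have "frac s = frac s'"
    by (rule inj_onD[OF inj]) (auto simp: fr eq frac_lt_1)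
  then have eq: "s - s' = of_int (\<lfloor>s\<rfloor> - \<lfloor>s'\<rfloor>)" by (simp add: frac_def)
  then have "\<bar>\<lfloor>s\<rfloor> - \<lfloor>s'\<rfloor>\<bar> < 1" using assms(4) by linarith
  then show ?thesis using eq by simp
qed

lemma strip_inj:
  fixes \<gamma> :: "real \<Rightarrow> real^2" and e :: "real^2"
  assumes \<gamma>: "\<And>s. s \<in> {a..b} \<Longrightarrow> (\<gamma> has_vector_derivative \<gamma>' s) (at s)"
    and neg: "\<And>s. s \<in> {a..b} \<Longrightarrow> e \<bullet> rot (\<gamma>' s) < 0"
    and s: "s \<in> {a..b}" "s' \<in> {a..b}" and eq: "\<gamma> s + r *\<^sub>R e = \<gamma> s' + r' *\<^sub>R e"
  shows "s = s' \<and> r = r'"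
proof -
  have e: "e \<bullet> rot e = 0" "e \<noteq> 0" using neg[OF s(1)] by (auto simp: inner_2)
  have inc: "\<gamma> x \<bullet> rot e < \<gamma> y \<bullet> rot e" if "x < y" "x \<in> {a..b}" "y \<in> {a..b}" for x y
  proof (rule DERIV_pos_imp_increasing[OF that(1)])
    fix t assume "x \<le> t" "t \<le> y"
    then have t: "t \<in> {a..b}" using that by auto
    have "((\<lambda>s. \<gamma> s \<bullet> rot e) has_derivative (\<lambda>h. (h *\<^sub>R \<gamma>' t) \<bullet> rot e)) (at t)"
      by (rule has_derivative_inner_left[OF \<gamma>[OF t, unfolded has_vector_derivative_def]])
    then have "((\<lambda>s. \<gamma> s \<bullet> rot e) has_real_derivative \<gamma>' t \<bullet> rot e) (at t)"
      unfolding has_field_derivative_def by (rule has_derivative_eq_rhs) (simp add: fun_eq_iff)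
    moreover have "\<gamma>' t \<bullet> rot e > 0" using neg[OF t] by (simp add: inner_2 algebra_simps)
    ultimately show "\<exists>y. ((\<lambda>s. \<gamma> s \<bullet> rot e) has_real_derivative y) (at t) \<and> 0 < y" by blast
  qed
  have "\<gamma> s \<bullet> rot e = \<gamma> s' \<bullet> rot e"
    using arg_cong[OF eq, of "\<lambda>x. x \<bullet> rot e"] e by (simp add: inner_add_left)
  then have "s = s'" using inc[of s s'] inc[of s' s] s by (cases s s' rule: linorder_cases) auto
  with eq e show ?thesis by auto
qed

text \<open>The divergence theorem for fields that vanish on the domain outside a small ball; a partition
  of unity reduces the general case to it.\<close>

definition local_div :: "fluid_domain \<Rightarrow> real^2 \<Rightarrow> real \<Rightarrow> bool" where
  "local_div d p \<rho> \<longleftrightarrow> (\<forall>M Y. open M \<longrightarrow> closure (dom d) \<subseteq> M \<longrightarrow> Ck_on (Suc 0) Y M \<longrightarrow>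
     (\<forall>x\<in>closure (dom d). x \<notin> ball p \<rho> \<longrightarrow> Y x = 0) \<longrightarrow>
     (divg Y has_integral (\<Sum>\<gamma>\<leftarrow>curves d. flux_int \<gamma> Y)) (dom d))"

lemma flux_int_zero: "(\<And>s. Y (\<gamma> s) = 0) \<Longrightarrow> flux_int \<gamma> Y = 0"
  by (simp add: flux_int_def)

lemma divg_zero_off_ball:
  assumes "open (dom d)" "\<forall>x\<in>closure (dom d). x \<notin> ball p \<rho> \<longrightarrow> Y x = 0" "x \<in> dom d" "x \<notin> cball p \<rho>"
  shows "divg Y x = 0"
proof (rule divg_zero_open)
  show "open (dom d - cball p \<rho>)" using assms(1) by (simp add: open_Diff)
  show "Y y = 0" if "y \<in> dom d - cball p \<rho>" for y
    using assms(2) that closure_subset[of "dom d"] ball_subset_cball[of p \<rho>] by blast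
qed (use assms in auto)

text \<open>Here the chart is an axis-parallel square inside the domain, and all boundary terms vanish.\<close>

lemma local_div_interior:
  assumes dom: "open (dom d)" "frontier (dom d) = bdry d" and p: "p \<in> dom d"
  shows "\<exists>\<rho>>0. local_div d p \<rho>"
proof -
  obtain \<eta> where \<eta>: "\<eta> > 0" "ball p \<eta> \<subseteq> dom d" using dom(1) p openE by blast
  define R where "R = \<eta> / 3"
  have R: "R > 0" using \<eta> by (simp add: R_def)
  define \<gamma> where "\<gamma> s = p + s *\<^sub>R axis 1 1" for s :: real
  define e :: "real^2" where "e = axis 2 1"
  have d\<gamma>: "(\<gamma> has_vector_derivative axis 1 1) (at s)" for s
    unfolding \<gamma>_def has_vector_derivative_def by (auto intro!: derivative_eq_intros)
  have \<gamma>C: "Ck_on (Suc 0) \<gamma> UNIV" unfolding \<gamma>_def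
    by (intro Ck_on_add Ck_on_const Ck_on_scaleR Ck_on_ident open_UNIV)
  have neg: "e \<bullet> rot (axis 1 1) < 0" by (simp add: e_def inner_2 axis_def)
  have coord: "\<gamma> s + r *\<^sub>R e = p + vector [s, r]" for s r
    by (simp add: \<gamma>_def e_def vec_eq_2 axis_def)
  have in_dom: "\<gamma> s + r *\<^sub>R e \<in> dom d" if "\<bar>s\<bar> \<le> R" "\<bar>r\<bar> \<le> R" for s r
  proof -
    have "norm (vector [s, r] :: real^2) \<le> \<bar>s\<bar> + \<bar>r\<bar>"
      using norm_le_l1_cart[of "vector [s, r] :: real^2"] by (simp add: sum_2)
    also have "\<dots> < \<eta>" using that R by (simp add: R_def)
    finally have "\<gamma> s + r *\<^sub>R e \<in> ball p \<eta>" unfolding coord by (simp add: dist_norm)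
    then show ?thesis using \<eta> by blast
  qed
  have off: "\<gamma> s + r *\<^sub>R e \<notin> cball p (R / 2)" if "\<bar>s\<bar> \<ge> R \<or> \<bar>r\<bar> \<ge> R" for s r
  proof -
    have "\<bar>s\<bar> \<le> norm (vector [s, r] :: real^2)" "\<bar>r\<bar> \<le> norm (vector [s, r] :: real^2)"
      using component_le_norm_cart[of "vector [s, r] :: real^2"] by (metis vector_2)+
    then show ?thesis unfolding coord using that R by (auto simp: dist_norm)
  qed
  have "local_div d p (R / 2)"
    unfolding local_div_def
  proof (intro allI impI)
    fix M :: "(real^2) set" and Y :: "real^2 \<Rightarrow> real^2"
    assume M: "open M" "closure (dom d) \<subseteq> M" and Y: "Ck_on (Suc 0) Y M"
      and Y0: "\<forall>x\<in>closure (dom d). x \<notin> ball p (R / 2) \<longrightarrow> Y x = 0"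
    have Yz: "Y (\<gamma> s + r *\<^sub>R e) = 0" if "\<bar>s\<bar> \<le> R" "\<bar>r\<bar> \<le> R" "\<bar>s\<bar> = R \<or> \<bar>r\<bar> = R" for s r
    proof -
      have "\<gamma> s + r *\<^sub>R e \<notin> cball p (R / 2)" using off[of s r] that(3) by auto
      then show ?thesis
        using Y0 in_dom[OF that(1,2)] closure_subset[of "dom d"] ball_subset_cball[of p "R/2"] by blast
    qed
    have vd: "vector_derivative \<gamma> (at s) = axis 1 1" for s by (rule vector_derivative_at[OF d\<gamma>])
    let ?A = "(\<lambda>w::real^2. \<gamma> (w $ 1) + w $ 2 *\<^sub>R e) ` box (vector [-R, -R]) (vector [R, R])"
    have "(divg Y has_integral integral {-R..R} (\<lambda>s. Y (\<gamma> s + (-R) *\<^sub>R e) \<bullet> rot (vector_derivative \<gamma> (at s)))) ?A"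
    proof (rule strip_area[OF \<gamma>C Y])
      show "\<gamma> s + r *\<^sub>R e \<in> M" if "s \<in> {-R..R}" "r \<in> {-R..R}" for s r
        using in_dom[of s r] that M closure_subset by (auto simp: abs_le_iff)
      show "inj_on (\<lambda>w::real^2. \<gamma> (w $ 1) + w $ 2 *\<^sub>R e) (box (vector [-R, -R]) (vector [R, R]))"
        unfolding coord by (auto intro!: inj_onI simp: vec_eq_2)
    qed (use R neg in \<open>auto simp: vd intro!: Yz\<close>)
    moreover have "integral {-R..R} (\<lambda>s. Y (\<gamma> s + (-R) *\<^sub>R e) \<bullet> rot (vector_derivative \<gamma> (at s))) = 0"
      by (rule integral_unique[OF has_integral_is_0]) (use R in \<open>auto simp del: scaleR_minus_left simp: Yz\<close>)
    ultimately have I: "(divg Y has_integral 0) ?A" by simp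
    have Ad: "?A \<subseteq> dom d" by (auto simp: mem_box_cart forall_2 intro!: in_dom)
    have zero: "divg Y x = 0" if x: "x \<in> dom d" "x \<notin> ?A" for x
    proof (rule divg_zero_off_ball[OF dom(1) Y0 x(1)])
      define s where "s = (x - p) $ 1" 
      define r where "r = (x - p) $ 2"
      have xe: "x = \<gamma> s + r *\<^sub>R e" by (simp add: coord vec_eq_2 s_def r_def)
      have "\<not> (\<bar>s\<bar> < R \<and> \<bar>r\<bar> < R)"
      proof
        assume "\<bar>s\<bar> < R \<and> \<bar>r\<bar> < R"
        then have "vector [s, r] \<in> box (vector [-R, -R]) (vector [R, R] :: real^2)"
          by (auto simp: mem_box_cart forall_2)
        then have "x \<in> ?A" by (intro image_eqI[of _ _ "vector [s, r]"]) (auto simp: xe)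
        then show False using x by blast
      qed
      then show "x \<notin> cball p (R / 2)" unfolding xe by (intro off) auto
    qed
    have "(\<Sum>\<gamma>\<leftarrow>curves d. flux_int \<gamma> Y) = 0"
    proof -
      have "flux_int g Y = 0" if "g \<in> set (curves d)" for g
      proof (rule flux_int_zero)
        fix s
        have fr: "g s \<in> frontier (dom d)" using that dom(2) by (auto simp: bdry_def)
        then have "g s \<notin> dom d" "g s \<in> closure (dom d)"
          using dom(1) by (auto simp: frontier_def interior_open)
        moreover have "ball p (R / 2) \<subseteq> dom d"
          using \<eta>(2) R subset_ball[of "R/2" \<eta> p] by (auto simp: R_def)
        ultimately show "Y (g s) = 0" using Y0 by blast
      qed
      then show ?thesis by (induction "curves d" rule: list.induct) (simp_all add: sum_list_0 cong: map_cong)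
    qed
    with has_integral_zero_off[OF I Ad zero]
    show "(divg Y has_integral (\<Sum>\<gamma>\<leftarrow>curves d. flux_int \<gamma> Y)) (dom d)" by simp
  qed
  then show ?thesis using R by (intro exI[of _ "R / 2"]) auto
qed

lemma sum_list_single:
  fixes f :: "'a \<Rightarrow> real"
  assumes "j < length xs" "\<And>i. i < length xs \<Longrightarrow> i \<noteq> j \<Longrightarrow> f (xs ! i) = 0"
  shows "(\<Sum>x\<leftarrow>xs. f x) = f (xs ! j)"
proof -
  have "(\<Sum>x\<leftarrow>xs. f x) = (\<Sum>i = 0..<length xs. f (xs ! i))"
    by (simp add: sum_list_sum_nth)
  also have "\<dots> = f (xs ! j) + (\<Sum>i \<in> {0..<length xs} - {j}. f (xs ! i))"
    by (rule sum.remove) (use assms in auto)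
  also have "(\<Sum>i \<in> {0..<length xs} - {j}. f (xs ! i)) = 0"
    by (rule sum.neutral) (use assms in auto)
  finally show ?thesis by simp
qed

lemma periodic_vector_derivative:
  assumes "\<And>s. \<gamma> (s + 1) = \<gamma> (s::real)" "\<And>s. (\<gamma> has_vector_derivative \<gamma>' s) (at s)"
  shows "\<gamma>' (s + 1) = \<gamma>' s"
proof -
  have 1: "((\<lambda>s. s + 1) has_vector_derivative 1) (at s)" by (auto intro!: derivative_eq_intros)
  have "((\<lambda>s. \<gamma> (s + 1)) has_vector_derivative \<gamma>' (s + 1)) (at s)"
    using vector_diff_chain_at[OF 1 assms(2)] by (simp add: o_def)
  moreover have "(\<lambda>s. \<gamma> (s + 1)) = \<gamma>" using assms(1) by (simp add: fun_eq_iff)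
  ultimately show ?thesis using vector_derivative_unique_at[OF _ assms(2)] by metis
qed

text \<open>The chart uses the inward normal at \<open>p\<close> as its constant transversal direction. Both halves of
  the chart are connected and avoid the boundary, so each of them lies inside or outside the
  domain; the one-sidedness condition at the single point \<open>p\<close> decides which.\<close>

lemma local_div_boundary:
  assumes reg: "regular_domain k d" and k: "1 \<le> k" and p: "p \<in> bdry d"
  shows "\<exists>\<rho>>0. local_div d p \<rho>"
proof -
  have op: "open (dom d)" and fr: "frontier (dom d) = bdry d"
    using reg by (auto simp: regular_domain_def)
  obtain j s1 where j: "j < length (curves d)" and s1: "p = (curves d ! j) s1"
    using p by (auto simp: bdry_def in_set_conv_nth)
  define \<gamma> where "\<gamma> = curves d ! j"
  have \<gamma>in: "\<gamma> \<in> set (curves d)" using j by (simp add: \<gamma>_def)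
  have \<gamma>C: "Ck_on (Suc 0) \<gamma> UNIV" if "\<gamma> \<in> set (curves d)" for \<gamma>
    using reg that k Ck_on_le[of k \<gamma> UNIV "Suc 0"] by (auto simp: regular_domain_def)
  note \<gamma>C1 = \<gamma>C[OF \<gamma>in]
  have per: "\<gamma> (s + 1) = \<gamma> s" if "\<gamma> \<in> set (curves d)" for \<gamma> s
    using reg that by (auto simp: regular_domain_def)
  have inj: "inj_on \<gamma> {0..<1}" using reg \<gamma>in by (auto simp: regular_domain_def)
  have side: "\<exists>\<delta>>0. \<forall>r. 0 < r \<and> r < \<delta> \<longrightarrow>
           \<gamma> s - r *\<^sub>R curve_normal \<gamma> s \<in> dom d \<and> \<gamma> s + r *\<^sub>R curve_normal \<gamma> s \<notin> dom d" for s
    using reg \<gamma>in by (auto simp: regular_domain_def)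
  define \<gamma>' where "\<gamma>' s = vector_derivative \<gamma> (at s)" for s
  have d\<gamma>: "(\<gamma> has_vector_derivative \<gamma>' s) (at s)" for s
    unfolding \<gamma>'_def using C1_curve[OF \<gamma>C1] by simp
  have c\<gamma>: "continuous_on A \<gamma>" for A
    using Ck_on_imp_continuous_on[OF \<gamma>C1] continuous_on_subset by blast
  have c\<gamma>': "continuous_on A \<gamma>'" for A
    unfolding \<gamma>'_def using C1_curve_continuous[OF \<gamma>C1] by auto
  have nz: "\<gamma>' s \<noteq> 0" for s using reg \<gamma>in by (auto simp: regular_domain_def \<gamma>'_def)
  define s0 where "s0 = frac (s1 - 1/2) + 1/2"
  have s0: "1/2 \<le> s0" "s0 < 3/2" using frac_lt_1[of "s1 - 1/2"] by (auto simp: s0_def)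
  have "s0 = s1 + of_int (- \<lfloor>s1 - 1/2\<rfloor>)" by (simp add: s0_def frac_def)
  then have ps0: "p = \<gamma> s0"
    using periodic_int[of \<gamma> s1, OF per[OF \<gamma>in]] s1 by (simp only: \<gamma>_def)
  define e where "e = - curve_normal \<gamma> s0"
  have e_eq: "e = - (1 / norm (\<gamma>' s0)) *\<^sub>R rot (\<gamma>' s0)"
    by (simp add: e_def curve_normal_eq \<gamma>'_def)
  have e1: "norm e = 1" using nz[of s0] by (simp add: e_eq norm_rot)
  have erot: "e \<bullet> rot (\<gamma>' s) = - (\<gamma>' s0 \<bullet> \<gamma>' s) / norm (\<gamma>' s0)" for s
    by (simp add: e_eq inner_rot_rot)
  \<comment> \<open>a parameter interval on which the direction \<open>e\<close> stays transversal to the curve\<close>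
  have "continuous_on UNIV (\<lambda>s. \<gamma>' s0 \<bullet> \<gamma>' s)" by (intro continuous_intros c\<gamma>')
  from open_Collect_less[OF continuous_on_const this]
  have "open {s. 0 < \<gamma>' s0 \<bullet> \<gamma>' s}" .
  moreover have "s0 \<in> {s. 0 < \<gamma>' s0 \<bullet> \<gamma>' s}" using nz[of s0] by simp
  ultimately obtain \<delta>0 where \<delta>0: "\<delta>0 > 0" "cball s0 \<delta>0 \<subseteq> {s. 0 < \<gamma>' s0 \<bullet> \<gamma>' s}"
    using open_contains_cball by blast
  define \<delta>1 where "\<delta>1 = min \<delta>0 (1/4)"
  have \<delta>1: "\<delta>1 > 0" "\<delta>1 \<le> 1/4" using \<delta>0 by (auto simp: \<delta>1_def)
  have neg: "e \<bullet> rot (\<gamma>' s) < 0" if "s \<in> {s0 - \<delta>1..s0 + \<delta>1}" for s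
  proof -
    have "s \<in> cball s0 \<delta>0" using that by (auto simp: \<delta>1_def dist_real_def)
    then have "0 < \<gamma>' s0 \<bullet> \<gamma>' s" using \<delta>0 by blast
    then show ?thesis using nz[of s0] unfolding erot by (simp add: divide_neg_pos)
  qed
  have sinj: "s = s' \<and> r = r'" if "s \<in> {s0 - \<delta>1..s0 + \<delta>1}" "s' \<in> {s0 - \<delta>1..s0 + \<delta>1}"
      "\<gamma> s + r *\<^sub>R e = \<gamma> s' + r' *\<^sub>R e" for s s' r r'
    by (rule strip_inj[OF d\<gamma> neg that])
  \<comment> \<open>away from that interval the boundary keeps a positive distance from \<open>p\<close>\<close>
  define K where "K = \<gamma> ` {s0 + \<delta>1..s0 + 1 - \<delta>1} \<union> (\<Union>i\<in>{..<length (curves d)} - {j}. (curves d ! i) ` {0..1})"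
  have "closed K" unfolding K_def
  proof (intro closed_Un closed_UN finite_Diff finite_lessThan ballI compact_imp_closed compact_continuous_image c\<gamma>)
    fix i assume "i \<in> {..<length (curves d)} - {j}"
    then show "continuous_on {0..1} (curves d ! i)"
      using Ck_on_imp_continuous_on[OF \<gamma>C[of "curves d ! i"]] continuous_on_subset by fastforce
  qed auto
  moreover have "p \<notin> K"
  proof
    assume "p \<in> K"
    then consider s where "s \<in> {s0 + \<delta>1..s0 + 1 - \<delta>1}" "\<gamma> s0 = \<gamma> s"
      | i s where "i < length (curves d)" "i \<noteq> j" "p = (curves d ! i) s"
      unfolding K_def ps0 by auto
    then show False
    proof cases
      case 1
      then have "s0 = s" using \<delta>1 by (intro closed_curve_eqD[of \<gamma>, OF per[OF \<gamma>in] inj 1(2)]) auto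
      then show False using 1 \<delta>1 by auto
    next
      case 2
      then have "range (curves d ! i) \<inter> range (curves d ! j) = {}"
        using reg j by (auto simp: regular_domain_def)
      then show False using 2 s1 by auto
    qed
  qed
  ultimately obtain \<beta> where \<beta>: "\<beta> > 0" "ball p \<beta> \<inter> K = {}"
    by (metis Compl_iff Diff_disjoint Diff_eq open_Compl open_contains_ball disjoint_eq_subset_Compl)
  have bdry_near: "\<exists>s\<in>{s0 - \<delta>1<..<s0 + \<delta>1}. x = \<gamma> s" if xb: "x \<in> bdry d" and xball: "x \<in> ball p \<beta>" for x
  proof -
    obtain g s where g: "g \<in> set (curves d)" "x = g s"
      using xb by (auto simp: bdry_def)
    obtain i where i: "i < length (curves d)" "x = (curves d ! i) s"
      using g by (metis in_set_conv_nth)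
    have fr': "(curves d ! i) s = (curves d ! i) (frac s)"
      using periodic_int[of "curves d ! i" "frac s" "\<lfloor>s\<rfloor>", OF per[OF nth_mem[OF i(1)]]] by (simp add: frac_def)
    have "i = j"
    proof (rule ccontr)
      assume "i \<noteq> j"
      then have "x \<in> K" unfolding K_def i fr' using i(1) frac_lt_1[of s] by (auto intro!: bexI[of _ i] simp: less_imp_le)
      then show False using xball \<beta> by blast
    qed
    define t where "t = s0 - \<delta>1 + frac (s - s0 + \<delta>1)"
    have "t = s + of_int (- \<lfloor>s - s0 + \<delta>1\<rfloor>)" by (simp add: t_def frac_def)
    then have xt: "x = \<gamma> t" using periodic_int[of \<gamma> s, OF per[OF \<gamma>in]] i \<open>i = j\<close> by (simp only: \<gamma>_def)
    have t: "s0 - \<delta>1 \<le> t" "t < s0 + 1 - \<delta>1" using frac_lt_1[of "s - s0 + \<delta>1"] by (auto simp: t_def)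
    have "t < s0 + \<delta>1"
    proof (rule ccontr)
      assume "\<not> t < s0 + \<delta>1"
      then have "x \<in> K" unfolding K_def xt using t by auto
      then show False using xball \<beta> by blast
    qed
    moreover have "t \<noteq> s0 - \<delta>1"
    proof
      assume "t = s0 - \<delta>1"
      then have "t + 1 = s0 + 1 - \<delta>1" by simp
      then have "x = \<gamma> (s0 + 1 - \<delta>1)" using per[OF \<gamma>in, of t] xt by metis
      then have "x \<in> K" unfolding K_def using \<delta>1 by auto
      then show False using xball \<beta> by blast
    qed
    ultimately show ?thesis using t xt by (intro bexI[of _ t]) auto
  qed
  \<comment> \<open>\<open>\<delta>\<close> and \<open>R\<close> are small enough for the chart to stay in the ball just found, where the
    boundary is the single arc around \<open>p\<close>\<close>
  have "continuous (at s0) \<gamma>" using c\<gamma>[of UNIV] by (simp add: continuous_on_eq_continuous_at)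
  then obtain \<delta>2 where \<delta>2: "\<delta>2 > 0" "\<And>s. \<bar>s - s0\<bar> < \<delta>2 \<Longrightarrow> dist (\<gamma> s) (\<gamma> s0) < \<beta> / 2"
    unfolding continuous_at_eps_delta dist_real_def using \<beta>(1) half_gt_zero by meson
  define \<delta> where "\<delta> = min \<delta>1 \<delta>2 / 2"
  have \<delta>: "\<delta> > 0" "\<delta> < \<delta>1" "\<delta> < \<delta>2" using \<delta>1 \<delta>2 by (auto simp: \<delta>_def)
  define R where "R = \<beta> / 3"
  have R: "R > 0" using \<beta> by (simp add: R_def)
  let ?I = "{s0 - \<delta>..s0 + \<delta>}"
  have I1: "s \<in> {s0 - \<delta>1..s0 + \<delta>1}" if "s \<in> ?I" for s using that \<delta> by auto
  have in_ball: "\<gamma> s + r *\<^sub>R e \<in> ball p \<beta>" if "s \<in> ?I" "\<bar>r\<bar> \<le> R" for s r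
  proof -
    have "dist (\<gamma> s + r *\<^sub>R e) (\<gamma> s0) \<le> norm (\<gamma> s - \<gamma> s0) + norm (r *\<^sub>R e)"
      unfolding dist_norm by (metis add.commute add_diff_eq norm_triangle_ineq)
    also have "\<dots> < \<beta> / 2 + R" using \<delta>2(2)[of s] that \<delta> e1 by (auto simp: dist_norm abs_less_iff)
    also have "\<dots> \<le> \<beta>" using \<beta> by (simp add: R_def)
    finally show ?thesis by (simp add: ps0 dist_commute)
  qed
  define \<Psi> where "\<Psi> = (\<lambda>w::real^2. \<gamma> (w $ 1) + w $ 2 *\<^sub>R e)"
  have c\<Psi>: "continuous_on A \<Psi>" for A unfolding \<Psi>_def
    by (intro continuous_intros continuous_on_compose2[OF c\<gamma>[of UNIV]]) auto
  define B where "B = box (vector [s0 - \<delta>, -R]) (vector [s0 + \<delta>, R] :: real^2)"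
  define B' where "B' = box (vector [s0 - \<delta>, 0]) (vector [s0 + \<delta>, R] :: real^2)"
  have injB: "inj_on \<Psi> B"
  proof (rule inj_onI)
    fix w w' assume "w \<in> B" "w' \<in> B" "\<Psi> w = \<Psi> w'"
    then show "w = w'" using sinj[of "w $ 1" "w' $ 1" "w $ 2" "w' $ 2"] \<delta>
      by (auto simp: B_def mem_box_cart forall_2 \<Psi>_def vec_eq_2)
  qed
  define U where "U = \<Psi> ` B"
  have U: "open U" unfolding U_def by (rule invariance_of_domain[OF c\<Psi> _ injB]) (simp add: B_def open_box)
  have UI: "\<gamma> s + r *\<^sub>R e \<in> U \<longleftrightarrow> s \<in> {s0 - \<delta><..<s0 + \<delta>} \<and> \<bar>r\<bar> < R" if "s \<in> {s0 - \<delta>1..s0 + \<delta>1}" for s r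
  proof
    assume "\<gamma> s + r *\<^sub>R e \<in> U"
    then obtain w where w: "w \<in> B" "\<gamma> s + r *\<^sub>R e = \<gamma> (w $ 1) + w $ 2 *\<^sub>R e"
      by (auto simp: U_def \<Psi>_def)
    then have "s = w $ 1 \<and> r = w $ 2"
      using that \<delta> by (intro sinj) (auto simp: B_def mem_box_cart forall_2)
    then show "s \<in> {s0 - \<delta><..<s0 + \<delta>} \<and> \<bar>r\<bar> < R" using w by (auto simp: B_def mem_box_cart forall_2)
  next
    assume "s \<in> {s0 - \<delta><..<s0 + \<delta>} \<and> \<bar>r\<bar> < R"
    then show "\<gamma> s + r *\<^sub>R e \<in> U" unfolding U_def
      by (intro image_eqI[of _ _ "vector [s, r]"]) (auto simp: \<Psi>_def B_def mem_box_cart forall_2)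
  qed
  have "p \<in> U" using UI[of s0 0] \<delta> \<delta>1 R ps0 by auto
  then obtain \<rho> where \<rho>: "\<rho> > 0" "cball p \<rho> \<subseteq> U" using U open_contains_cball by blast
  have not_bdry: "\<gamma> s + r *\<^sub>R e \<notin> bdry d" if "s \<in> ?I" "\<bar>r\<bar> \<le> R" "r \<noteq> 0" for s r
  proof
    assume "\<gamma> s + r *\<^sub>R e \<in> bdry d"
    from bdry_near[OF this in_ball[OF that(1,2)]]
    obtain s' where "s' \<in> {s0 - \<delta>1<..<s0 + \<delta>1}" "\<gamma> s + r *\<^sub>R e = \<gamma> s' + 0 *\<^sub>R e" by auto
    then show False using sinj[of s s' r 0] I1[OF that(1)] that(3) by auto
  qed
  \<comment> \<open>each half of the chart is connected and does not meet the boundary\<close>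
  have conn: "connected (\<Psi> ` cbox (vector [a, b]) (vector [c, d]))" for a b c d
    by (intro connected_continuous_image c\<Psi> convex_connected convex_box)
  obtain \<delta>3 where \<delta>3: "\<delta>3 > 0" "\<And>r. 0 < r \<Longrightarrow> r < \<delta>3 \<Longrightarrow>
           \<gamma> s0 - r *\<^sub>R curve_normal \<gamma> s0 \<in> dom d \<and> \<gamma> s0 + r *\<^sub>R curve_normal \<gamma> s0 \<notin> dom d"
    using side by meson
  have mem_cb: "\<gamma> s + r *\<^sub>R e \<in> \<Psi> ` cbox (vector [s0 - \<delta>, a]) (vector [s0 + \<delta>, b])"
    if "s \<in> ?I" "a \<le> r" "r \<le> b" for s r a b
    by (rule image_eqI[of _ _ "vector [s, r]"]) (use that in \<open>auto simp: \<Psi>_def mem_box_cart forall_2\<close>)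
  have above: "\<gamma> s + r *\<^sub>R e \<in> dom d" if s: "s \<in> ?I" and r: "0 < r" "r \<le> R" for s r
  proof (rule ccontr)
    assume n: "\<gamma> s + r *\<^sub>R e \<notin> dom d"
    define r0 where "r0 = min r (\<delta>3 / 2)"
    have r0: "0 < r0" "r0 < \<delta>3" "r0 \<le> r" using r \<delta>3 by (auto simp: r0_def)
    let ?Q = "\<Psi> ` cbox (vector [s0 - \<delta>, r0]) (vector [s0 + \<delta>, R])"
    have "\<gamma> s0 + r0 *\<^sub>R e \<in> dom d" using \<delta>3(2)[OF r0(1,2)] by (simp add: e_def)
    moreover have "\<gamma> s0 + r0 *\<^sub>R e \<in> ?Q" using \<delta> r r0 by (intro mem_cb) auto
    moreover have "\<gamma> s + r *\<^sub>R e \<in> ?Q" using s r r0 by (intro mem_cb) auto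
    ultimately have "?Q \<inter> frontier (dom d) \<noteq> {}"
      using n by (intro connected_Int_frontier conn) auto
    moreover have "?Q \<inter> bdry d = {}"
      using not_bdry r0 by (auto simp: \<Psi>_def mem_box_cart forall_2)
    ultimately show False using fr by simp
  qed
  have below: "\<gamma> s + r *\<^sub>R e \<notin> dom d" if s: "s \<in> ?I" and r: "- R \<le> r" "r < 0" for s r
  proof
    assume n: "\<gamma> s + r *\<^sub>R e \<in> dom d"
    define r0 where "r0 = min (- r) (\<delta>3 / 2)"
    have r0: "0 < r0" "r0 < \<delta>3" "r0 \<le> - r" using r \<delta>3 by (auto simp: r0_def)
    let ?Q = "\<Psi> ` cbox (vector [s0 - \<delta>, - R]) (vector [s0 + \<delta>, - r0])"
    have "\<gamma> s0 + (- r0) *\<^sub>R e \<notin> dom d" using \<delta>3(2)[OF r0(1,2)] by (simp add: e_def)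
    moreover have "\<gamma> s0 + (- r0) *\<^sub>R e \<in> ?Q" using \<delta> r r0 by (intro mem_cb) auto
    moreover have "\<gamma> s + r *\<^sub>R e \<in> ?Q" using s r r0 by (intro mem_cb) auto
    ultimately have "?Q \<inter> frontier (dom d) \<noteq> {}"
      using n by (intro connected_Int_frontier conn) auto
    moreover have "?Q \<inter> bdry d = {}"
      using not_bdry r0 by (auto simp: \<Psi>_def mem_box_cart forall_2)
    ultimately show False using fr by simp
  qed
  have bd_cl: "x \<in> closure (dom d) \<and> x \<notin> dom d" if "x \<in> bdry d" for x
    using that op unfolding fr[symmetric] by (auto simp: frontier_def interior_open)
  have \<gamma>bd: "\<gamma> s \<in> bdry d" for s using \<gamma>in by (auto simp: bdry_def)
  have cl: "\<gamma> s + r *\<^sub>R e \<in> closure (dom d)" if s: "s \<in> ?I" and r: "0 \<le> r" "r \<le> R" for s r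
  proof (cases "r = 0")
    case True
    then show ?thesis using bd_cl[OF \<gamma>bd[of s]] by simp
  next
    case False
    then have "\<gamma> s + r *\<^sub>R e \<in> dom d" using above[OF s, of r] r by simp
    then show ?thesis by (rule subsetD[OF closure_subset])
  qed
  have "local_div d p \<rho>"
    unfolding local_div_def
  proof (intro allI impI)
    fix M :: "(real^2) set" and Y :: "real^2 \<Rightarrow> real^2"
    assume M: "open M" "closure (dom d) \<subseteq> M" and Y: "Ck_on (Suc 0) Y M"
      and Y0: "\<forall>x\<in>closure (dom d). x \<notin> ball p \<rho> \<longrightarrow> Y x = 0"
    have YU: "Y x = 0" if "x \<in> closure (dom d)" "x \<notin> U" for x
      using Y0 that \<rho>(2) ball_subset_cball[of p \<rho>] by blast
    have Yz: "Y (\<gamma> s + r *\<^sub>R e) = 0" if "s \<in> ?I" "0 \<le> r" "r \<le> R" "s = s0 - \<delta> \<or> s = s0 + \<delta> \<or> r = R" for s r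
      by (rule YU[OF cl[OF that(1-3)]]) (use UI[OF I1[OF that(1)], of r] that in auto)
    let ?A = "\<Psi> ` B'"
    have I: "(divg Y has_integral integral ?I (\<lambda>s. Y (\<gamma> s + 0 *\<^sub>R e) \<bullet> rot (vector_derivative \<gamma> (at s)))) ?A"
      unfolding \<Psi>_def B'_def
    proof (rule strip_area[OF \<gamma>C1 Y])
      show "\<gamma> s + r *\<^sub>R e \<in> M" if "s \<in> ?I" "r \<in> {0..R}" for s r
        using cl[of s r] that M by auto
      show "inj_on (\<lambda>w::real^2. \<gamma> (w $ 1) + w $ 2 *\<^sub>R e) (box (vector [s0 - \<delta>, 0]) (vector [s0 + \<delta>, R]))"
      proof -
        have "B' \<subseteq> B" using R by (auto simp: B_def B'_def mem_box_cart forall_2)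
        from inj_on_subset[OF injB this] show ?thesis unfolding B'_def \<Psi>_def .
      qed
      show "e \<bullet> rot (vector_derivative \<gamma> (at s)) < 0" if "s \<in> ?I" for s
        using neg[OF I1[OF that]] by (simp add: \<gamma>'_def)
    qed (use \<delta> R in \<open>auto intro!: Yz\<close>)
    have Ad: "?A \<subseteq> dom d" unfolding \<Psi>_def B'_def by (auto simp: mem_box_cart forall_2 intro!: above)
    have zero: "divg Y x = 0" if x: "x \<in> dom d" "x \<notin> ?A" for x
    proof (rule divg_zero_off_ball[OF op Y0 x(1)])
      have "x \<notin> U"
      proof
        assume "x \<in> U"
        then obtain w where w: "w \<in> B" "x = \<Psi> w" by (auto simp: U_def)
        then have w': "w $ 1 \<in> ?I" "- R < w $ 2" "w $ 2 < R" by (auto simp: B_def mem_box_cart forall_2)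
        have "w $ 2 > 0"
        proof (rule ccontr)
          assume "\<not> w $ 2 > 0"
          then consider "w $ 2 = 0" | "w $ 2 < 0" by linarith
          then show False
          proof cases
            case 1
            then show False using x(1) w bd_cl[OF \<gamma>bd] by (simp add: \<Psi>_def)
          next
            case 2
            then show False using below[OF w'(1)] w' x w(2) by (simp add: \<Psi>_def)
          qed
        qed
        then have "w \<in> B'" using w(1) by (auto simp: B_def B'_def mem_box_cart forall_2)
        then show False using x w by blast
      qed
      then show "x \<notin> cball p \<rho>" using \<rho> by blast
    qed
    \<comment> \<open>only the part of the boundary in the chart contributes to the flux\<close>
    have YK: "Y x = 0" if "x \<in> bdry d" "x \<notin> \<gamma> ` {s0 - \<delta><..<s0 + \<delta>}" for x
    proof (rule YU)
      show "x \<in> closure (dom d)" using bd_cl that by blast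
      show "x \<notin> U"
      proof
        assume "x \<in> U"
        then obtain w where w: "w \<in> B" "x = \<Psi> w" by (auto simp: U_def)
        then have w': "w $ 1 \<in> {s0 - \<delta><..<s0 + \<delta>}" "\<bar>w $ 2\<bar> < R" by (auto simp: B_def mem_box_cart forall_2)
        have "w $ 2 = 0" using not_bdry[of "w $ 1" "w $ 2"] w w' that(1) by (auto simp: \<Psi>_def)
        then show False using that(2) w w' by (auto simp: \<Psi>_def)
      qed
    qed
    let ?f = "\<lambda>s. Y (\<gamma> s) \<bullet> rot (\<gamma>' s)"
    have per': "\<gamma>' (s + 1) = \<gamma>' s" for s
      by (rule periodic_vector_derivative[OF per[OF \<gamma>in] d\<gamma>])
    have cY: "continuous_on M Y" using Ck_on_imp_continuous_on[OF Y] .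
    have \<gamma>M: "\<gamma> s \<in> M" for s using bd_cl[OF \<gamma>bd] M by blast
    have cf: "continuous_on UNIV ?f"
      using \<gamma>M by (intro continuous_intros bounded_linear.continuous_on[OF bounded_linear_rot] c\<gamma>'
          continuous_on_compose2[OF cY c\<gamma>]) auto
    have "(\<Sum>\<gamma>\<leftarrow>curves d. flux_int \<gamma> Y) = flux_int \<gamma> Y"
      unfolding \<gamma>_def
    proof (rule sum_list_single[OF j])
      fix i assume i: "i < length (curves d)" "i \<noteq> j"
      then have "range (curves d ! i) \<inter> range (curves d ! j) = {}"
        using reg j by (auto simp: regular_domain_def)
      then show "flux_int (curves d ! i) Y = 0"
      proof (intro flux_int_zero YK)
        show "(curves d ! i) s \<in> bdry d" for s
          unfolding bdry_def using i(1) by (meson UN_I nth_mem rangeI)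
      qed (auto simp: \<gamma>_def)
    qed
    also have "\<dots> = integral {0..1} ?f" by (simp add: flux_int_def \<gamma>'_def)
    also have "\<dots> = integral {s0 - 1/2..s0 - 1/2 + 1} ?f"
      by (rule integral_periodic_shift[symmetric]) (use cf per[OF \<gamma>in] per' s0 in auto)
    also have "\<dots> = integral ?I ?f"
    proof (rule integral_unique, rule has_integral_zero_off)
      show "(?f has_integral integral ?I ?f) ?I"
        using cf continuous_on_subset integrable_continuous_real integrable_integral by blast
      show "?I \<subseteq> {s0 - 1/2..s0 - 1/2 + 1}" using \<delta> \<delta>1 by auto
      fix s assume s: "s \<in> {s0 - 1/2..s0 - 1/2 + 1}" "s \<notin> ?I"
      have "\<gamma> s \<notin> \<gamma> ` {s0 - \<delta><..<s0 + \<delta>}"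
      proof
        assume "\<gamma> s \<in> \<gamma> ` {s0 - \<delta><..<s0 + \<delta>}"
        then obtain s' where s': "s' \<in> {s0 - \<delta><..<s0 + \<delta>}" "\<gamma> s = \<gamma> s'" by auto
        then have "s = s'" using s \<delta> \<delta>1 by (intro closed_curve_eqD[of \<gamma>, OF per[OF \<gamma>in] inj]) auto
        then show False using s s' by auto
      qed
      then show "?f s = 0" using YK[OF \<gamma>bd] by simp
    qed
    finally have "(\<Sum>\<gamma>\<leftarrow>curves d. flux_int \<gamma> Y) = integral ?I (\<lambda>s. Y (\<gamma> s + 0 *\<^sub>R e) \<bullet> rot (vector_derivative \<gamma> (at s)))"
      by (simp add: \<gamma>'_def)
    with has_integral_zero_off[OF I Ad zero]
    show "(divg Y has_integral (\<Sum>\<gamma>\<leftarrow>curves d. flux_int \<gamma> Y)) (dom d)" by simp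
  qed
  then show ?thesis using \<rho> by blast
qed

text \<open>The positive part of a quadratic function, squared, is a bump of class \<open>C\<^sup>1\<close>.
  Normalised, such bumps form the partition of unity.\<close>

lemma C1_max_0_square: "Ck_on (Suc 0) (\<lambda>t::real. (max 0 t)\<^sup>2) UNIV"
proof (rule Ck_on_SucI[OF open_UNIV])
  fix t :: real
  have "((\<lambda>t. (max 0 t)\<^sup>2) has_real_derivative 2 * max 0 t) (at t)"
  proof (cases t "0::real" rule: linorder_cases)
    case less
    have "((\<lambda>t. (max 0 t)\<^sup>2) has_real_derivative 0) (at t)"
      by (rule has_field_derivative_transform_within_open[OF DERIV_const, where S="{..<0}"]) (use less in auto)
    then show ?thesis using less by simp
  next
    case greater
    have "((\<lambda>t::real. t\<^sup>2) has_real_derivative 2 * t) (at t)"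
      by (auto intro!: derivative_eq_intros)
    then have "((\<lambda>t. (max 0 t)\<^sup>2) has_real_derivative 2 * t) (at t)"
      by (rule has_field_derivative_transform_within_open[where S="{0<..}"]) (use greater in auto)
    then show ?thesis using greater by simp
  next
    case equal
    have "((\<lambda>h::real. (max 0 h)\<^sup>2 / h) \<longlongrightarrow> 0) (at 0)"
    proof (rule Lim_null_comparison)
      show "\<forall>\<^sub>F h in at 0. norm ((max 0 h)\<^sup>2 / h) \<le> \<bar>h::real\<bar>"
        by (auto simp: max_def power2_eq_square)
      show "((\<lambda>h::real. \<bar>h\<bar>) \<longlongrightarrow> 0) (at 0)" by (rule tendsto_rabs_zero) simp
    qed
    then show ?thesis using equal by (simp add: DERIV_def)
  qed
  then show "((\<lambda>t. (max 0 t)\<^sup>2) has_derivative (\<lambda>h. 2 * max 0 t * h)) (at t)"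
    by (simp add: has_field_derivative_def)
next
  show "Ck_on 0 (\<lambda>t. 2 * max 0 t * h) UNIV" for h :: real
    by (auto intro!: continuous_intros)
qed

lemma divg_cong_open:
  assumes "open S" "x \<in> S" "\<And>y. y \<in> S \<Longrightarrow> X y = Y y" and "(X has_derivative D) (at x)"
  shows "divg X x = divg Y x"
  using divg_eq[OF assms(4)] divg_eq[OF has_derivative_transform_within_open[OF assms(4,1,2,3)]] by simp

lemma flux_int_sum:
  assumes "finite I" "\<And>i. i \<in> I \<Longrightarrow> (\<lambda>s. X i (\<gamma> s) \<bullet> rot (vector_derivative \<gamma> (at s))) integrable_on {0..1}"
    and "\<And>s. Y (\<gamma> s) = (\<Sum>i\<in>I. X i (\<gamma> s))"
  shows "flux_int \<gamma> Y = (\<Sum>i\<in>I. flux_int \<gamma> (X i))"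
  unfolding flux_int_def by (simp add: assms inner_sum_left Henstock_Kurzweil_Integration.integral_sum)

lemma flux_int_integrable:
  assumes \<gamma>: "Ck_on (Suc 0) \<gamma> UNIV" and Y: "continuous_on M Y" "range \<gamma> \<subseteq> M"
  shows "(\<lambda>s. Y (\<gamma> s) \<bullet> rot (vector_derivative \<gamma> (at s))) integrable_on {0..1}"
proof (rule integrable_continuous_real)
  have "continuous_on {0..1} \<gamma>"
    using Ck_on_imp_continuous_on[OF \<gamma>] continuous_on_subset by blast
  then show "continuous_on {0..1} (\<lambda>s. Y (\<gamma> s) \<bullet> rot (vector_derivative \<gamma> (at s)))"
    using Y(2) C1_curve_continuous[OF \<gamma>] by (intro continuous_intros
        bounded_linear.continuous_on[OF bounded_linear_rot] continuous_on_compose2[OF Y(1)]) auto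
qed

theorem divergence_theorem:
  assumes reg: "regular_domain k d" and k: "1 \<le> k"
    and N: "open N" "closure (dom d) \<subseteq> N" and Y: "Ck_on (Suc 0) Y N"
  shows "(divg Y has_integral (\<Sum>\<gamma>\<leftarrow>curves d. flux_int \<gamma> Y)) (dom d)"
proof -
  have op: "open (dom d)" and fr: "frontier (dom d) = bdry d" and bd: "bounded (dom d)"
    using reg by (auto simp: regular_domain_def)
  have \<gamma>C: "Ck_on (Suc 0) \<gamma> UNIV" if "\<gamma> \<in> set (curves d)" for \<gamma>
    using reg that k Ck_on_le[of k \<gamma> UNIV "Suc 0"] by (auto simp: regular_domain_def)
  have bd_cl: "bdry d \<subseteq> closure (dom d)" unfolding fr[symmetric] by (auto simp: frontier_def)
  have "\<exists>\<rho>>0. local_div d p \<rho>" if p: "p \<in> closure (dom d)" for p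
  proof (cases "p \<in> dom d")
    case False
    then have "p \<in> bdry d" using p op unfolding fr[symmetric] by (auto simp: frontier_def interior_open)
    then show ?thesis by (rule local_div_boundary[OF reg k])
  qed (rule local_div_interior[OF op fr])
  then obtain \<rho> where \<rho>: "\<And>p. p \<in> closure (dom d) \<Longrightarrow> \<rho> p > 0"
      "\<And>p. p \<in> closure (dom d) \<Longrightarrow> local_div d p (\<rho> p)" by metis
  have "compact (closure (dom d))" using bd by simp
  then obtain I where I: "I \<subseteq> closure (dom d)" "finite I" "closure (dom d) \<subseteq> (\<Union>p\<in>I. ball p (\<rho> p))"
  proof (rule compactE_image[of _ "closure (dom d)" "\<lambda>p. ball p (\<rho> p)"])
    show "closure (dom d) \<subseteq> (\<Union>p\<in>closure (dom d). ball p (\<rho> p))" using \<rho>(1) by (fastforce simp: mem_ball)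
  qed auto
  define b where "b p x = (max 0 ((\<rho> p)\<^sup>2 - (x - p) \<bullet> (x - p)))\<^sup>2" for p x :: "real^2"
  define Bs where "Bs x = (\<Sum>p\<in>I. b p x)" for x
  define M where "M = N \<inter> (\<Union>p\<in>I. ball p (\<rho> p))"
  have M: "open M" "closure (dom d) \<subseteq> M" using N I by (auto simp: M_def)
  have bpos: "b p x > 0 \<longleftrightarrow> x \<in> ball p (\<rho> p)" if "p \<in> I" for p x
  proof -
    have "\<rho> p > 0" using \<rho>(1) I that by blast
    then have "norm (x - p) < \<rho> p \<longleftrightarrow> (norm (x - p))\<^sup>2 < (\<rho> p)\<^sup>2"
      by (meson abs_le_square_iff abs_norm_cancel less_eq_real_def linorder_not_less norm_ge_zero power2_less_imp_less power_strict_mono zero_less_numeral)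
    moreover have "b p x > 0 \<longleftrightarrow> (norm (x - p))\<^sup>2 < (\<rho> p)\<^sup>2"
      by (auto simp: b_def power2_norm_eq_inner max_def)
    ultimately show ?thesis by (simp add: dist_norm norm_minus_commute)
  qed
  have bnn: "b p x \<ge> 0" for p x by (simp add: b_def)
  have Bpos: "Bs x > 0" if xM: "x \<in> M" for x
  proof -
    obtain p where "p \<in> I" "x \<in> ball p (\<rho> p)" using xM by (auto simp: M_def)
    then show ?thesis unfolding Bs_def using I bnn bpos by (intro sum_pos2[of _ p]) auto
  qed
  have bC: "Ck_on (Suc 0) (b p) M" for p
    unfolding b_def
    by (rule Ck_on_compose[OF M(1) subset_UNIV _ C1_max_0_square]) (intro Ck_on_intros M Ck_on_ident)
  define Z where "Z p x = (b p x / Bs x) *\<^sub>R Y x" for p x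
  have ZC: "Ck_on (Suc 0) (Z p) M" for p
    unfolding Z_def
  proof (intro Ck_on_scaleR Ck_on_divide M bC)
    show "Ck_on (Suc 0) Bs M" unfolding Bs_def by (intro Ck_on_sum M bC)
    show "Bs x \<noteq> 0" if "x \<in> M" for x using Bpos[OF that] by simp
    show "Ck_on (Suc 0) Y M" using Ck_on_subset[OF Y] by (auto simp: M_def)
  qed
  have sumZ: "(\<Sum>p\<in>I. Z p x) = Y x" if "x \<in> M" for x
    using Bpos[OF that] unfolding Z_def scaleR_left.sum[symmetric] sum_divide_distrib[symmetric]
    by (simp add: Bs_def)
  have loc: "(divg (Z p) has_integral (\<Sum>\<gamma>\<leftarrow>curves d. flux_int \<gamma> (Z p))) (dom d)" if "p \<in> I" for p
  proof -
    have "Z p x = 0" if "x \<notin> ball p (\<rho> p)" for x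
      using bpos[OF \<open>p \<in> I\<close>, of x] bnn[of p x] that by (simp add: Z_def)
    then show ?thesis
      using \<rho>(2)[of p] that I M ZC unfolding local_div_def by blast
  qed
  have "((\<lambda>x. \<Sum>p\<in>I. divg (Z p) x) has_integral (\<Sum>p\<in>I. \<Sum>\<gamma>\<leftarrow>curves d. flux_int \<gamma> (Z p))) (dom d)"
    by (rule has_integral_sum[OF I(2) loc])
  moreover have "(\<Sum>p\<in>I. divg (Z p) x) = divg Y x" if "x \<in> dom d" for x
  proof -
    have xM: "x \<in> M" using that M closure_subset by blast
    note dZ = Ck_on_has_derivative[OF ZC xM]
    have dS: "((\<lambda>x. \<Sum>p\<in>I. Z p x) has_derivative (\<lambda>h. \<Sum>p\<in>I. frechet_derivative (Z p) (at x) h)) (at x)"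
      by (intro has_derivative_sum dZ)
    have "(\<Sum>p\<in>I. divg (Z p) x) = divg (\<lambda>x. \<Sum>p\<in>I. Z p x) x"
      using divg_eq[OF dS] divg_eq[OF dZ] by (simp add: sum.distrib)
    also have "\<dots> = divg Y x"
      by (rule divg_cong_open[OF M(1) xM sumZ dS])
    finally show ?thesis .
  qed
  moreover have "(\<Sum>p\<in>I. \<Sum>\<gamma>\<leftarrow>curves d. flux_int \<gamma> (Z p)) = (\<Sum>\<gamma>\<leftarrow>curves d. flux_int \<gamma> Y)"
  proof -
    have swap: "(\<Sum>p\<in>I. \<Sum>\<gamma>\<leftarrow>cs. flux_int \<gamma> (Z p)) = (\<Sum>\<gamma>\<leftarrow>cs. \<Sum>p\<in>I. flux_int \<gamma> (Z p))" for cs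
      by (induction cs) (simp_all add: sum.distrib)
    have "(\<Sum>p\<in>I. flux_int \<gamma> (Z p)) = flux_int \<gamma> Y" if "\<gamma> \<in> set (curves d)" for \<gamma>
    proof (rule flux_int_sum[symmetric, OF I(2)])
      have rM: "range \<gamma> \<subseteq> M" using that bd_cl M by (auto simp: bdry_def)
      show "Y (\<gamma> s) = (\<Sum>i\<in>I. Z i (\<gamma> s))" for s
        using rM by (intro sumZ[symmetric]) blast
      show "(\<lambda>s. Z p (\<gamma> s) \<bullet> rot (vector_derivative \<gamma> (at s))) integrable_on {0..1}" for p
        by (rule flux_int_integrable[OF \<gamma>C[OF that] Ck_on_imp_continuous_on[OF ZC] rM])
    qed
    then show ?thesis unfolding swap by (simp cong: map_cong)
  qed
  ultimately show ?thesis by (metis (mono_tags, lifting) has_integral_cong)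
qed

section \<open>Smooth cut-off functions\<close>

text \<open>Polynomials in \<open>1/y\<close> times \<open>exp (-1/y)\<close>, extended by zero: a class closed under
  differentiation, hence consisting of smooth functions.\<close>

definition flat :: "real poly \<Rightarrow> real \<Rightarrow> real" where
  "flat p y = (if y > 0 then poly p (1 / y) * exp (- (1 / y)) else 0)"

lemma poly_exp_tendsto_0: "((\<lambda>s. poly p s * exp (- s)) \<longlongrightarrow> 0) at_top" for p :: "real poly"
proof -
  have "((\<lambda>s. \<Sum>i\<le>degree p. coeff p i * (s ^ i / exp s)) \<longlongrightarrow> (\<Sum>i\<le>degree p. coeff p i * 0)) at_top"
    by (intro tendsto_sum tendsto_mult_left tendsto_power_div_exp_0)
  then show ?thesis
    by (simp add: poly_altdef sum_distrib_right exp_minus divide_inverse mult.assoc)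
qed

lemma flat_tendsto_0: "(flat p \<longlongrightarrow> 0) (at 0)"
  unfolding filterlim_at_split
proof
  have "\<forall>\<^sub>F y in at_left 0. 0 = flat p y" by (auto simp: eventually_at_filter flat_def)
  then show "(flat p \<longlongrightarrow> 0) (at_left 0)" by (rule Lim_transform_eventually[OF tendsto_const])
  have "filterlim (\<lambda>y::real. 1 / y) at_top (at_right 0)"
    using filterlim_inverse_at_top_right by (simp add: inverse_eq_divide)
  from filterlim_compose[OF poly_exp_tendsto_0[of p] this]
  show "(flat p \<longlongrightarrow> 0) (at_right 0)"
    by (rule Lim_transform_eventually) (auto simp: eventually_at_filter flat_def)
qed

lemma flat_derivative: "(flat p has_real_derivative flat ([:0, 0, 1:] * (p - pderiv p)) y) (at y)"
proof (cases y "0::real" rule: linorder_cases)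
  case less
  have "(flat p has_real_derivative 0) (at y)"
    by (rule has_field_derivative_transform_within_open[OF DERIV_const, where S="{..<0}"])
      (use less in \<open>auto simp: flat_def\<close>)
  then show ?thesis using less by (simp add: flat_def)
next
  case greater
  have 1: "((\<lambda>y. 1 / y) has_real_derivative - (1 / y\<^sup>2)) (at y)"
    using greater by (auto intro!: derivative_eq_intros simp: power2_eq_square)
  have "((\<lambda>y. poly p (1 / y) * exp (- (1 / y))) has_real_derivative
      poly (pderiv p) (1 / y) * - (1 / y\<^sup>2) * exp (- (1 / y)) + exp (- (1 / y)) * - (- (1 / y\<^sup>2)) * poly p (1 / y)) (at y)"
    by (intro DERIV_mult DERIV_chain2[OF poly_DERIV 1] DERIV_chain2[OF DERIV_exp DERIV_minus[OF 1]])
  moreover have "poly (pderiv p) (1 / y) * - (1 / y\<^sup>2) * exp (- (1 / y)) + exp (- (1 / y)) * - (- (1 / y\<^sup>2)) * poly p (1 / y)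
      = flat ([:0, 0, 1:] * (p - pderiv p)) y"
    using greater by (simp add: flat_def power2_eq_square algebra_simps)
  ultimately have "((\<lambda>y. poly p (1 / y) * exp (- (1 / y))) has_real_derivative
      flat ([:0, 0, 1:] * (p - pderiv p)) y) (at y)" by simp
  then show ?thesis
    by (rule has_field_derivative_transform_within_open[where S="{0<..}"])
      (use greater in \<open>auto simp: flat_def\<close>)
next
  case equal
  have "((\<lambda>h. flat p h / h) \<longlongrightarrow> 0) (at 0)"
    using flat_tendsto_0[of "[:0, 1:] * p"]
    by (rule Lim_transform_eventually) (auto simp: eventually_at_filter flat_def)
  then show ?thesis using equal by (simp add: DERIV_def flat_def)
qed

lemma smooth_flat: "Ck_on k (flat p) UNIV"
proof (induction k arbitrary: p)
  case 0
  have "isCont (flat p) y" for y using flat_derivative[of p y] by (rule DERIV_isCont)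
  then show ?case by (simp add: continuous_at_imp_continuous_on)
next
  case (Suc k)
  show ?case
    by (rule Ck_on_SucI[OF open_UNIV flat_derivative[unfolded has_field_derivative_def]])
      (intro Ck_on_mult Ck_on_const Suc.IH open_UNIV)
qed

definition smooth_step :: "real \<Rightarrow> real" where
  "smooth_step y = flat 1 y / (flat 1 y + flat 1 (1 - y))"

lemma flat_1: "flat 1 y \<ge> 0" "y > 0 \<Longrightarrow> flat 1 y > 0" "y \<le> 0 \<Longrightarrow> flat 1 y = 0"
  by (auto simp: flat_def)

lemma flat_1_sum_pos: "flat 1 y + flat 1 (1 - y) > 0"
  using flat_1(1,2)[of y] flat_1(1,2)[of "1 - y"] by (cases "y > 0") linarith+

lemma smooth_step:
  "y \<le> 0 \<Longrightarrow> smooth_step y = 0" "y \<ge> 1 \<Longrightarrow> smooth_step y = 1" "0 \<le> smooth_step y" "smooth_step y \<le> 1"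
  using flat_1[of y] flat_1[of "1 - y"] flat_1_sum_pos[of y] by (auto simp: smooth_step_def)

lemma smooth_smooth_step: "Ck_on k smooth_step UNIV"
proof -
  have "Ck_on k (\<lambda>y. flat 1 (1 - y)) UNIV"
    by (rule Ck_on_compose[OF open_UNIV subset_UNIV _ smooth_flat]) (intro Ck_on_intros Ck_on_ident open_UNIV)
  then have "Ck_on k (\<lambda>y. flat 1 y / (flat 1 y + flat 1 (1 - y))) UNIV"
    using flat_1_sum_pos by (intro Ck_on_intros open_UNIV smooth_flat) (auto simp: less_le)
  then show ?thesis unfolding smooth_step_def[abs_def] .
qed

text \<open>A product of radial smooth steps over a finite cover of \<open>K\<close>: the factor of a ball vanishes on
  that ball and is \<open>1\<close> off the ball of twice the radius, which lies in \<open>U\<close>.\<close>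

lemma smooth_cutoff:
  fixes K U :: "'a::euclidean_space set"
  assumes K: "compact K" and U: "open U" "K \<subseteq> U"
  obtains \<phi> G where "\<And>k. Ck_on k \<phi> UNIV" "open G" "K \<subseteq> G" "\<And>x. x \<in> G \<Longrightarrow> \<phi> x = 0"
    "\<And>x. x \<notin> U \<Longrightarrow> \<phi> x = 1" "\<And>x. 0 \<le> \<phi> x \<and> \<phi> x \<le> (1::real)"
proof -
  have "\<exists>r>0. ball x (2 * r) \<subseteq> U" if x: "x \<in> K" for x
  proof -
    obtain e where "e > 0" "ball x e \<subseteq> U" using U x by (meson openE subsetD)
    then show ?thesis by (intro exI[of _ "e / 2"]) simp
  qed
  then obtain r where r: "\<And>x. x \<in> K \<Longrightarrow> r x > 0" "\<And>x. x \<in> K \<Longrightarrow> ball x (2 * r x) \<subseteq> U" by metis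
  from K obtain I where I: "I \<subseteq> K" "finite I" "K \<subseteq> (\<Union>p\<in>I. ball p (r p))"
  proof (rule compactE_image[of _ K "\<lambda>p. ball p (r p)"])
    show "K \<subseteq> (\<Union>p\<in>K. ball p (r p))" using r(1) by fastforce
  qed auto
  define \<phi> where "\<phi> x = (\<Prod>p\<in>I. smooth_step (((x - p) \<bullet> (x - p) - (r p)\<^sup>2) / (3 * (r p)\<^sup>2)))" for x
  have rI: "r p > 0" if "p \<in> I" for p using r I that by blast
  show thesis
  proof
    show "Ck_on k \<phi> UNIV" for k
      unfolding \<phi>_def
    proof (intro Ck_on_prod open_UNIV)
      fix p assume p: "p \<in> I"
      show "Ck_on k (\<lambda>x. smooth_step (((x - p) \<bullet> (x - p) - (r p)\<^sup>2) / (3 * (r p)\<^sup>2))) UNIV"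
        by (rule Ck_on_compose[OF open_UNIV subset_UNIV _ smooth_smooth_step])
          (intro Ck_on_intros Ck_on_ident open_UNIV, use rI[OF p] in auto)
    qed
    show "open (\<Union>p\<in>I. ball p (r p))" by auto
    show "\<phi> x = 0" if "x \<in> (\<Union>p\<in>I. ball p (r p))" for x
    proof -
      from that have "\<exists>p\<in>I. norm (x - p) < r p" by (auto simp: dist_norm norm_minus_commute)
      then obtain p where p: "p \<in> I" "norm (x - p) < r p" by blast
      then have "(norm (x - p))\<^sup>2 \<le> (r p)\<^sup>2" by (intro power_mono) auto
      then have "smooth_step (((x - p) \<bullet> (x - p) - (r p)\<^sup>2) / (3 * (r p)\<^sup>2)) = 0"
        by (intro smooth_step(1) divide_nonpos_nonneg) (auto simp: power2_norm_eq_inner)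
      then show ?thesis unfolding \<phi>_def using p I(2) by (intro prod_zero) auto
    qed
    show "\<phi> x = 1" if x: "x \<notin> U" for x
      unfolding \<phi>_def
    proof (intro prod.neutral ballI smooth_step(2))
      fix p assume p: "p \<in> I"
      then have "x \<notin> ball p (2 * r p)" using r(2)[of p] I x by blast
      then have "2 * r p \<le> norm (x - p)" by (simp add: dist_norm norm_minus_commute)
      then have "(2 * r p)\<^sup>2 \<le> (norm (x - p))\<^sup>2" using rI[OF p] by (intro power_mono) auto
      then show "1 \<le> ((x - p) \<bullet> (x - p) - (r p)\<^sup>2) / (3 * (r p)\<^sup>2)"
        using rI[OF p] by (simp add: power2_norm_eq_inner power_mult_distrib field_simps)
    qed
    show "0 \<le> \<phi> x \<and> \<phi> x \<le> 1" for x
      unfolding \<phi>_def using smooth_step(3,4) by (auto intro!: prod_nonneg prod_le_1)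
  qed (use I in auto)
qed

section \<open>Boundary integrals\<close>

lemma bint_cong:
  assumes "on_bdry d S (\<lambda>x n. f x n = h x n)" shows "bint d S f = bint d S h"
  unfolding bint_def
proof (intro arg_cong[of _ _ sum_list] map_cong refl set_lebesgue_integral_cong ballI allI impI)
  fix \<gamma> s assume "\<gamma> \<in> set (curves d)"
  then show "indicat_real S (\<gamma> s) * f (\<gamma> s) (curve_normal \<gamma> s) * norm (vector_derivative \<gamma> (at s)) =
       indicat_real S (\<gamma> s) * h (\<gamma> s) (curve_normal \<gamma> s) * norm (vector_derivative \<gamma> (at s))"
    using assms by (auto simp: on_bdry_def indicator_def)
qed auto

locale regular_boundary =
  fixes kr :: nat and d :: fluid_domain
  assumes reg: "regular_domain kr d" and k1: "1 \<le> kr"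
begin

lemma
  shows open_dom: "open (dom d)" and frontier_dom: "frontier (dom d) = bdry d"
    and bounded_dom: "bounded (dom d)" and bdry_eq: "bdry d = wall d \<union> farfield d"
    and closed_wall: "closed (wall d)" and closed_far: "closed (farfield d)"
    and wall_far: "wall d \<inter> farfield d = {}" and iso_adia: "iso d \<inter> adia d = {}"
    and iso_borel: "iso d \<in> sets borel" and adia_borel: "adia d \<in> sets borel"
  using reg by (auto simp: regular_domain_def)

lemma bdry_closure: "bdry d \<subseteq> closure (dom d)"
  unfolding frontier_dom[symmetric] by (auto simp: frontier_def)

lemma wall_closure: "wall d \<subseteq> closure (dom d)" and far_closure: "farfield d \<subseteq> closure (dom d)"
  using bdry_closure bdry_eq by auto

lemma compact_wall: "compact (wall d)"
  using closed_wall wall_closure bounded_dom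
  by (meson bounded_closure bounded_subset compact_eq_bounded_closed)

context
  fixes \<gamma> assumes \<gamma>: "\<gamma> \<in> set (curves d)"
begin

lemma curve_C1: "Ck_on (Suc 0) \<gamma> UNIV"
  using reg \<gamma> k1 Ck_on_le[of kr \<gamma> UNIV "Suc 0"] by (auto simp: regular_domain_def)

lemma curve_periodic: "\<gamma> (s + 1) = \<gamma> s"
  using reg \<gamma> by (auto simp: regular_domain_def)

lemma curve_vd: "(\<gamma> has_vector_derivative vector_derivative \<gamma> (at s)) (at s)"
  using C1_curve[OF curve_C1] by simp

lemma curve_cont: "continuous_on A \<gamma>"
  using Ck_on_imp_continuous_on[OF curve_C1] continuous_on_subset by blast

lemma curve_vd_cont: "continuous_on A (\<lambda>s. vector_derivative \<gamma> (at s))"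
  using C1_curve_continuous[OF curve_C1] by auto

lemma curve_vd_nz: "vector_derivative \<gamma> (at s) \<noteq> 0"
  using reg \<gamma> by (auto simp: regular_domain_def)

lemma normal_cont: "continuous_on A (curve_normal \<gamma>)"
proof -
  have "continuous_on A (\<lambda>s. (1 / norm (vector_derivative \<gamma> (at s))) *\<^sub>R rot (vector_derivative \<gamma> (at s)))"
    by (intro continuous_intros bounded_linear.continuous_on[OF bounded_linear_rot] curve_vd_cont)
      (simp add: curve_vd_nz)
  then show ?thesis by (simp add: curve_normal_eq[abs_def])
qed

lemma curve_in_bdry: "\<gamma> s \<in> bdry d"
  using \<gamma> by (auto simp: bdry_def)

text \<open>A boundary curve is connected, while wall and far field are disjoint and closed.\<close>

lemma wall_or_far: "range \<gamma> \<subseteq> wall d \<or> range \<gamma> \<subseteq> farfield d"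
proof -
  have "connected (range \<gamma>)" by (rule connected_continuous_image[OF curve_cont connected_UNIV])
  moreover have "range \<gamma> \<subseteq> wall d \<union> farfield d" using curve_in_bdry bdry_eq by auto
  ultimately show ?thesis
    using connected_closed[of "range \<gamma>"] closed_wall closed_far wall_far by blast
qed

lemma wall_or_disjoint:
  assumes "S = wall d \<or> S = farfield d" shows "range \<gamma> \<subseteq> S \<or> range \<gamma> \<inter> S = {}"
  using wall_or_far wall_far assms by auto

lemma bint_term_integrable:
  assumes S: "S \<in> sets borel"
    and f: "continuous_on {0..1} (\<lambda>s. f (\<gamma> s) (curve_normal \<gamma> s))"
  shows "set_integrable lborel {0..1}
     (\<lambda>s. indicator S (\<gamma> s) * f (\<gamma> s) (curve_normal \<gamma> s) * norm (vector_derivative \<gamma> (at s)))"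
proof -
  let ?h = "\<lambda>s. f (\<gamma> s) (curve_normal \<gamma> s) * norm (vector_derivative \<gamma> (at s))"
  have "continuous_on {0..1} ?h" by (intro continuous_intros f curve_vd_cont)
  then have 1: "set_integrable lborel {0..1} ?h" by (intro borel_integrable_compact[folded set_integrable_def]) auto
  have "\<gamma> \<in> borel_measurable borel" using curve_cont[of UNIV] by (rule borel_measurable_continuous_onI)
  from measurable_sets_borel[OF this S] have "\<gamma> -` S \<in> sets borel" by simp
  then have "set_integrable lborel ({0..1} \<inter> \<gamma> -` S) ?h"
    by (intro set_integrable_subset[OF 1]) auto
  then show ?thesis
    unfolding set_integrable_def
    by (rule Bochner_Integration.integrable_cong[THEN iffD1, rotated -1]) (auto simp: indicator_def)
qed

end

lemma bint_0: "bint d S (\<lambda>x n. 0) = 0"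
  by (simp add: bint_def)

lemma bint_cmult: "bint d S (\<lambda>x n. c * f x n) = c * bint d S f"
proof -
  have "indicat_real S (\<gamma> s) * (c * f (\<gamma> s) (curve_normal \<gamma> s)) * norm (vector_derivative \<gamma> (at s)) =
    c * (indicat_real S (\<gamma> s) * f (\<gamma> s) (curve_normal \<gamma> s) * norm (vector_derivative \<gamma> (at s)))" for \<gamma> s
    by simp
  then show ?thesis unfolding bint_def by (simp only: set_integral_mult_right sum_list_const_mult)
qed

lemma bint_bdry_split: "bint d (bdry d) f = bint d (wall d) f + bint d (farfield d) f"
  unfolding bint_def sum_list_addf[symmetric]
proof (intro arg_cong[of _ _ sum_list] map_cong refl)
  fix \<gamma> assume g: "\<gamma> \<in> set (curves d)"
  have "indicat_real (bdry d) (\<gamma> s) = 1" for s using curve_in_bdry[OF g] by simp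
  moreover have "(\<forall>s. indicat_real (wall d) (\<gamma> s) = 1 \<and> indicat_real (farfield d) (\<gamma> s) = 0) \<or>
      (\<forall>s. indicat_real (wall d) (\<gamma> s) = 0 \<and> indicat_real (farfield d) (\<gamma> s) = 1)"
    using wall_or_far[OF g] wall_far by (auto simp: indicator_def)
  ultimately show "(LINT s:{0..1}|lborel. indicat_real (bdry d) (\<gamma> s) * f (\<gamma> s) (curve_normal \<gamma> s) * norm (vector_derivative \<gamma> (at s))) =
      (LINT s:{0..1}|lborel. indicat_real (wall d) (\<gamma> s) * f (\<gamma> s) (curve_normal \<gamma> s) * norm (vector_derivative \<gamma> (at s))) +
      (LINT s:{0..1}|lborel. indicat_real (farfield d) (\<gamma> s) * f (\<gamma> s) (curve_normal \<gamma> s) * norm (vector_derivative \<gamma> (at s)))"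
    by auto
qed

lemma bdry_minus_wall: "bdry d - wall d = farfield d"
  using bdry_eq wall_far by auto

text \<open>Continuity in point and normal together gives integrability along the boundary, because
  the unit normal is continuous along the curves.\<close>

definition bcont :: "(real^2) set \<Rightarrow> (real^2 \<Rightarrow> real^2 \<Rightarrow> real) \<Rightarrow> bool" where
  "bcont S f \<longleftrightarrow> continuous_on (S \<times> UNIV) (\<lambda>p. f (fst p) (snd p))"

lemma bcont_curve:
  assumes "bcont S f" "\<gamma> \<in> set (curves d)" "range \<gamma> \<subseteq> S"
  shows "continuous_on A (\<lambda>s. f (\<gamma> s) (curve_normal \<gamma> s))"
proof -
  have "continuous_on A (\<lambda>s. (\<gamma> s, curve_normal \<gamma> s))"
    by (intro continuous_intros curve_cont normal_cont assms(2))
  from continuous_on_compose2[OF assms(1)[unfolded bcont_def] this] show ?thesis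
    using assms(3) by auto
qed

lemma bint_part_integrable:
  assumes "bcont S f" "S = wall d \<or> S = farfield d" "S' \<subseteq> S" "S' \<in> sets borel" "\<gamma> \<in> set (curves d)"
  shows "set_integrable lborel {0..1}
     (\<lambda>s. indicator S' (\<gamma> s) * f (\<gamma> s) (curve_normal \<gamma> s) * norm (vector_derivative \<gamma> (at s)))"
proof (cases "range \<gamma> \<subseteq> S")
  case True
  show ?thesis by (rule bint_term_integrable[OF assms(5,4) bcont_curve[OF assms(1,5) True]])
next
  case False
  then have "\<gamma> s \<notin> S'" for s using wall_or_disjoint[OF assms(5,2)] assms(3) by auto
  then show ?thesis by (simp add: set_integrable_def)
qed

lemma bint_add:
  assumes S: "S = wall d \<or> S = farfield d" "S' \<subseteq> S" "S' \<in> sets borel" and "bcont S f" "bcont S h"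
  shows "bint d S' (\<lambda>x n. f x n + h x n) = bint d S' f + bint d S' h"
  unfolding bint_def sum_list_addf[symmetric]
proof (intro arg_cong[of _ _ sum_list] map_cong refl)
  fix \<gamma> assume g: "\<gamma> \<in> set (curves d)"
  show "(LINT s:{0..1}|lborel. indicat_real S' (\<gamma> s) * (f (\<gamma> s) (curve_normal \<gamma> s) + h (\<gamma> s) (curve_normal \<gamma> s)) * norm (vector_derivative \<gamma> (at s))) =
      (LINT s:{0..1}|lborel. indicat_real S' (\<gamma> s) * f (\<gamma> s) (curve_normal \<gamma> s) * norm (vector_derivative \<gamma> (at s))) +
      (LINT s:{0..1}|lborel. indicat_real S' (\<gamma> s) * h (\<gamma> s) (curve_normal \<gamma> s) * norm (vector_derivative \<gamma> (at s)))"
    unfolding distrib_left distrib_right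
    by (rule set_integral_add(2)) (rule bint_part_integrable[OF _ S g], fact)+
qed

lemma bcont_cmult: "bcont S f \<Longrightarrow> bcont S (\<lambda>x n. c * f x n)"
  unfolding bcont_def by (intro continuous_intros)

lemma bint_diff:
  assumes S: "S = wall d \<or> S = farfield d" "S' \<subseteq> S" "S' \<in> sets borel" and "bcont S f" "bcont S h"
  shows "bint d S' (\<lambda>x n. f x n - h x n) = bint d S' f - bint d S' h"
  using bint_add[OF assms(1-4) bcont_cmult[OF assms(5), of "-1"]] bint_cmult[of S' "-1" h] by simp

lemma bint_wall_split:
  assumes "bcont (wall d) f" shows "bint d (wall d) f = bint d (iso d) f + bint d (adia d) f"
  unfolding bint_def sum_list_addf[symmetric]
proof (intro arg_cong[of _ _ sum_list] map_cong refl)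
  fix \<gamma> assume g: "\<gamma> \<in> set (curves d)"
  have "indicat_real (wall d) x = indicat_real (iso d) x + indicat_real (adia d) x" for x
    using iso_adia by (auto simp: wall_def indicator_def)
  then show "(LINT s:{0..1}|lborel. indicat_real (wall d) (\<gamma> s) * f (\<gamma> s) (curve_normal \<gamma> s) * norm (vector_derivative \<gamma> (at s))) =
      (LINT s:{0..1}|lborel. indicat_real (iso d) (\<gamma> s) * f (\<gamma> s) (curve_normal \<gamma> s) * norm (vector_derivative \<gamma> (at s))) +
      (LINT s:{0..1}|lborel. indicat_real (adia d) (\<gamma> s) * f (\<gamma> s) (curve_normal \<gamma> s) * norm (vector_derivative \<gamma> (at s)))"
    unfolding distrib_right
    by (subst set_integral_add(2)[symmetric])
      (auto intro!: bint_part_integrable[OF assms _ _ _ g] simp: iso_borel adia_borel wall_def distrib_right)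
qed

lemma bint_flux:
  assumes S: "S = wall d \<or> S = farfield d" and Y: "continuous_on S Y"
  shows "bint d S (\<lambda>x n. Y x \<bullet> n) = (\<Sum>\<gamma>\<leftarrow>curves d. if range \<gamma> \<subseteq> S then flux_int \<gamma> Y else 0)"
  unfolding bint_def
proof (intro arg_cong[of _ _ sum_list] map_cong refl)
  fix \<gamma> assume g: "\<gamma> \<in> set (curves d)"
  show "(LINT s:{0..1}|lborel. indicat_real S (\<gamma> s) * (Y (\<gamma> s) \<bullet> curve_normal \<gamma> s) * norm (vector_derivative \<gamma> (at s))) =
         (if range \<gamma> \<subseteq> S then flux_int \<gamma> Y else 0)"
  proof (cases "range \<gamma> \<subseteq> S")
    case True
    have eq: "indicat_real S (\<gamma> s) * (Y (\<gamma> s) \<bullet> curve_normal \<gamma> s) * norm (vector_derivative \<gamma> (at s))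
        = Y (\<gamma> s) \<bullet> rot (vector_derivative \<gamma> (at s))" for s
    proof -
      have "\<gamma> s \<in> S" using True by blast
      then show ?thesis using norm_curve_normal[of \<gamma> s, symmetric] by simp
    qed
    have "continuous_on {0..1} (\<lambda>s. Y (\<gamma> s) \<bullet> rot (vector_derivative \<gamma> (at s)))"
      using True by (intro continuous_intros bounded_linear.continuous_on[OF bounded_linear_rot]
          curve_vd_cont[OF g] continuous_on_compose2[OF Y curve_cont[OF g]]) auto
    then have "set_integrable lborel {0..1} (\<lambda>s. Y (\<gamma> s) \<bullet> rot (vector_derivative \<gamma> (at s)))"
      by (intro borel_integrable_compact[folded set_integrable_def]) auto
    from set_borel_integral_eq_integral(2)[OF this] show ?thesis
      unfolding eq using True by (simp add: flux_int_def)
  next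
    case False
    then have "\<gamma> s \<notin> S" for s using wall_or_disjoint[OF g S] by auto
    then show ?thesis using False by simp
  qed
qed

lemma bint_flux_bdry:
  assumes "continuous_on (bdry d) Y"
  shows "bint d (bdry d) (\<lambda>x n. Y x \<bullet> n) = (\<Sum>\<gamma>\<leftarrow>curves d. flux_int \<gamma> Y)"
proof -
  have c: "continuous_on (wall d) Y" "continuous_on (farfield d) Y"
    using assms bdry_eq by (auto elim: continuous_on_subset)
  show ?thesis
    unfolding bint_bdry_split bint_flux[OF disjI1[OF refl] c(1)] bint_flux[OF disjI2[OF refl] c(2)] sum_list_addf[symmetric]
  proof (intro arg_cong[of _ _ sum_list] map_cong refl)
    fix \<gamma> assume g: "\<gamma> \<in> set (curves d)"
    show "(if range \<gamma> \<subseteq> wall d then flux_int \<gamma> Y else 0) + (if range \<gamma> \<subseteq> farfield d then flux_int \<gamma> Y else 0) = flux_int \<gamma> Y"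
    proof (cases "range \<gamma> \<subseteq> wall d")
      case True
      then have "\<not> range \<gamma> \<subseteq> farfield d" using wall_far rangeI[of \<gamma> 0] by blast
      then show ?thesis using True by simp
    qed (use wall_or_far[OF g] in simp)
  qed
qed

end

section \<open>Time derivatives on a moving boundary\<close>

lemma countable_isolated:
  fixes A :: "'a::second_countable_topology set"
  assumes "\<And>a. a \<in> A \<Longrightarrow> \<not> a islimpt A"
  shows "countable A"
proof -
  obtain B :: "'a set set" where B: "countable B" "topological_basis B"
    using ex_countable_basis by blast
  have "A \<subseteq> (\<lambda>b. the_elem (b \<inter> A)) ` B"
  proof
    fix a assume a: "a \<in> A"
    then obtain T where T: "a \<in> T" "open T" "\<And>y. y \<in> A \<Longrightarrow> y \<in> T \<Longrightarrow> y = a"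
      using assms[OF a] unfolding islimpt_def by blast
    obtain b where b: "b \<in> B" "a \<in> b" "b \<subseteq> T"
      using topological_basisE[OF B(2) T(2,1)] by blast
    then have "b \<inter> A = {a}" using a T by blast
    then show "a \<in> (\<lambda>b. the_elem (b \<inter> A)) ` B" using b by (intro image_eqI[of _ _ b]) auto
  qed
  then show ?thesis using B(1) countable_subset countable_image by metis
qed

text \<open>At an accumulation point of the zero set the difference quotients force the derivative to
  vanish; the other points of the zero set are isolated.\<close>

lemma countable_nonzero_derivative:
  fixes f f' :: "real \<Rightarrow> real"
  assumes d: "\<And>s. (f has_real_derivative f' s) (at s)" and z: "\<And>s. s \<in> S \<Longrightarrow> f s = 0"
  shows "countable {s \<in> S. f' s \<noteq> 0}"
proof (rule countable_isolated)
  fix a assume a: "a \<in> {s \<in> S. f' s \<noteq> 0}"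
  show "\<not> a islimpt {s \<in> S. f' s \<noteq> 0}"
  proof
    assume "a islimpt {s \<in> S. f' s \<noteq> 0}"
    then have "a islimpt S" by (rule islimpt_subset) auto
    then have nb: "at a within S \<noteq> bot" by (simp add: trivial_limit_within)
    have "((\<lambda>y. (f y - f a) / (y - a)) \<longlongrightarrow> f' a) (at a within S)"
      using has_field_derivative_at_within[OF d[of a], of S] by (simp add: has_field_derivative_iff)
    then have "((\<lambda>y. 0) \<longlongrightarrow> f' a) (at a within S)"
      by (rule Lim_transform_eventually) (use a z in \<open>auto simp: eventually_at_filter\<close>)
    then have "f' a = 0" using nb tendsto_unique[OF nb _ tendsto_const] by metis
    then show False using a by simp
  qed
qed

text \<open>The wall conditions hold for \<open>t \<ge> 0\<close> only, so they are differentiated from the right.\<close>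

lemma right_constant_derivative:
  fixes f :: "real \<Rightarrow> 'a::real_normed_vector"
  assumes "(f has_vector_derivative D) (at 0)" "0 < \<epsilon>" "\<And>t. 0 \<le> t \<Longrightarrow> t < \<epsilon> \<Longrightarrow> f t = c"
  shows "D = 0"
proof -
  have 1: "(f has_vector_derivative D) (at 0 within {0..<\<epsilon>})"
    by (rule has_vector_derivative_at_within[OF assms(1)])
  have "((\<lambda>t. c) has_vector_derivative 0) (at 0 within {0..<\<epsilon>})" by (rule has_vector_derivative_const)
  then have 2: "(f has_vector_derivative 0) (at 0 within {0..<\<epsilon>})"
    by (rule has_vector_derivative_transform[rotated -1]) (use assms in auto)
  have "at (0::real) within {0..<\<epsilon>} \<noteq> bot"
    using assms(2) by (simp add: trivial_limit_within)
  from vector_derivative_unique_within[OF this 1 2] show ?thesis .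
qed

lemma Dm_mult:
  fixes f :: "real^'n \<Rightarrow> real^'m"
  assumes "(f has_derivative D) (at x)" shows "Dm f x *v h = D h"
  unfolding jacobian_def frechet_derivative_at[OF assms, symmetric]
  using matrix_works[of D] assms has_derivative_linear by (metis matrix_vector_mul(2))

context
  fixes Y :: "real \<Rightarrow> real^2 \<Rightarrow> 'b::real_normed_vector" and Q k
  assumes Y: "Ck_on (Suc k) (\<lambda>(t, x). Y t x) Q" and Q: "open Q"
begin

abbreviation "DY t x \<equiv> frechet_derivative (\<lambda>(t, x). Y t x) (at (t, x))"

lemma joint_derivative: "(t, x) \<in> Q \<Longrightarrow> ((\<lambda>(t, x). Y t x) has_derivative DY t x) (at (t, x))"
  by (rule Ck_on_has_derivative[OF Y])

lemma slice_x: 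
  assumes "(t, x) \<in> Q" shows "(Y t has_derivative (\<lambda>h. DY t x (0, h))) (at x)"
proof -
  have "((\<lambda>x. (t, x)) has_derivative (\<lambda>h. (0, h))) (at x)" by (auto intro!: derivative_eq_intros)
  from has_derivative_compose[OF this joint_derivative[OF assms]] show ?thesis by simp
qed

lemma moving_point:
  assumes "(t, x + t *\<^sub>R w) \<in> Q"
  shows "((\<lambda>t. Y t (x + t *\<^sub>R w)) has_vector_derivative DY t (x + t *\<^sub>R w) (1, w)) (at t within S)"
proof -
  have 1: "((\<lambda>t. (t, x + t *\<^sub>R w)) has_derivative (\<lambda>h. (h, h *\<^sub>R w))) (at t within S)"
    by (auto intro!: derivative_eq_intros)
  have lin: "linear (DY t (x + t *\<^sub>R w))" using joint_derivative[OF assms] has_derivative_linear by blast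
  have "DY t (x + t *\<^sub>R w) (h, h *\<^sub>R w) = h *\<^sub>R DY t (x + t *\<^sub>R w) (1, w)" for h
    using linear_cmul[OF lin, of h "(1, w)"] by simp
  with has_derivative_compose[OF 1 joint_derivative[OF assms]] show ?thesis
    by (simp add: has_vector_derivative_def)
qed

lemma slice_t: "(t, x) \<in> Q \<Longrightarrow> ((\<lambda>t. Y t x) has_vector_derivative DY t x (1, 0)) (at t)"
  using moving_point[of t x 0] by simp

lemma DY_split: 
  assumes "(t, x) \<in> Q" shows "DY t x (1, w) = DY t x (1, 0) + DY t x (0, w)"
proof -
  have lin: "linear (DY t x)" using joint_derivative[OF assms] has_derivative_linear by blast
  show ?thesis using linear_add[OF lin, of "(1, 0)" "(0, w)"] by simp
qed

lemma shape_deriv_eq: "(0, x) \<in> Q \<Longrightarrow> shape_deriv (\<lambda>t. Y t x) = DY 0 x (1, 0)"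
  unfolding shape_deriv_def using vector_derivative_at[OF slice_t] by simp

lemma Ck_on_pd: "Ck_on k (\<lambda>(t, x). pd l (Y t) x) Q"
proof (rule Ck_on_cong_imp[OF Q _ Ck_on_derivative[OF Y, of "(0, axis l 1)"]])
  fix y assume "y \<in> Q"
  then show "frechet_derivative (\<lambda>(t, x). Y t x) (at y) (0, axis l 1) = (case y of (t, x) \<Rightarrow> pd l (Y t) x)"
    using fun_cong[OF frechet_derivative_at[OF slice_x[of "fst y" "snd y"]], of "axis l 1"]
    by (simp add: case_prod_beta pd_def)
qed

lemma slice_Ck: "Ck_on (Suc k) (Y t) {x. (t, x) \<in> Q}"
proof -
  have "open (Pair t -` Q)"
    by (rule open_vimage[OF Q]) (intro continuous_intros)
  then have op: "open {x. (t, x) \<in> Q}" by (simp add: vimage_def)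
  have P: "Ck_on j (Pair t) {x. (t, x) \<in> Q}" for j
  proof -
    have 0: "Ck_on j (\<lambda>x::real^2. (t, 0::real^2) + (0, x)) {x. (t, x) \<in> Q}"
      by (intro Ck_on_add Ck_on_const op Ck_on_bounded_linear bounded_linear_Pair bounded_linear_zero bounded_linear_ident)
    then show ?thesis by simp
  qed
  have "Ck_on (Suc k) (\<lambda>x. (\<lambda>(t, x). Y t x) (Pair t x)) {x. (t, x) \<in> Q}"
    by (rule Ck_on_compose[OF op _ P Y]) auto
  then show ?thesis by simp
qed

end

context regular_boundary begin

lemma wall_pert: "wall (perturb V t d) = (\<lambda>x. x + t *\<^sub>R V x) ` wall d"
  by (auto simp: wall_def perturb_def Let_def)

lemma adia_pert: "adia (perturb V t d) = (\<lambda>x. x + t *\<^sub>R V x) ` adia d"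
  and iso_pert: "iso (perturb V t d) = (\<lambda>x. x + t *\<^sub>R V x) ` iso d"
  by (auto simp: perturb_def Let_def)

lemma curves_pert: "curves (perturb V t d) = map (\<lambda>\<gamma> s. \<gamma> s + t *\<^sub>R V (\<gamma> s)) (curves d)"
  by (simp add: perturb_def Let_def o_def)

end

locale perturbed_boundary = regular_boundary +
  fixes V :: "real^2 \<Rightarrow> real^2" and \<epsilon> :: real and N :: "(real^2) set"
  assumes VC: "Ck_on (Suc 0) V UNIV" and V_far: "\<And>x. x \<in> farfield d \<Longrightarrow> V x = 0"
    and \<epsilon>: "0 < \<epsilon>" and N: "open N" "closure (dom d) \<subseteq> N"
begin

abbreviation "Q \<equiv> {-\<epsilon><..<\<epsilon>} \<times> N"

lemma open_Q: "open Q" using N by (intro open_Times) auto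

lemma wall_N: "wall d \<subseteq> N" using wall_closure N by blast

lemma V_continuous: "continuous_on A V"
  using Ck_on_imp_continuous_on[OF VC] continuous_on_subset by blast

text \<open>The derivative of the perturbation field along a boundary curve; the perturbed curve has
  velocity \<open>\<gamma>' + t w'\<close>.\<close>

definition w' :: "(real \<Rightarrow> real^2) \<Rightarrow> real \<Rightarrow> real^2" where
  "w' \<gamma> s = frechet_derivative V (at (\<gamma> s)) (vector_derivative \<gamma> (at s))"

lemma w'_cont: "\<gamma> \<in> set (curves d) \<Longrightarrow> continuous_on A (w' \<gamma>)"
  unfolding w'_def by (rule Ck_on_continuous_derivative[OF VC curve_cont]) (auto intro: curve_vd_cont)

lemma w_deriv:
  assumes g: "\<gamma> \<in> set (curves d)"
  shows "((\<lambda>s. V (\<gamma> s)) has_vector_derivative w' \<gamma> s) (at s)"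
proof -
  have D: "(V has_derivative frechet_derivative V (at (\<gamma> s))) (at (\<gamma> s))"
    using Ck_on_has_derivative[OF VC] by simp
  from has_derivative_compose[OF curve_vd[OF g, unfolded has_vector_derivative_def] D]
  show ?thesis
    unfolding has_vector_derivative_def w'_def
    by (simp add: linear_cmul[OF has_derivative_linear[OF D]])
qed

lemma pert_vd:
  assumes g: "\<gamma> \<in> set (curves d)"
  shows "vector_derivative (\<lambda>s. \<gamma> s + t *\<^sub>R V (\<gamma> s)) (at s) = vector_derivative \<gamma> (at s) + t *\<^sub>R w' \<gamma> s"
  by (rule vector_derivative_at)
    (intro has_vector_derivative_add curve_vd[OF g] bounded_linear.has_vector_derivative[OF bounded_linear_scaleR_right] w_deriv[OF g])

lemma small_time:
  "\<exists>\<delta>>0. \<delta> \<le> \<epsilon> \<and> (\<forall>x\<in>wall d. \<forall>t. \<bar>t\<bar> < \<delta> \<longrightarrow> x + t *\<^sub>R V x \<in> N - farfield d)"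
proof -
  have "open (N - farfield d)" "wall d \<subseteq> N - farfield d"
    using N closed_far wall_N wall_far by auto
  from compact_subset_open_imp_ball_epsilon_subset[OF compact_wall this]
  obtain e where e: "e > 0" "(\<Union>x\<in>wall d. ball x e) \<subseteq> N - farfield d" .
  have "bounded (V ` wall d)"
    by (intro compact_imp_bounded compact_continuous_image V_continuous compact_wall)
  then obtain M where M: "M > 0" "\<And>x. x \<in> wall d \<Longrightarrow> norm (V x) \<le> M"
    by (auto simp: bounded_pos)
  have *: "x + t *\<^sub>R V x \<in> N - farfield d" if "x \<in> wall d" "\<bar>t\<bar> < min \<epsilon> (e / M)" for x t
  proof -
    have "\<bar>t\<bar> * norm (V x) \<le> \<bar>t\<bar> * M" using M that by (intro mult_left_mono) auto
    also have "\<dots> < e" using that M by (simp add: field_simps)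
    finally have "x + t *\<^sub>R V x \<in> ball x e" by (simp add: dist_norm)
    then show ?thesis using e that by blast
  qed
  show ?thesis
    by (rule exI[of _ "min \<epsilon> (e / M)"]) (use \<epsilon> e(1) M(1) * in auto)
qed

text \<open>Pulled back to the original curves, the flux is a parameter integral over a fixed interval. Its
  time derivative contains \<open>D Y V \<bullet> rot \<gamma>' + Y \<bullet> rot (V \<circ> \<gamma>)'\<close>, which by the trace identity is
  \<open>div Y (V \<bullet> rot \<gamma>')\<close> plus a total derivative along a closed curve. The curves that belong to the
  far field are not moved.\<close>

theorem flux_shape_derivative:
  assumes Y: "Ck_on (Suc 0) (\<lambda>(t, x). Y t x) Q"
  shows "((\<lambda>t. (bint (perturb V t d) (wall (perturb V t d)) (\<lambda>x n. Y t x \<bullet> n) - bint d (wall d) (\<lambda>x n. Y 0 x \<bullet> n)) / t)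
    \<longlongrightarrow> bint d (wall d) (\<lambda>x n. shape_deriv (\<lambda>t. Y t x) \<bullet> n + (V x \<bullet> n) * divg (Y 0) x)) (at_right 0)"
proof -
  obtain \<delta> where \<delta>: "0 < \<delta>" "\<delta> \<le> \<epsilon>" "\<And>x t. x \<in> wall d \<Longrightarrow> \<bar>t\<bar> < \<delta> \<Longrightarrow> x + t *\<^sub>R V x \<in> N"
    "\<And>x t. x \<in> wall d \<Longrightarrow> \<bar>t\<bar> < \<delta> \<Longrightarrow> x + t *\<^sub>R V x \<notin> farfield d"
    using small_time by blast
  define D where "D = frechet_derivative (\<lambda>(t, x). Y t x)"
  note Yd = slice_x[OF Y open_Q] moving_point[OF Y open_Q] DY_split[OF Y open_Q] shape_deriv_eq[OF Y open_Q]
  have cY: "continuous_on Q (\<lambda>(t, x). Y t x)" using Ck_on_imp_continuous_on[OF Y] .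
  define f where "f \<gamma> t s = Y t (\<gamma> s + t *\<^sub>R V (\<gamma> s)) \<bullet> rot (vector_derivative \<gamma> (at s) + t *\<^sub>R w' \<gamma> s)" for \<gamma> t s
  define g where "g \<gamma> t = integral {0..1} (f \<gamma> t)" for \<gamma> t
  have wall_curve: "\<gamma> s \<in> wall d" if "range \<gamma> \<subseteq> wall d" for \<gamma> and s :: real using that by blast
  have inQ: "(t, \<gamma> s + t *\<^sub>R V (\<gamma> s)) \<in> Q" if "range \<gamma> \<subseteq> wall d" "\<bar>t\<bar> < \<delta>" for \<gamma> and s :: real and t
    using \<delta>(2) \<delta>(3)[OF wall_curve[OF that(1)] that(2)] that(2) by auto
  have cf: "continuous_on ({-\<delta><..<\<delta>} \<times> {0..1}) (\<lambda>(t, s). f \<gamma> t s)"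
    if \<gamma>: "\<gamma> \<in> set (curves d)" "range \<gamma> \<subseteq> wall d" for \<gamma>
  proof -
    have 1: "continuous_on ({-\<delta><..<\<delta>} \<times> {0..1}) (\<lambda>y. (fst y, \<gamma> (snd y) + fst y *\<^sub>R V (\<gamma> (snd y))))"
      by (intro continuous_intros continuous_on_compose2[OF curve_cont[OF \<gamma>(1), of UNIV]]
          continuous_on_compose2[OF V_continuous[of UNIV]]) auto
    have im: "(\<lambda>y. (fst y, \<gamma> (snd y) + fst y *\<^sub>R V (\<gamma> (snd y)))) ` ({-\<delta><..<\<delta>} \<times> {0..1}) \<subseteq> Q"
      using inQ[OF \<gamma>(2)] by (auto simp: abs_less_iff)
    note 2 = continuous_on_compose2[OF cY 1 im, unfolded case_prod_conv]
    show ?thesis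
      unfolding f_def case_prod_beta
      by (intro continuous_intros bounded_linear.continuous_on[OF bounded_linear_rot] 2
          continuous_on_compose2[OF curve_vd_cont[OF \<gamma>(1), of UNIV]] continuous_on_compose2[OF w'_cont[OF \<gamma>(1), of UNIV]])
        auto
  qed
  have cf1: "continuous_on {0..1} (f \<gamma> t)" if \<gamma>: "\<gamma> \<in> set (curves d)" "range \<gamma> \<subseteq> wall d" and t: "\<bar>t\<bar> < \<delta>" for \<gamma> t
  proof -
    have "continuous_on {0..1} (\<lambda>s. (t, s))" "(\<lambda>s. (t, s)) ` {0..1} \<subseteq> {-\<delta><..<\<delta>} \<times> {0..1}"
      using t by (auto intro!: continuous_intros)
    from continuous_on_compose2[OF cf[OF \<gamma>] this] show ?thesis by simp
  qed
  have pull: "bint (perturb V t d) (wall (perturb V t d)) (\<lambda>x n. Y t x \<bullet> n)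
      = (\<Sum>\<gamma>\<leftarrow>curves d. if range \<gamma> \<subseteq> wall d then g \<gamma> t else 0)" if t: "\<bar>t\<bar> < \<delta>" for t
    unfolding bint_def curves_pert map_map o_def
  proof (intro arg_cong[of _ _ sum_list] map_cong refl)
    fix \<gamma> assume \<gamma>: "\<gamma> \<in> set (curves d)"
    let ?\<gamma> = "\<lambda>s. \<gamma> s + t *\<^sub>R V (\<gamma> s)"
    show "(LINT s:{0..1}|lborel. indicat_real (wall (perturb V t d)) (?\<gamma> s) * (Y t (?\<gamma> s) \<bullet> curve_normal ?\<gamma> s)
         * norm (vector_derivative ?\<gamma> (at s))) = (if range \<gamma> \<subseteq> wall d then g \<gamma> t else 0)"
    proof (cases "range \<gamma> \<subseteq> wall d")
      case True
      have "indicat_real (wall (perturb V t d)) (?\<gamma> s) = 1" for s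
        using wall_curve[OF True, of s] by (simp add: wall_pert)
      then have eq: "indicat_real (wall (perturb V t d)) (?\<gamma> s) * (Y t (?\<gamma> s) \<bullet> curve_normal ?\<gamma> s)
         * norm (vector_derivative ?\<gamma> (at s)) = f \<gamma> t s" for s
        using norm_curve_normal[of ?\<gamma> s, symmetric] by (simp add: f_def pert_vd[OF \<gamma>])
      have "set_integrable lborel {0..1} (f \<gamma> t)"
        using cf1[OF \<gamma> True t] by (intro borel_integrable_compact[folded set_integrable_def]) auto
      from set_borel_integral_eq_integral(2)[OF this] show ?thesis
        unfolding eq using True by (simp add: g_def)
    next
      case False
      then have far: "\<gamma> s \<in> farfield d" for s using wall_or_far[OF \<gamma>] by blast
      have "?\<gamma> s \<notin> wall (perturb V t d)" for s
      proof
        assume "?\<gamma> s \<in> wall (perturb V t d)"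
        then obtain x where "x \<in> wall d" "\<gamma> s = x + t *\<^sub>R V x"
          using V_far[OF far[of s]] by (auto simp: wall_pert)
        then show False using \<delta>(4)[OF _ t] far[of s] by metis
      qed
      then show ?thesis using False by simp
    qed
  qed
  have pull0: "bint d (wall d) (\<lambda>x n. Y 0 x \<bullet> n) = (\<Sum>\<gamma>\<leftarrow>curves d. if range \<gamma> \<subseteq> wall d then g \<gamma> 0 else 0)"
  proof -
    have "continuous_on (wall d) (Y 0)"
    proof -
      have "continuous_on (wall d) (\<lambda>x. (0::real, x))" "(\<lambda>x. (0, x)) ` wall d \<subseteq> Q"
        using wall_N \<epsilon> by (auto intro!: continuous_intros)
      from continuous_on_compose2[OF cY this] show ?thesis by simp
    qed
    from bint_flux[OF disjI1[OF refl] this] show ?thesis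
      by (simp add: g_def f_def[abs_def] flux_int_def cong: if_cong)
  qed
  define Z where "Z x = D (at (0, x)) (1, 0) + divg (Y 0) x *\<^sub>R V x" for x
  have Y0C: "Ck_on (Suc 0) (Y 0) N"
    using slice_Ck[OF Y open_Q, of 0] \<epsilon> by simp
  have cZ: "continuous_on (wall d) Z"
    unfolding Z_def D_def
    by (intro continuous_intros V_continuous C1_continuous_divg[OF Y0C wall_N] Ck_on_continuous_derivative[OF Y])
      (use wall_N \<epsilon> in auto)
  have gd: "(g \<gamma> has_vector_derivative flux_int \<gamma> Z) (at 0)" if \<gamma>: "\<gamma> \<in> set (curves d)" "range \<gamma> \<subseteq> wall d" for \<gamma>
  proof -
    let ?\<gamma>' = "\<lambda>s. vector_derivative \<gamma> (at s)"
    define fx where "fx t s = D (at (t, \<gamma> s + t *\<^sub>R V (\<gamma> s))) (1, V (\<gamma> s)) \<bullet> rot (?\<gamma>' s + t *\<^sub>R w' \<gamma> s)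
      + Y t (\<gamma> s + t *\<^sub>R V (\<gamma> s)) \<bullet> rot (w' \<gamma> s)" for t s
    have "(g \<gamma> has_vector_derivative integral (cbox 0 1) (fx 0)) (at 0 within {-\<delta><..<\<delta>})"
      unfolding g_def cbox_interval[symmetric]
    proof (rule leibniz_rule_vector_derivative)
      fix t s :: real assume "t \<in> {-\<delta><..<\<delta>}" "s \<in> cbox 0 1"
      then have t: "\<bar>t\<bar> < \<delta>" by auto
      have r: "((\<lambda>t. rot (?\<gamma>' s + t *\<^sub>R w' \<gamma> s)) has_vector_derivative rot (w' \<gamma> s)) (at t within {-\<delta><..<\<delta>})"
        by (rule bounded_linear.has_vector_derivative[OF bounded_linear_rot]) (auto intro!: derivative_eq_intros)
      show "((\<lambda>t. f \<gamma> t s) has_vector_derivative fx t s) (at t within {-\<delta><..<\<delta>})"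
        unfolding f_def fx_def D_def
        using bounded_bilinear.has_vector_derivative[OF bounded_bilinear_inner Yd(2)[OF inQ[OF \<gamma>(2) t]] r]
        by (simp add: add.commute)
    next
      fix t assume "t \<in> {-\<delta><..<\<delta>}"
      then show "f \<gamma> t integrable_on cbox 0 1"
        using cf1[OF \<gamma>] by (auto intro!: integrable_continuous_real simp: abs_less_iff)
    next
      have 1: "continuous_on ({-\<delta><..<\<delta>} \<times> cbox 0 1) (\<lambda>y. (fst y, \<gamma> (snd y) + fst y *\<^sub>R V (\<gamma> (snd y))))"
        by (intro continuous_intros continuous_on_compose2[OF curve_cont[OF \<gamma>(1), of UNIV]]
            continuous_on_compose2[OF V_continuous[of UNIV]]) auto
      have 2: "continuous_on ({-\<delta><..<\<delta>} \<times> cbox 0 1) (\<lambda>y. (1, V (\<gamma> (snd y))))"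
        by (intro continuous_intros continuous_on_compose2[OF curve_cont[OF \<gamma>(1), of UNIV]]
            continuous_on_compose2[OF V_continuous[of UNIV]]) auto
      have im: "(\<lambda>y. (fst y, \<gamma> (snd y) + fst y *\<^sub>R V (\<gamma> (snd y)))) ` ({-\<delta><..<\<delta>} \<times> cbox 0 1) \<subseteq> Q"
        using inQ[OF \<gamma>(2)] by (auto simp: abs_less_iff)
      note 3 = Ck_on_continuous_derivative[OF Y 1 im 2]
      note 4 = continuous_on_compose2[OF cY 1 im, unfolded case_prod_conv]
      have "continuous_on ({-\<delta><..<\<delta>} \<times> cbox 0 1) (\<lambda>y. fx (fst y) (snd y))"
        unfolding fx_def D_def
        by (intro continuous_intros bounded_linear.continuous_on[OF bounded_linear_rot] 3 4
          continuous_on_compose2[OF curve_vd_cont[OF \<gamma>(1), of UNIV]] continuous_on_compose2[OF w'_cont[OF \<gamma>(1), of UNIV]]) auto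
      then show "continuous_on ({-\<delta><..<\<delta>} \<times> cbox 0 1) (\<lambda>(t, s). fx t s)" by (simp add: case_prod_beta)
    qed (use \<delta> in auto)
    then have "(g \<gamma> has_vector_derivative integral {0..1} (fx 0)) (at 0)"
      using \<delta>(1) by (simp add: at_within_open[of 0 "{-\<delta><..<\<delta>}"] has_vector_derivative_def)
    moreover have "integral {0..1} (fx 0) = flux_int \<gamma> Z"
    proof -
      define \<theta>' where "\<theta>' s = D (at (0, \<gamma> s)) (0, ?\<gamma>' s) \<bullet> rot (V (\<gamma> s)) + Y 0 (\<gamma> s) \<bullet> rot (w' \<gamma> s)" for s
      have in0: "(0, \<gamma> s) \<in> Q" for s using inQ[OF \<gamma>(2), of 0 s] \<delta>(1) by simp
      have "(\<theta>' has_integral Y 0 (\<gamma> 1) \<bullet> rot (V (\<gamma> 1)) - Y 0 (\<gamma> 0) \<bullet> rot (V (\<gamma> 0))) {0..1}"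
      proof (rule fundamental_theorem_of_calculus)
        fix s :: real
        have lin: "linear (\<lambda>h. D (at (0, \<gamma> s)) (0, h))"
          using has_derivative_linear[OF Yd(1)[OF in0]] by (simp add: D_def)
        have 1: "((\<lambda>s. Y 0 (\<gamma> s)) has_vector_derivative D (at (0, \<gamma> s)) (0, ?\<gamma>' s)) (at s)"
          using has_derivative_compose[OF curve_vd[OF \<gamma>(1), of s, unfolded has_vector_derivative_def] Yd(1)[OF in0]]
          unfolding has_vector_derivative_def D_def[symmetric] by (simp add: linear_cmul[OF lin])
        have 2: "((\<lambda>s. rot (V (\<gamma> s))) has_vector_derivative rot (w' \<gamma> s)) (at s)"
          by (rule bounded_linear.has_vector_derivative[OF bounded_linear_rot w_deriv[OF \<gamma>(1)]])
        show "((\<lambda>s. Y 0 (\<gamma> s) \<bullet> rot (V (\<gamma> s))) has_vector_derivative \<theta>' s) (at s within {0..1})"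
          unfolding \<theta>'_def
          by (rule has_vector_derivative_at_within,
              rule has_vector_derivative_eq_rhs[OF bounded_bilinear.has_vector_derivative[OF bounded_bilinear_inner 1 2]])
            (rule add.commute)
      qed simp
      then have \<theta>: "(\<theta>' has_integral 0) {0..1}"
        using curve_periodic[OF \<gamma>(1), of 0] by simp
      have "(\<lambda>s. Z (\<gamma> s) \<bullet> rot (?\<gamma>' s)) integrable_on {0..1}"
        by (rule flux_int_integrable[OF curve_C1[OF \<gamma>(1)] cZ \<gamma>(2)])
      from has_integral_add[OF integrable_integral[OF this] \<theta>]
      have "((\<lambda>s. Z (\<gamma> s) \<bullet> rot (?\<gamma>' s) + \<theta>' s) has_integral flux_int \<gamma> Z) {0..1}"
        by (simp add: flux_int_def)
      moreover have "Z (\<gamma> s) \<bullet> rot (?\<gamma>' s) + \<theta>' s = fx 0 s" for s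
        using trace_identity[OF Yd(1)[OF in0], of s "V (\<gamma> s)" "?\<gamma>' s"] Yd(3)[OF in0, of s "V (\<gamma> s)"]
        by (simp add: Z_def \<theta>'_def fx_def D_def inner_add_left)
      ultimately show ?thesis by (simp add: integral_unique)
    qed
    ultimately show ?thesis by simp
  qed
  define G where "G t = (\<Sum>\<gamma>\<leftarrow>curves d. if range \<gamma> \<subseteq> wall d then g \<gamma> t else 0)" for t
  have "(G has_vector_derivative (\<Sum>\<gamma>\<leftarrow>cs. if range \<gamma> \<subseteq> wall d then flux_int \<gamma> Z else 0)) (at 0)"
    if "set cs \<subseteq> set (curves d)" "G = (\<lambda>t. \<Sum>\<gamma>\<leftarrow>cs. if range \<gamma> \<subseteq> wall d then g \<gamma> t else 0)" for cs G
    using that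
  proof (induction cs arbitrary: G)
    case (Cons \<gamma> cs)
    have "((\<lambda>t. if range \<gamma> \<subseteq> wall d then g \<gamma> t else 0) has_vector_derivative (if range \<gamma> \<subseteq> wall d then flux_int \<gamma> Z else 0)) (at 0)"
      using gd[of \<gamma>] Cons.prems by auto
    from has_vector_derivative_add[OF this Cons.IH[OF _ refl]] show ?case using Cons.prems by simp
  qed simp
  from this[OF order_refl, of G]
  have Gd: "(G has_vector_derivative (\<Sum>\<gamma>\<leftarrow>curves d. if range \<gamma> \<subseteq> wall d then flux_int \<gamma> Z else 0)) (at 0)"
    unfolding G_def by simp
  also have "(\<Sum>\<gamma>\<leftarrow>curves d. if range \<gamma> \<subseteq> wall d then flux_int \<gamma> Z else 0) = bint d (wall d) (\<lambda>x n. Z x \<bullet> n)"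
    by (rule bint_flux[symmetric, OF disjI1[OF refl] cZ])
  also have "\<dots> = bint d (wall d) (\<lambda>x n. shape_deriv (\<lambda>t. Y t x) \<bullet> n + (V x \<bullet> n) * divg (Y 0) x)"
  proof (rule bint_cong, unfold on_bdry_def, intro ballI allI impI)
    fix \<gamma> and s :: real assume "\<gamma> s \<in> wall d"
    then have "(0, \<gamma> s) \<in> Q" using wall_N \<epsilon> by auto
    from Yd(4)[OF this]
    show "Z (\<gamma> s) \<bullet> curve_normal \<gamma> s = shape_deriv (\<lambda>t. Y t (\<gamma> s)) \<bullet> curve_normal \<gamma> s
        + (V (\<gamma> s) \<bullet> curve_normal \<gamma> s) * divg (Y 0) (\<gamma> s)"
      by (simp add: Z_def D_def inner_add_left)
  qed
  finally have "(G has_real_derivative bint d (wall d) (\<lambda>x n. shape_deriv (\<lambda>t. Y t x) \<bullet> n + (V x \<bullet> n) * divg (Y 0) x)) (at 0)"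
    by (simp add: has_real_derivative_iff_has_vector_derivative)
  then have "((\<lambda>t. (G t - G 0) / t) \<longlongrightarrow> bint d (wall d) (\<lambda>x n. shape_deriv (\<lambda>t. Y t x) \<bullet> n + (V x \<bullet> n) * divg (Y 0) x)) (at 0)"
    by (simp add: DERIV_def)
  then have "((\<lambda>t. (G t - G 0) / t) \<longlongrightarrow> bint d (wall d) (\<lambda>x n. shape_deriv (\<lambda>t. Y t x) \<bullet> n + (V x \<bullet> n) * divg (Y 0) x)) (at_right 0)"
    by (rule filterlim_at_split[THEN iffD1, THEN conjunct2])
  then show ?thesis
  proof (rule Lim_transform_eventually)
    have "\<forall>\<^sub>F t in at_right 0. \<bar>t\<bar> < \<delta>"
      unfolding eventually_at_right_field using \<delta>(1) by (intro exI[of _ \<delta>]) auto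
    then show "\<forall>\<^sub>F t in at_right 0. (G t - G 0) / t =
      (bint (perturb V t d) (wall (perturb V t d)) (\<lambda>x n. Y t x \<bullet> n) - bint d (wall d) (\<lambda>x n. Y 0 x \<bullet> n)) / t"
      by eventually_elim (simp add: pull pull0 G_def)
  qed
qed

end

context perturbed_boundary begin

lemma on_bdry_pert:
  assumes "on_bdry (perturb V t d) ((\<lambda>x. x + t *\<^sub>R V x) ` S) P" "\<gamma> \<in> set (curves d)" "\<gamma> s \<in> S"
  shows "P (\<gamma> s + t *\<^sub>R V (\<gamma> s)) (curve_normal (\<lambda>s. \<gamma> s + t *\<^sub>R V (\<gamma> s)) s)"
proof -
  have "(\<lambda>s. \<gamma> s + t *\<^sub>R V (\<gamma> s)) \<in> set (curves (perturb V t d))"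
    using assms(2) by (auto simp: curves_pert)
  moreover have "\<gamma> s + t *\<^sub>R V (\<gamma> s) \<in> (\<lambda>x. x + t *\<^sub>R V x) ` S" using assms(3) by auto
  ultimately show ?thesis using assms(1) unfolding on_bdry_def by meson
qed

text \<open>A boundary condition that is transported with the wall makes the material derivative vanish.\<close>

lemma wall_zero_derivative:
  assumes Y: "Ck_on (Suc 0) (\<lambda>(t, x). Y t x) Q" and x: "x \<in> wall d"
    and z: "\<And>t. 0 \<le> t \<Longrightarrow> t < \<epsilon> \<Longrightarrow> Y t (x + t *\<^sub>R V x) = c"
  shows "shape_deriv (\<lambda>t. Y t x) = - frechet_derivative (Y 0) (at x) (V x)"
proof -
  have in0: "(0, x) \<in> Q" using x wall_N \<epsilon> by auto
  have "((\<lambda>t. Y t (x + t *\<^sub>R V x)) has_vector_derivative frechet_derivative (\<lambda>(t, x). Y t x) (at (0, x)) (1, V x)) (at 0)"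
    using moving_point[OF Y open_Q, of 0 x "V x" UNIV] in0 by simp
  from right_constant_derivative[OF this \<epsilon> z]
  have "frechet_derivative (\<lambda>(t, x). Y t x) (at (0, x)) (1, V x) = 0" by blast
  then show ?thesis
    unfolding DY_split[OF Y open_Q in0, of "V x"] shape_deriv_eq[OF Y open_Q in0]
      frechet_derivative_at[OF slice_x[OF Y open_Q in0], symmetric]
    by (simp add: eq_neg_iff_add_eq_0)
qed

text \<open>The unit normal of the perturbed wall depends on \<open>t\<close>. Differentiating the Neumann condition
  along the curve, the contribution of the moving normal is \<open>q \<bullet> rot (V \<circ> \<gamma>)'\<close>; integration by
  parts turns it into the tangential divergence of \<open>m q\<close>. The adiabatic part is only a Borel set,
  so the integration runs over the whole curve: on the isothermal part \<open>m\<close> vanishes, hence so does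
  its derivative along the curve, except at countably many parameters.\<close>

lemma adiabatic_by_parts:
  assumes q: "Ck_on (Suc 0) (\<lambda>(t, x). q t x) Q"
    and m: "Ck_on (Suc 0) m M" "open M" "wall d \<subseteq> M"
    and Vn: "on_bdry d (wall d) (\<lambda>x n. V x = (V x \<bullet> n) *\<^sub>R n)"
    and m0: "\<And>x. x \<in> iso d \<Longrightarrow> m x = 0"
    and qn: "\<And>t. 0 \<le> t \<Longrightarrow> t < \<epsilon> \<Longrightarrow> on_bdry (perturb V t d) (adia (perturb V t d)) (\<lambda>x n. q t x \<bullet> n = 0)"
  shows "bint d (adia d) (\<lambda>x n. m x * (shape_deriv (\<lambda>t. q t x) \<bullet> n)
       + (V x \<bullet> n) * (m x * ((Dm (q 0) x *v n) \<bullet> n) + div_tan (\<lambda>y. m y *\<^sub>R q 0 y) x n)) = 0"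
proof -
  define f where "f x n = m x * (shape_deriv (\<lambda>t. q t x) \<bullet> n)
       + (V x \<bullet> n) * (m x * ((Dm (q 0) x *v n) \<bullet> n) + div_tan (\<lambda>y. m y *\<^sub>R q 0 y) x n)" for x n
  have "(LINT s:{0..1}|lborel. indicat_real (adia d) (\<gamma> s) * f (\<gamma> s) (curve_normal \<gamma> s) * norm (vector_derivative \<gamma> (at s))) = 0"
    if \<gamma>: "\<gamma> \<in> set (curves d)" for \<gamma>
  proof (cases "range \<gamma> \<subseteq> wall d")
    case False
    then have "\<gamma> s \<notin> adia d" for s
      using wall_or_far[OF \<gamma>] wall_far by (auto simp: wall_def)
    then show ?thesis by simp
  next
    case True
    let ?\<gamma>' = "\<lambda>s. vector_derivative \<gamma> (at s)"
    define \<nu> where "\<nu> s = V (\<gamma> s) \<bullet> curve_normal \<gamma> s" for s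
    define Dq where "Dq s = frechet_derivative (\<lambda>(t, x). q t x) (at (0, \<gamma> s))" for s
    define Dmm where "Dmm s = frechet_derivative m (at (\<gamma> s))" for s
    have wall: "\<gamma> s \<in> wall d" for s using True by blast
    have in0: "(0, \<gamma> s) \<in> Q" for s using wall[of s] wall_N \<epsilon> by auto
    have Vw: "V (\<gamma> s) = \<nu> s *\<^sub>R curve_normal \<gamma> s" for s
      using Vn \<gamma> wall unfolding on_bdry_def \<nu>_def by blast
    have dq: "(q 0 has_derivative (\<lambda>h. Dq s (0, h))) (at (\<gamma> s))" for s
      unfolding Dq_def by (rule slice_x[OF q open_Q in0])
    have dm: "(m has_derivative Dmm s) (at (\<gamma> s))" for s
      unfolding Dmm_def using Ck_on_has_derivative[OF m(1)] wall[of s] m(3) by blast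
    have dW: "((\<lambda>y. m y *\<^sub>R q 0 y) has_derivative (\<lambda>h. m (\<gamma> s) *\<^sub>R Dq s (0, h) + Dmm s h *\<^sub>R q 0 (\<gamma> s))) (at (\<gamma> s))" for s
      by (rule has_derivative_scaleR[OF dm dq])
    have linq: "linear (\<lambda>h. Dq s (0, h))" for s using has_derivative_linear[OF dq] .
    have linm: "linear (Dmm s)" for s using has_derivative_linear[OF dm] .
    define \<theta> where "\<theta> s = (m (\<gamma> s) *\<^sub>R q 0 (\<gamma> s)) \<bullet> rot (V (\<gamma> s))" for s
    define \<theta>' where "\<theta>' s = (m (\<gamma> s) *\<^sub>R Dq s (0, ?\<gamma>' s) + Dmm s (?\<gamma>' s) *\<^sub>R q 0 (\<gamma> s)) \<bullet> rot (V (\<gamma> s))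
        + (m (\<gamma> s) *\<^sub>R q 0 (\<gamma> s)) \<bullet> rot (w' \<gamma> s)" for s
    have d\<theta>: "(\<theta> has_vector_derivative \<theta>' s) (at s)" for s
    proof -
      have 1: "((\<lambda>s. m (\<gamma> s) *\<^sub>R q 0 (\<gamma> s)) has_vector_derivative
          m (\<gamma> s) *\<^sub>R Dq s (0, ?\<gamma>' s) + Dmm s (?\<gamma>' s) *\<^sub>R q 0 (\<gamma> s)) (at s)"
        using has_derivative_compose[OF curve_vd[OF \<gamma>(1), of s, unfolded has_vector_derivative_def] dW[of s]]
        unfolding has_vector_derivative_def
        by (simp add: linear_cmul[OF linq] linear_cmul[OF linm] scaleR_add_right mult.commute)
      have 2: "((\<lambda>s. rot (V (\<gamma> s))) has_vector_derivative rot (w' \<gamma> s)) (at s)"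
        by (rule bounded_linear.has_vector_derivative[OF bounded_linear_rot w_deriv[OF \<gamma>(1)]])
      show ?thesis
        unfolding \<theta>'_def \<theta>_def
        by (rule has_vector_derivative_eq_rhs[OF bounded_bilinear.has_vector_derivative[OF bounded_bilinear_inner 1 2]])
          (rule add.commute)
    qed
    have cm: "continuous_on A (\<lambda>s. m (\<gamma> s))" for A
      by (rule continuous_on_compose2[OF Ck_on_imp_continuous_on[OF m(1)] curve_cont[OF \<gamma>]]) (use wall m in auto)
    have c0: "continuous_on A (\<lambda>s. (0::real, \<gamma> s))" "(\<lambda>s. (0::real, \<gamma> s)) ` A \<subseteq> Q" for A
      using in0 by (auto intro!: continuous_intros curve_cont[OF \<gamma>])
    have cq: "continuous_on A (\<lambda>s. q 0 (\<gamma> s))" for A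
      using continuous_on_compose2[OF Ck_on_imp_continuous_on[OF q] c0] by simp
    have cDq: "continuous_on A (\<lambda>s. Dq s (0, ?\<gamma>' s))" for A
      unfolding Dq_def by (rule Ck_on_continuous_derivative[OF q c0]) (intro continuous_intros curve_vd_cont[OF \<gamma>])
    have cDm: "continuous_on A (\<lambda>s. Dmm s (?\<gamma>' s))" for A
      unfolding Dmm_def by (rule Ck_on_continuous_derivative[OF m(1) curve_cont[OF \<gamma>] _ curve_vd_cont[OF \<gamma>]])
        (use wall m in auto)
    have c\<theta>': "continuous_on A \<theta>'" for A
      unfolding \<theta>'_def
      by (intro continuous_intros cm cq cDq cDm bounded_linear.continuous_on[OF bounded_linear_rot] w'_cont[OF \<gamma>]
          continuous_on_compose2[OF V_continuous[of UNIV] curve_cont[OF \<gamma>]]) auto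
    \<comment> \<open>differentiate \<open>q \<bullet> rot \<gamma>' = 0\<close> along the moving point; the two remaining terms
      combine by the trace identity, since \<open>V\<close> is normal\<close>
    have key: "f (\<gamma> s) (curve_normal \<gamma> s) * norm (?\<gamma>' s) = - \<theta>' s" if ad: "\<gamma> s \<in> adia d" for s
    proof -
      have "Dq s (1, V (\<gamma> s)) \<bullet> rot (?\<gamma>' s) + q 0 (\<gamma> s) \<bullet> rot (w' \<gamma> s) = 0"
      proof (rule right_constant_derivative[OF _ \<epsilon>])
        have 1: "((\<lambda>t. q t (\<gamma> s + t *\<^sub>R V (\<gamma> s))) has_vector_derivative Dq s (1, V (\<gamma> s))) (at 0)"
          unfolding Dq_def using moving_point[OF q open_Q, of 0 "\<gamma> s" "V (\<gamma> s)" UNIV] in0[of s] by simp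
        have 2: "((\<lambda>t. rot (?\<gamma>' s + t *\<^sub>R w' \<gamma> s)) has_vector_derivative rot (w' \<gamma> s)) (at 0)"
          by (rule bounded_linear.has_vector_derivative[OF bounded_linear_rot]) (auto intro!: derivative_eq_intros)
        show "((\<lambda>t. q t (\<gamma> s + t *\<^sub>R V (\<gamma> s)) \<bullet> rot (?\<gamma>' s + t *\<^sub>R w' \<gamma> s)) has_vector_derivative
            Dq s (1, V (\<gamma> s)) \<bullet> rot (?\<gamma>' s) + q 0 (\<gamma> s) \<bullet> rot (w' \<gamma> s)) (at 0)"
          by (rule has_vector_derivative_eq_rhs[OF bounded_bilinear.has_vector_derivative[OF bounded_bilinear_inner 1 2]])
            simp
        fix t assume t: "0 \<le> t" "t < \<epsilon>"
        have "q t (\<gamma> s + t *\<^sub>R V (\<gamma> s)) \<bullet> curve_normal (\<lambda>s. \<gamma> s + t *\<^sub>R V (\<gamma> s)) s = 0"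
          by (rule on_bdry_pert[OF qn[OF t, unfolded adia_pert] \<gamma> ad])
        then show "q t (\<gamma> s + t *\<^sub>R V (\<gamma> s)) \<bullet> rot (?\<gamma>' s + t *\<^sub>R w' \<gamma> s) = 0"
          using norm_curve_normal[of "\<lambda>s. \<gamma> s + t *\<^sub>R V (\<gamma> s)" s, symmetric] by (simp add: pert_vd[OF \<gamma>])
      qed
      moreover have "Dq s (1, V (\<gamma> s)) = Dq s (1, 0) + Dq s (0, V (\<gamma> s))"
        unfolding Dq_def by (rule DY_split[OF q open_Q in0])
      ultimately have bc: "Dq s (1, 0) \<bullet> rot (?\<gamma>' s) + Dq s (0, V (\<gamma> s)) \<bullet> rot (?\<gamma>' s) = - (q 0 (\<gamma> s) \<bullet> rot (w' \<gamma> s))"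
        by (simp add: inner_add_left)
      let ?n = "curve_normal \<gamma> s" and ?l = "norm (?\<gamma>' s)"
      have ln: "?l *\<^sub>R ?n = rot (?\<gamma>' s)" by (rule norm_curve_normal)
      have rn: "rot (V (\<gamma> s)) = \<nu> s *\<^sub>R rot ?n" by (subst Vw) (rule rot_scaleR)
      have sd: "shape_deriv (\<lambda>t. q t (\<gamma> s)) = Dq s (1, 0)"
        unfolding Dq_def by (rule shape_deriv_eq[OF q open_Q in0])
      have nn: "?n \<bullet> rot (?\<gamma>' s) = ?l"
        using curve_vd_nz[OF \<gamma>, of s] by (simp add: curve_normal_eq inner_rot_rot dot_square_norm power2_eq_square norm_rot)
      let ?DW = "\<lambda>h. m (\<gamma> s) *\<^sub>R Dq s (0, h) + Dmm s h *\<^sub>R q 0 (\<gamma> s)"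
      have "div_tan (\<lambda>y. m y *\<^sub>R q 0 y) (\<gamma> s) ?n * ?l = - (?DW (?\<gamma>' s) \<bullet> rot ?n)"
        using trace_identity[OF dW[of s], of ?n "?\<gamma>' s"] unfolding nn
        by (simp add: div_tan_def Dm_mult[OF dW] ln[symmetric] algebra_simps)
      then have dt: "\<nu> s * (div_tan (\<lambda>y. m y *\<^sub>R q 0 y) (\<gamma> s) ?n * ?l) = - (?DW (?\<gamma>' s) \<bullet> rot (V (\<gamma> s)))"
        by (simp add: rn)
      have "Dq s (0, V (\<gamma> s)) \<bullet> rot (?\<gamma>' s) = \<nu> s * ((Dm (q 0) (\<gamma> s) *v ?n) \<bullet> ?n) * ?l"
        unfolding Dm_mult[OF dq] by (subst Vw) (simp add: linear_cmul[OF linq] ln[symmetric])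
      moreover have "Dq s (1, 0) \<bullet> rot (?\<gamma>' s) = (Dq s (1, 0) \<bullet> ?n) * ?l"
        by (simp add: ln[symmetric])
      ultimately have "f (\<gamma> s) ?n * ?l = m (\<gamma> s) * (Dq s (1, 0) \<bullet> rot (?\<gamma>' s) + Dq s (0, V (\<gamma> s)) \<bullet> rot (?\<gamma>' s))
          + \<nu> s * (div_tan (\<lambda>y. m y *\<^sub>R q 0 y) (\<gamma> s) ?n * ?l)"
        unfolding f_def sd \<nu>_def[symmetric] by (simp add: algebra_simps)
      then show ?thesis unfolding bc dt \<theta>'_def by simp
    qed
    let ?A = "\<lambda>S s. indicat_real S (\<gamma> s) * \<theta>' s"
    have meas: "\<gamma> \<in> borel_measurable borel" using curve_cont[OF \<gamma>, of UNIV] by (rule borel_measurable_continuous_onI)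
    have intA: "set_integrable lborel {0..1} (?A S)" if S: "S \<in> sets borel" for S
    proof -
      from measurable_sets_borel[OF meas S] have S': "\<gamma> -` S \<in> sets borel" by simp
      have 1: "set_integrable lborel {0..1} \<theta>'"
        by (intro borel_integrable_compact[folded set_integrable_def] c\<theta>') auto
      then have "set_integrable lborel ({0..1} \<inter> \<gamma> -` S) \<theta>'"
        using S' by (intro set_integrable_subset[OF 1]) auto
      then show ?thesis
        unfolding set_integrable_def
        by (rule Bochner_Integration.integrable_cong[THEN iffD1, rotated -1]) (auto simp: indicator_def)
    qed
    have iso0: "(LINT s:{0..1}|lborel. ?A (iso d) s) = 0"
      unfolding set_lebesgue_integral_def
    proof (rule integral_eq_zero_AE)
      have "countable {s \<in> \<gamma> -` iso d. \<theta>' s \<noteq> 0}"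
      proof (rule countable_nonzero_derivative)
        show "(\<theta> has_real_derivative \<theta>' s) (at s)" for s
          using d\<theta> by (simp add: has_real_derivative_iff_has_vector_derivative)
        show "\<theta> s = 0" if "s \<in> \<gamma> -` iso d" for s using m0 that by (simp add: \<theta>_def)
      qed
      then have "{s \<in> \<gamma> -` iso d. \<theta>' s \<noteq> 0} \<in> null_sets lborel" by (rule countable_imp_null_set_lborel)
      then show "AE s in lborel. indicat_real {0..1} s *\<^sub>R ?A (iso d) s = 0"
        by (rule AE_I') (auto simp: indicator_def)
    qed
    have "(LINT s:{0..1}|lborel. ?A (adia d) s) = (LINT s:{0..1}|lborel. ?A (iso d) s + ?A (adia d) s)"
      using set_integral_add(2)[OF intA[OF iso_borel] intA[OF adia_borel]] iso0 by simp
    also have "\<dots> = (LINT s:{0..1}|lborel. \<theta>' s)"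
    proof (rule set_lebesgue_integral_cong)
      show "\<forall>s. s \<in> {0..1} \<longrightarrow> ?A (iso d) s + ?A (adia d) s = \<theta>' s"
        using wall iso_adia by (auto simp: wall_def indicator_def)
    qed simp
    also have "\<dots> = integral {0..1} \<theta>'"
      by (intro set_borel_integral_eq_integral(2) borel_integrable_compact[folded set_integrable_def] c\<theta>') auto
    also have "\<dots> = \<theta> 1 - \<theta> 0"
      by (intro integral_unique fundamental_theorem_of_calculus) (use d\<theta> in \<open>auto intro: has_vector_derivative_at_within\<close>)
    also have "\<dots> = 0" using curve_periodic[OF \<gamma>, of 0] by (simp add: \<theta>_def)
    finally have 0: "(LINT s:{0..1}|lborel. ?A (adia d) s) = 0" .
    have "indicat_real (adia d) (\<gamma> s) * f (\<gamma> s) (curve_normal \<gamma> s) * norm (?\<gamma>' s) = - 1 * ?A (adia d) s" for s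
      using key[of s] by (simp add: indicator_def)
    then show ?thesis using 0 by (simp only: set_integral_mult_right mult_zero_right)
  qed
  then have "(\<Sum>\<gamma>\<leftarrow>curves d. LINT s:{0..1}|lborel. indicat_real (adia d) (\<gamma> s) * f (\<gamma> s) (curve_normal \<gamma> s) * norm (vector_derivative \<gamma> (at s))) = (\<Sum>\<gamma>\<leftarrow>curves d. 0)"
    by (intro arg_cong[of _ _ sum_list] map_cong refl)
  then show ?thesis unfolding f_def bint_def by simp
qed

end

section \<open>Fluxes of a perfect gas\<close>

abbreviation Upos :: "(real^4) set" where "Upos \<equiv> {U. 0 < U $ 1}"

lemma open_Upos: "open Upos"
  by (intro open_Collect_less continuous_intros)

lemma Ck_on_vector2:
  fixes a b :: "'a::euclidean_space \<Rightarrow> real"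
  assumes "open S" "Ck_on k a S" "Ck_on k b S"
  shows "Ck_on k (\<lambda>x. vector [a x, b x] :: real^2) S"
proof (rule Ck_on_vec[OF assms(1)])
  fix i :: 2
  show "Ck_on k (\<lambda>x. (vector [a x, b x] :: real^2) $ i) S"
    using exhaust_2[of i] assms by auto
qed

lemma Ck_on_vector4:
  fixes a b c e :: "'a::euclidean_space \<Rightarrow> real"
  assumes "open S" "Ck_on k a S" "Ck_on k b S" "Ck_on k c S" "Ck_on k e S"
  shows "Ck_on k (\<lambda>x. vector [a x, b x, c x, e x] :: real^4) S"
proof (rule Ck_on_vec[OF assms(1)])
  fix i :: 4
  show "Ck_on k (\<lambda>x. (vector [a x, b x, c x, e x] :: real^4) $ i) S"
    using exhaust_4[of i] assms by (auto simp: vector_4)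
qed

lemma Ck_on_comp: "open S \<Longrightarrow> Ck_on k (\<lambda>x::'a::euclidean_space^'n. x $ i) S"
  by (rule Ck_on_bounded_linear[OF bounded_linear_vec_nth])

lemma Ck_vel: "Ck_on j vel Upos"
  unfolding vel_def[abs_def]
  by (intro Ck_on_vector2 Ck_on_divide open_Upos Ck_on_comp) auto

lemma Ck_energy: "Ck_on j energy Upos"
  unfolding energy_def[abs_def] by (intro Ck_on_divide open_Upos Ck_on_comp) auto

lemma Ck_rho: "Ck_on j rho Upos"
  unfolding rho_def[abs_def] by (intro Ck_on_comp open_Upos)

lemma Ck_temp: "Ck_on j (temp g) Upos"
proof -
  have "Ck_on j (\<lambda>U. (energy U - (vel U \<bullet> vel U) / 2) * (1 / cv g)) Upos"
    unfolding divide_inverse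
    by (intro Ck_on_mult Ck_on_diff Ck_on_inner Ck_on_const open_Upos Ck_energy Ck_vel)
  then show ?thesis by (simp add: temp_def[abs_def] power2_norm_eq_inner)
qed

lemma Ck_pres: "Ck_on j (pres g) Upos"
  unfolding pres_def[abs_def] by (intro Ck_on_mult Ck_rho Ck_temp Ck_on_const open_Upos)

lemma Ck_enth: "Ck_on j (enth g) Upos"
  unfolding enth_def[abs_def]
  by (intro Ck_on_add Ck_on_divide Ck_energy Ck_pres Ck_rho open_Upos) (simp add: rho_def)

lemma Ck_fc: "Ck_on j (fc g k) Upos"
  unfolding fc_def[abs_def]
  by (intro Ck_on_vector4 Ck_on_add Ck_on_mult Ck_rho Ck_on_nth Ck_vel Ck_enth open_Upos)
    (cases "k = 1"; cases "k = 2"; simp add: Ck_pres Ck_on_const open_Upos)+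

lemma stress_linear: "linear (stress \<mu>)"
  by (rule linearI)
    (simp_all add: stress_def transpose_def trace_def vec_eq_iff sum.distrib sum_distrib_left algebra_simps mat_def)

lemma stress_nth: "stress \<mu> A $ i $ j = \<mu> * (A $ i $ j + A $ j $ i - (if i = j then 2/3 * trace A else 0))"
  by (simp add: stress_def transpose_def mat_def algebra_simps)

lemma stress_sym: "stress \<mu> A $ i $ j = stress \<mu> A $ j $ i"
  by (simp add: stress_nth algebra_simps)

lemma tau_linear: "linear (tau g U)"
proof -
  have "linear (\<lambda>A::real^2^4. Dm vel U ** A)"
    by (rule linearI) (simp_all add: matrix_matrix_mult_def vec_eq_iff sum.distrib sum_distrib_left algebra_simps)
  from linear_compose[OF this stress_linear] show ?thesis by (simp add: tau_def[abs_def] o_def)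
qed

lemma temp_derivative: "U \<in> Upos \<Longrightarrow> (temp g has_derivative frechet_derivative (temp g) (at U)) (at U)"
  using Ck_on_has_derivative[OF Ck_temp] by blast

lemma vel_derivative: "U \<in> Upos \<Longrightarrow> (vel has_derivative frechet_derivative vel (at U)) (at U)"
  using Ck_on_has_derivative[OF Ck_vel] by blast

lemma temp_grad_linear:
  assumes "U \<in> Upos" shows "linear (temp_grad g U)"
proof -
  have lin: "linear (frechet_derivative (temp g) (at U))"
    using temp_derivative[OF assms] has_derivative_linear by blast
  have col: "column l (A + B) = column l A + column l B" "column l (c *\<^sub>R A) = c *\<^sub>R column l A"
    for l :: 2 and A B :: "real^2^4" and c
    by (simp_all add: column_def vec_eq_iff)
  show ?thesis
    by (rule linearI) (simp_all add: temp_grad_def vec_eq_iff col linear_add[OF lin] linear_cmul[OF lin])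
qed

lemma fv_linear:
  assumes "U \<in> Upos" shows "linear (fv g k U)"
proof -
  note t = linear_add[OF tau_linear[of g U]] linear_cmul[OF tau_linear[of g U]]
  note q = linear_add[OF temp_grad_linear[OF assms, of g]] linear_cmul[OF temp_grad_linear[OF assms, of g]]
  have eq4: "(x::real^4) = y \<longleftrightarrow> x $ 1 = y $ 1 \<and> x $ 2 = y $ 2 \<and> x $ 3 = y $ 3 \<and> x $ 4 = y $ 4" for x y
    by (simp add: vec_eq_iff forall_4)
  show ?thesis
    by (rule linearI) (simp_all add: fv_def eq4 vector_4 t q sum_2 algebra_simps)
qed

text \<open>Matrix units. The viscous flux is linear in the gradient, so it is determined by its values on
  them, which are smooth functions of the state alone. This yields regularity and derivatives in
  both arguments without an explicit formula.\<close>

definition E_mat :: "4 \<Rightarrow> 2 \<Rightarrow> real^2^4" where "E_mat a b = (\<chi> i j. if i = a \<and> j = b then 1 else 0)"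

lemma matrix_decomp: "(A :: real^2^4) = (\<Sum>a\<in>UNIV. \<Sum>b\<in>UNIV. A $ a $ b *\<^sub>R E_mat a b)"
proof -
  have "(\<Sum>a\<in>UNIV. \<Sum>b\<in>UNIV. A $ a $ b *\<^sub>R E_mat a b) $ i $ j = A $ i $ j" for i j
  proof -
    have "(\<Sum>a\<in>UNIV. \<Sum>b\<in>UNIV. A $ a $ b *\<^sub>R E_mat a b) $ i $ j
        = (\<Sum>a\<in>UNIV. \<Sum>b\<in>UNIV. if i = a then if j = b then A $ a $ b else 0 else 0)"
      unfolding sum_component by (intro sum.cong refl) (simp add: E_mat_def)
    also have "\<dots> = (\<Sum>a\<in>UNIV. if i = a then (\<Sum>b\<in>UNIV. if j = b then A $ a $ b else 0) else 0)"
      by (intro sum.cong refl) simp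
    finally show ?thesis by simp
  qed
  then show ?thesis by (simp add: vec_eq_iff)
qed

lemma fv_decomp:
  assumes "U \<in> Upos" shows "fv g k U A = (\<Sum>a\<in>UNIV. \<Sum>b\<in>UNIV. A $ a $ b *\<^sub>R fv g k U (E_mat a b))"
  by (subst matrix_decomp[of A]) (simp add: linear_sum[OF fv_linear[OF assms]] linear_cmul[OF fv_linear[OF assms]])

lemma Ck_tau: "Ck_on j (\<lambda>U. tau g U A) Upos"
proof -
  have "Ck_on j (\<lambda>U. Dm vel U $ i $ l) Upos" for i l
    unfolding jacobian_def matrix_def
    by (simp, intro Ck_on_nth Ck_on_derivative Ck_vel open_Upos)
  then have "Ck_on j (\<lambda>U. Dm vel U ** A) Upos"
    by (intro Ck_on_vec open_Upos) (simp add: matrix_matrix_mult_def, intro Ck_on_sum Ck_on_mult Ck_on_const open_Upos)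
  from Ck_on_linear[OF _ open_Upos this] show ?thesis
    unfolding tau_def[abs_def] using stress_linear linear_conv_bounded_linear by blast
qed

lemma Ck_temp_grad: "Ck_on j (\<lambda>U. temp_grad g U A) Upos"
  unfolding temp_grad_def
  by (intro Ck_on_vec open_Upos) (simp, intro Ck_on_derivative Ck_temp)

lemma Ck_fv: "Ck_on j (\<lambda>U. fv g k U A) Upos"
  unfolding fv_def[abs_def]
  by (intro Ck_on_vector4 Ck_on_add Ck_on_sum Ck_on_mult Ck_on_nth Ck_tau Ck_temp_grad Ck_vel Ck_on_const open_Upos)

lemma Dm_nth: "Dm f x $ i $ j = frechet_derivative f (at x) (axis j 1) $ i"
  by (simp add: jacobian_def matrix_def)

lemma Dm_nth_pd: "Dm u x $ i $ j = pd j u x $ i"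
  by (simp add: Dm_nth pd_def)

lemma column_Dm: "column j (Dm u x) = pd j u x"
  by (simp add: column_def vec_eq_iff Dm_nth_pd)

lemma Dm_chain:
  assumes "(u has_derivative D) (at x)" "u x \<in> Upos"
  shows "Dm vel (u x) ** Dm u x = Dm (\<lambda>y. vel (u y)) x"
proof -
  note c = has_derivative_compose[OF assms(1) vel_derivative[OF assms(2)]]
  have "(Dm vel (u x) ** Dm u x) *v h = Dm (\<lambda>y. vel (u y)) x *v h" for h
    unfolding matrix_vector_mul_assoc[symmetric] Dm_mult[OF assms(1)] Dm_mult[OF c]
      Dm_mult[OF vel_derivative[OF assms(2)]] ..
  then show ?thesis by (simp add: matrix_eq)
qed

lemma tau_along:
  assumes "(u has_derivative D) (at x)" "u x \<in> Upos"
  shows "tau g (u x) (Dm u x) = stress (visc g) (Dm (\<lambda>y. vel (u y)) x)"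
  by (simp add: tau_def Dm_chain[OF assms])

lemma temp_grad_along:
  assumes "(u has_derivative D) (at x)" "u x \<in> Upos"
  shows "temp_grad g (u x) (Dm u x) = grad (\<lambda>y. temp g (u y)) x"
proof -
  note c = has_derivative_compose[OF assms(1) temp_derivative[OF assms(2), of g]]
  show ?thesis
    by (simp add: temp_grad_def grad_def column_Dm pd_def frechet_derivative_at[OF c, symmetric]
        frechet_derivative_at[OF assms(1), symmetric])
qed

text \<open>Contracting the blocks \<open>G\<^sub>k\<^sub>l\<close> with a normal \<open>n\<close> amounts to evaluating the viscous flux at the
  rank-one gradient \<open>h \<otimes> n\<close>.\<close>

definition outer :: "real^4 \<Rightarrow> real^2 \<Rightarrow> real^2^4" where "outer h n = (\<chi> i j. h $ i * n $ j)"

lemma fv_derivative: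
  assumes "U \<in> Upos" shows "(fv g k U has_derivative fv g k U) (at A)"
  using fv_linear[OF assms] linear_imp_has_derivative by blast

lemma visc_G_mult:
  assumes "u x \<in> Upos" shows "visc_G g u k l x *v h = fv g k (u x) (outer h (axis l 1))"
proof -
  have eq: "(\<chi> i j. if j = l then h $ i else 0) = outer h (axis l 1)" for h :: "real^4"
    by (simp add: outer_def axis_def vec_eq_iff)
  have fd: "frechet_derivative (fv g k (u x)) (at (Dm u x)) = fv g k (u x)"
    using frechet_derivative_at[OF fv_derivative[OF assms]] by metis
  have "linear (\<lambda>h. outer h (axis l 1))"
    by (rule linearI) (simp_all add: outer_def vec_eq_iff algebra_simps)
  from linear_compose[OF this fv_linear[OF assms, of g k]]
  have "linear (\<lambda>h. fv g k (u x) (outer h (axis l 1)))" by (simp add: o_def)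
  then show ?thesis unfolding visc_G_def fd eq by simp
qed

lemma outer_sum: "(\<Sum>l\<in>UNIV. n $ l *\<^sub>R outer h (axis l 1)) = outer h n"
  by (simp add: outer_def vec_eq_iff sum_2 axis_def forall_2 mult.commute)

lemma outer_pd_sum: "(\<Sum>l\<in>UNIV. outer (pd l w x) (axis l 1)) = Dm w x"
  by (simp add: outer_def vec_eq_iff sum_2 axis_def forall_2 Dm_nth_pd)

lemma visc_G_normal:
  assumes "u x \<in> Upos"
  shows "(\<Sum>l\<in>UNIV. n $ l *\<^sub>R (visc_G g u k l x *v h)) = fv g k (u x) (outer h n)"
  unfolding visc_G_mult[of u x, OF assms] outer_sum[of n h, symmetric]
  by (simp only: linear_sum[OF fv_linear[OF assms]] linear_cmul[OF fv_linear[OF assms]])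

lemma visc_G_grad:
  assumes "u x \<in> Upos"
  shows "(\<Sum>l\<in>UNIV. visc_G g u k l x *v pd l w x) = fv g k (u x) (Dm w x)"
  unfolding visc_G_mult[of u x, OF assms] outer_pd_sum[of w x, symmetric]
  by (simp only: linear_sum[OF fv_linear[OF assms]])

lemma inner_vector_matrix: "a \<bullet> (b v* M) = (M *v a) \<bullet> b"
  for M :: "real^'n^'m"
  by (metis dot_lmul_matrix inner_commute)

lemma inner_visc_GT_grad:
  assumes "u x \<in> Upos"
  shows "h \<bullet> (visc_GT_grad g u z x *v n) = (\<Sum>k\<in>UNIV. fv g k (u x) (outer h n) \<bullet> pd k z x)"
proof -
  have "visc_GT_grad g u z x *v n = (\<Sum>l\<in>UNIV. n $ l *\<^sub>R (\<Sum>k\<in>UNIV. transpose (visc_G g u k l x) *v pd k z x))"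
    by (simp add: visc_GT_grad_def matrix_vector_mult_def vec_eq_iff sum_component mult.commute)
  then have "h \<bullet> (visc_GT_grad g u z x *v n) = (\<Sum>l\<in>UNIV. n $ l * (\<Sum>k\<in>UNIV. (visc_G g u k l x *v h) \<bullet> pd k z x))"
    by (simp add: inner_sum_right inner_vector_matrix)
  also have "\<dots> = (\<Sum>k\<in>UNIV. (\<Sum>l\<in>UNIV. n $ l *\<^sub>R (visc_G g u k l x *v h)) \<bullet> pd k z x)"
    by (simp add: sum_2 inner_add_left algebra_simps)
  finally show ?thesis by (simp add: visc_G_normal[of u x, OF assms])
qed

lemma inner_matrix_2: "(A :: real^2^4) \<bullet> B = (\<Sum>l\<in>UNIV. column l A \<bullet> column l B)"
  by (simp add: inner_vec_def column_def sum_2 sum_4 algebra_simps)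

lemma inner_grad_visc:
  assumes "u x \<in> Upos"
  shows "Dm w x \<bullet> visc_GT_grad g u z x = (\<Sum>k\<in>UNIV. fv g k (u x) (Dm w x) \<bullet> pd k z x)"
proof -
  have col: "column l (visc_GT_grad g u z x) = (\<Sum>k\<in>UNIV. transpose (visc_G g u k l x) *v pd k z x)" for l
    by (simp add: visc_GT_grad_def column_def vec_eq_iff)
  have "Dm w x \<bullet> visc_GT_grad g u z x = (\<Sum>l\<in>UNIV. \<Sum>k\<in>UNIV. (visc_G g u k l x *v pd l w x) \<bullet> pd k z x)"
    unfolding inner_matrix_2 col column_Dm by (simp add: inner_sum_right inner_vector_matrix)
  also have "\<dots> = (\<Sum>k\<in>UNIV. (\<Sum>l\<in>UNIV. visc_G g u k l x *v pd l w x) \<bullet> pd k z x)"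
    by (simp add: sum_2 inner_add_left algebra_simps)
  finally show ?thesis by (simp add: visc_G_grad[of u x, OF assms])
qed

text \<open>On the far field the boundary terms of the adjoint problem add up to the normal component of
  the linearised flux, paired with \<open>z\<close>.\<close>

lemma lin_flux_normal:
  assumes "u x \<in> Upos"
  shows "(lin_flux g u w x *v n) \<bullet> z x = w x \<bullet> n_flux_uT g u z x n - Dm w x \<bullet> n_visc_GT g u z x n"
proof -
  have col: "column l (n_visc_GT g u z x n) = (\<Sum>k\<in>UNIV. n $ k *\<^sub>R (transpose (visc_G g u k l x) *v z x))" for l
    by (simp add: n_visc_GT_def column_def vec_eq_iff)
  have eq: "lin_flux g u w x *v n = (\<Sum>k\<in>UNIV. n $ k *\<^sub>R (flux_u g u k x *v w x - (\<Sum>l\<in>UNIV. visc_G g u k l x *v pd l w x)))"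
    by (simp add: lin_flux_def matrix_vector_mult_def[of "\<chi> i k. _ i k"] vec_eq_iff mult.commute)
  show ?thesis
    unfolding eq inner_matrix_2 col column_Dm
    by (simp add: n_flux_uT_def inner_sum_right inner_vector_matrix sum_2 inner_add_left inner_diff_left algebra_simps)
qed

declare Ck_on.simps(2) [simp del]

section \<open>Linearisation of the flow\<close>

text \<open>By the fundamental theorem \<open>Y t - Y 0\<close> is the time integral of \<open>\<partial>\<^sub>t Y\<close>; differentiate under the
  integral in space, then in time.\<close>

lemma mixed_partials:
  fixes Y :: "real \<Rightarrow> real^2 \<Rightarrow> 'b::euclidean_space"
  assumes Y: "Ck_on (Suc (Suc 0)) (\<lambda>(t, x). Y t x) Q" and Q: "open Q" and in0: "(0, x) \<in> Q"
  shows "shape_deriv (\<lambda>t. pd l (Y t) x) = pd l (\<lambda>y. shape_deriv (\<lambda>t. Y t y)) x"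
proof -
  define D where "D = frechet_derivative (\<lambda>(t, x). Y t x)"
  define e where "e = (axis l 1 :: real^2)"
  obtain r where r: "r > 0" "cball (0, x) r \<subseteq> Q" using Q in0 open_contains_cball by blast
  define \<delta> where "\<delta> = r / 3"
  have \<delta>: "\<delta> > 0" using r by (simp add: \<delta>_def)
  have inQ: "(t, x + s *\<^sub>R e) \<in> Q" if "\<bar>t\<bar> \<le> \<delta>" "\<bar>s\<bar> \<le> \<delta>" for t s
  proof -
    have "norm (t, s *\<^sub>R e) \<le> norm t + norm (s *\<^sub>R e)" by (rule norm_Pair_le)
    also have "\<dots> \<le> r" using that r by (simp add: e_def \<delta>_def)
    finally have "(t, x + s *\<^sub>R e) \<in> cball (0, x) r" by (simp add: dist_norm norm_Pair)
    then show ?thesis using r by blast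
  qed
  have Y1: "Ck_on (Suc 0) (\<lambda>(t, x). Y t x) Q" using Ck_on_SucD[OF Y] .
  define Z where "Z t y = D (at (t, y)) (1, 0)" for t y
  have ZC: "Ck_on (Suc 0) (\<lambda>(t, y). Z t y) Q"
  proof -
    have "(\<lambda>(t, y). Z t y) = (\<lambda>p. D (at p) (1, 0))" by (simp add: fun_eq_iff Z_def)
    then show ?thesis using Ck_on_derivative[OF Y, of "(1, 0)"] unfolding D_def by metis
  qed
  have ft: "((\<lambda>t. Y t y) has_vector_derivative Z t y) (at t)" if "(t, y) \<in> Q" for t y
    unfolding Z_def D_def by (rule slice_t[OF Y1 Q that])
  have fx: "((\<lambda>s. W t (x + s *\<^sub>R e)) has_vector_derivative pd l (W t) (x + s *\<^sub>R e)) (at s within S)"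
    if W: "Ck_on (Suc 0) (\<lambda>(t, x). W t x) Q" and "\<bar>t\<bar> \<le> \<delta>" "\<bar>s\<bar> \<le> \<delta>"
    for W :: "real \<Rightarrow> real^2 \<Rightarrow> 'b" and t s S
  proof -
    have 1: "((\<lambda>s. x + s *\<^sub>R e) has_derivative (\<lambda>h. h *\<^sub>R e)) (at s within S)" by (auto intro!: derivative_eq_intros)
    note sx = slice_x[OF W Q inQ[OF that(2,3)]]
    have lin: "linear (\<lambda>h. frechet_derivative (\<lambda>(t, x). W t x) (at (t, x + s *\<^sub>R e)) (0, h))"
      using has_derivative_linear[OF sx] .
    show ?thesis
      using has_derivative_compose[OF 1 sx] fun_cong[OF frechet_derivative_at[OF sx], of e]
      unfolding has_vector_derivative_def pd_def e_def[symmetric]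
      by (simp add: linear_cmul[OF lin])
  qed
  have ftc: "((\<lambda>\<tau>. Z \<tau> (x + s *\<^sub>R e)) has_integral Y t (x + s *\<^sub>R e) - Y 0 (x + s *\<^sub>R e)) {0..t}"
    if "0 \<le> t" "t \<le> \<delta>" "\<bar>s\<bar> \<le> \<delta>" for t s
    by (rule fundamental_theorem_of_calculus[OF that(1)])
      (use inQ[of _ s] that in \<open>auto intro!: has_vector_derivative_at_within[OF ft]\<close>)
  have cpd: "continuous_on ({-\<delta>..\<delta>} \<times> {0..\<delta>}) (\<lambda>(s, t). pd l (Z t) (x + s *\<^sub>R e))"
  proof -
    have "continuous_on ({-\<delta>..\<delta>} \<times> {0..\<delta>}) (\<lambda>y. (snd y, x + fst y *\<^sub>R e))"
      "(\<lambda>y. (snd y, x + fst y *\<^sub>R e)) ` ({-\<delta>..\<delta>} \<times> {0..\<delta>}) \<subseteq> Q"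
      using inQ by (auto intro!: continuous_intros simp: abs_le_iff)
    from continuous_on_compose2[OF Ck_on_imp_continuous_on[OF Ck_on_pd[OF ZC Q]] this]
    show ?thesis by (simp add: case_prod_beta')
  qed
  have cZ: "continuous_on {0..\<delta>} (\<lambda>t. Z t (x + s *\<^sub>R e))" if "\<bar>s\<bar> \<le> \<delta>" for s
  proof -
    have "continuous_on {0..\<delta>} (\<lambda>t. (t, x + s *\<^sub>R e))" "(\<lambda>t. (t, x + s *\<^sub>R e)) ` {0..\<delta>} \<subseteq> Q"
      using inQ that by (auto intro!: continuous_intros)
    from continuous_on_compose2[OF Ck_on_imp_continuous_on[OF ZC] this] show ?thesis by simp
  qed
  have main: "pd l (Y t) x - pd l (Y 0) x = integral {0..t} (\<lambda>\<tau>. pd l (Z \<tau>) x)" if t: "0 \<le> t" "t \<le> \<delta>" for t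
  proof -
    have "((\<lambda>s. integral (cbox 0 t) (\<lambda>\<tau>. Z \<tau> (x + s *\<^sub>R e))) has_vector_derivative
        integral (cbox 0 t) (\<lambda>\<tau>. pd l (Z \<tau>) (x + 0 *\<^sub>R e))) (at 0 within {-\<delta>..\<delta>})"
    proof (rule leibniz_rule_vector_derivative)
      fix s \<tau> assume "s \<in> {-\<delta>..\<delta>}" "\<tau> \<in> cbox 0 t"
      then show "((\<lambda>s. Z \<tau> (x + s *\<^sub>R e)) has_vector_derivative pd l (Z \<tau>) (x + s *\<^sub>R e)) (at s within {-\<delta>..\<delta>})"
        using t by (intro fx ZC) auto
    next
      fix s assume "s \<in> {-\<delta>..\<delta>}"
      then have "continuous_on {0..t} (\<lambda>\<tau>. Z \<tau> (x + s *\<^sub>R e))"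
        using t by (intro continuous_on_subset[OF cZ]) auto
      then show "(\<lambda>\<tau>. Z \<tau> (x + s *\<^sub>R e)) integrable_on cbox 0 t" by (simp add: integrable_continuous_real)
    next
      show "continuous_on ({-\<delta>..\<delta>} \<times> cbox 0 t) (\<lambda>(s, \<tau>). pd l (Z \<tau>) (x + s *\<^sub>R e))"
        by (rule continuous_on_subset[OF cpd]) (use t in auto)
    qed (use \<delta> in auto)
    then have 1: "((\<lambda>s. integral {0..t} (\<lambda>\<tau>. Z \<tau> (x + s *\<^sub>R e))) has_vector_derivative
        integral {0..t} (\<lambda>\<tau>. pd l (Z \<tau>) x)) (at 0 within {-\<delta>..\<delta>})" by simp
    have 2: "((\<lambda>s. Y t (x + s *\<^sub>R e) - Y 0 (x + s *\<^sub>R e)) has_vector_derivative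
        integral {0..t} (\<lambda>\<tau>. pd l (Z \<tau>) x)) (at 0 within {-\<delta>..\<delta>})"
      by (rule has_vector_derivative_transform[OF _ _ 1]) (use \<delta> t ftc in \<open>auto simp: abs_le_iff intro!: integral_unique[symmetric]\<close>)
    have 3: "((\<lambda>s. Y t (x + s *\<^sub>R e) - Y 0 (x + s *\<^sub>R e)) has_vector_derivative
        pd l (Y t) x - pd l (Y 0) x) (at 0 within {-\<delta>..\<delta>})"
      using has_vector_derivative_diff[OF fx[OF Y1, of t 0] fx[OF Y1, of 0 0]] t \<delta> by simp
    have "at (0::real) within {-\<delta>..\<delta>} \<noteq> bot" using \<delta> by (simp add: trivial_limit_within)
    from vector_derivative_unique_within[OF this 3 2] show ?thesis .
  qed
  have c0: "continuous_on {0..\<delta>} (\<lambda>\<tau>. pd l (Z \<tau>) x)"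
  proof -
    have "continuous_on {0..\<delta>} (\<lambda>\<tau>. (0::real, \<tau>))" "(\<lambda>\<tau>. (0::real, \<tau>)) ` {0..\<delta>} \<subseteq> {-\<delta>..\<delta>} \<times> {0..\<delta>}"
      using \<delta> by (auto intro!: continuous_intros)
    from continuous_on_compose2[OF cpd this] show ?thesis by simp
  qed
  have "((\<lambda>t. integral {0..t} (\<lambda>\<tau>. pd l (Z \<tau>) x)) has_vector_derivative pd l (Z 0) x) (at 0 within {0..\<delta>})"
    by (rule integral_has_vector_derivative[OF c0]) (use \<delta> in simp)
  then have "((\<lambda>t. pd l (Y t) x - pd l (Y 0) x) has_vector_derivative pd l (Z 0) x) (at 0 within {0..\<delta>})"
    by (rule has_vector_derivative_transform[rotated -1]) (use \<delta> main in auto)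
  from has_vector_derivative_add[OF this has_vector_derivative_const[of "pd l (Y 0) x"]]
  have 1: "((\<lambda>t. pd l (Y t) x) has_vector_derivative pd l (Z 0) x) (at 0 within {0..\<delta>})" by simp
  note pC = Ck_on_pd[OF Y Q, of l]
  have 2: "((\<lambda>t. pd l (Y t) x) has_vector_derivative shape_deriv (\<lambda>t. pd l (Y t) x)) (at 0 within {0..\<delta>})"
    unfolding shape_deriv_eq[OF pC Q in0] by (rule has_vector_derivative_at_within[OF slice_t[OF pC Q in0]])
  have "at (0::real) within {0..\<delta>} \<noteq> bot" using \<delta> by (simp add: trivial_limit_within)
  from vector_derivative_unique_within[OF this 2 1]
  have eq: "shape_deriv (\<lambda>t. pd l (Y t) x) = pd l (Z 0) x" .
  have "open (Pair (0::real) -` Q)" by (rule open_vimage[OF Q]) (intro continuous_intros)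
  then have op: "open {y. (0, y) \<in> Q}" by (simp add: vimage_def)
  have "(Z 0 has_derivative frechet_derivative (Z 0) (at x)) (at x)"
    using slice_x[OF ZC Q in0] frechet_derivative_at by metis
  then have "((\<lambda>y. shape_deriv (\<lambda>t. Y t y)) has_derivative frechet_derivative (Z 0) (at x)) (at x)"
    by (rule has_derivative_transform_within_open[OF _ op])
      (use in0 in \<open>auto simp: shape_deriv_eq[OF Y1 Q] Z_def D_def\<close>)
  from frechet_derivative_at[OF this] show ?thesis unfolding eq by (simp add: pd_def)
qed

lemma shape_derivI: "(f has_vector_derivative D) (at 0) \<Longrightarrow> shape_deriv f = D"
  unfolding shape_deriv_def by (rule vector_derivative_at)

locale flow = perturbed_boundary +
  fixes g :: gas and u :: "real \<Rightarrow> real^2 \<Rightarrow> real^4"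
  assumes uC: "Ck_on (Suc (Suc (Suc 0))) (\<lambda>(t, x). u t x) Q"
    and upos: "\<And>t x. (t, x) \<in> Q \<Longrightarrow> u t x \<in> Upos"
begin

abbreviation "u1 \<equiv> \<lambda>x. shape_deriv (\<lambda>t. u t x)"
abbreviation "vt t x \<equiv> vel (u t x)"
abbreviation "Tt t x \<equiv> temp g (u t x)"
abbreviation "qt t x \<equiv> grad (Tt t) x"
abbreviation "tt t x \<equiv> tau g (u t x) (Dm (u t) x)"
abbreviation "Ft t x \<equiv> flux_at g (u t) x"

lemma Ck_along:
  assumes "\<And>j. Ck_on j f Upos"
  shows "Ck_on (Suc (Suc (Suc 0))) (\<lambda>(t, x). f (u t x)) Q"
proof -
  have "(\<lambda>(t, x). u t x) ` Q \<subseteq> Upos" using upos by auto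
  from Ck_on_compose[OF open_Q this uC assms] show ?thesis by (simp add: case_prod_beta')
qed

lemma u_slice: 
  assumes "(t, x) \<in> Q"
  shows "(u t has_derivative frechet_derivative (u t) (at x)) (at x)"
  using slice_x[OF uC open_Q assms] frechet_derivative_at by metis

lemma tt_eq: "(t, x) \<in> Q \<Longrightarrow> tt t x = stress (visc g) (Dm (vt t) x)"
  by (rule tau_along[of "u t", OF u_slice upos])

lemma temp_grad_eq: "(t, x) \<in> Q \<Longrightarrow> temp_grad g (u t x) (Dm (u t) x) = qt t x"
  by (rule temp_grad_along[of "u t", OF u_slice upos])

lemma Ck_Dm:
  fixes Y :: "real \<Rightarrow> real^2 \<Rightarrow> real^'m"
  assumes "Ck_on (Suc m) (\<lambda>(t, x). Y t x) Q"
  shows "Ck_on m (\<lambda>(t, x). Dm (Y t) x) Q"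
proof -
  have "Ck_on m (\<lambda>p. pd j (Y (fst p)) (snd p) $ i) Q" for i j
    using Ck_on_nth[OF open_Q Ck_on_pd[OF assms open_Q, of j], of i] by (simp add: case_prod_beta')
  then show ?thesis
    unfolding case_prod_beta' by (intro Ck_on_vec open_Q) (simp add: Dm_nth_pd)
qed

lemma Ck_grad:
  assumes "Ck_on (Suc m) (\<lambda>(t, x). Y t x) Q"
  shows "Ck_on m (\<lambda>(t, x). grad (Y t) x) Q"
  using Ck_on_pd[OF assms open_Q]
  unfolding case_prod_beta' by (intro Ck_on_vec open_Q) (simp add: grad_def)

lemma qt_C2: "Ck_on (Suc (Suc 0)) (\<lambda>(t, x). qt t x) Q"
  by (rule Ck_grad[OF Ck_along[OF Ck_temp]])

lemma tt_C2: "Ck_on (Suc (Suc 0)) (\<lambda>(t, x). tt t x) Q"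
proof (rule Ck_on_cong_imp[OF open_Q _ Ck_on_linear[OF _ open_Q Ck_Dm[OF Ck_along[OF Ck_vel]]]])
  show "bounded_linear (stress (visc g))" using stress_linear linear_conv_bounded_linear by blast
qed (auto simp: tt_eq)

lemma fv_along_C2: "Ck_on (Suc (Suc 0)) (\<lambda>(t, x). fv g k (u t x) (Dm (u t) x)) Q"
proof -
  have 1: "Ck_on (Suc (Suc 0)) (\<lambda>(t, x). fv g k (u t x) (E_mat a b)) Q" for a b
    by (rule Ck_on_SucD[OF Ck_along[OF Ck_fv]])
  have 2: "Ck_on (Suc (Suc 0)) (\<lambda>p. Dm (u (fst p)) (snd p) $ a $ b) Q" for a b
    using Ck_on_nth[OF open_Q Ck_on_nth[OF open_Q Ck_Dm[OF uC]]] by (simp add: case_prod_beta')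
  have "Ck_on (Suc (Suc 0)) (\<lambda>p. \<Sum>a\<in>UNIV. \<Sum>b\<in>UNIV. Dm (u (fst p)) (snd p) $ a $ b *\<^sub>R fv g k (u (fst p) (snd p)) (E_mat a b)) Q"
    by (intro Ck_on_sum Ck_on_scaleR open_Q 2 1[unfolded case_prod_beta'])
  from Ck_on_cong_imp[OF open_Q _ this] show ?thesis
    using upos fv_decomp by (auto simp: case_prod_beta')
qed

lemma Ft_C2: "Ck_on (Suc (Suc 0)) (\<lambda>(t, x). Ft t x) Q"
proof -
  have "Ck_on (Suc (Suc 0)) (\<lambda>p. (fc g k (u (fst p) (snd p)) - fv g k (u (fst p) (snd p)) (Dm (u (fst p)) (snd p))) $ i) Q" for i k
    by (intro Ck_on_nth Ck_on_diff open_Q fv_along_C2[unfolded case_prod_beta']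
        Ck_on_SucD[OF Ck_along[OF Ck_fc], unfolded case_prod_beta'])
  then show ?thesis
    unfolding case_prod_beta' by (intro Ck_on_vec open_Q) (simp add: flux_at_def flux_def)
qed

lemma u_t: "(0, x) \<in> Q \<Longrightarrow> ((\<lambda>t. u t x) has_vector_derivative u1 x) (at 0)"
  using slice_t[OF uC open_Q] shape_deriv_eq[OF uC open_Q] by simp

lemma along_t:
  assumes "(0, x) \<in> Q" "\<And>j. Ck_on j f Upos"
  shows "((\<lambda>t. f (u t x)) has_vector_derivative frechet_derivative f (at (u 0 x)) (u1 x)) (at 0)"
proof -
  have fd: "(f has_derivative frechet_derivative f (at (u 0 x))) (at (u 0 x))"
    using Ck_on_has_derivative[OF assms(2)[of "Suc 0"]] upos[OF assms(1)] by blast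
  have lin: "linear (frechet_derivative f (at (u 0 x)))" using has_derivative_linear[OF fd] .
  show ?thesis
    using has_derivative_compose[OF u_t[OF assms(1), unfolded has_vector_derivative_def] fd]
    unfolding has_vector_derivative_def by (simp add: linear_cmul[OF lin])
qed

lemma Dm_t: 
  assumes "(0, x) \<in> Q"
  shows "((\<lambda>t. Dm (u t) x $ a $ b) has_vector_derivative Dm u1 x $ a $ b) (at 0)"
proof -
  note p = Ck_on_pd[OF uC open_Q, of b]
  have "((\<lambda>t. pd b (u t) x) has_vector_derivative pd b u1 x) (at 0)"
    using slice_t[OF p open_Q assms] mixed_partials[OF Ck_on_SucD[OF uC] open_Q assms, of b]
    by (simp add: shape_deriv_eq[OF p open_Q assms])
  from bounded_linear.has_vector_derivative[OF bounded_linear_vec_nth this, of a]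
  show ?thesis by (simp add: Dm_nth_pd)
qed

lemma flux_u_mult:
  assumes "(0, x) \<in> Q"
  shows "flux_u g (u 0) k x *v h = frechet_derivative (fc g k) (at (u 0 x)) h
      - frechet_derivative (\<lambda>U. fv g k U (Dm (u 0) x)) (at (u 0 x)) h"
  unfolding flux_u_def matrix_vector_mult_diff_rdistrib
  using Dm_mult[OF Ck_on_has_derivative[OF Ck_fc[of "Suc 0"], of "u 0 x" g k]]
    Dm_mult[OF Ck_on_has_derivative[OF Ck_fv[of "Suc 0"], of "u 0 x" g k "Dm (u 0) x"]] upos[OF assms]
  by simp

lemma fv_frechet_decomp:
  assumes "U \<in> Upos"
  shows "frechet_derivative (\<lambda>U. fv g k U A) (at U) h
    = (\<Sum>a\<in>UNIV. \<Sum>b\<in>UNIV. A $ a $ b *\<^sub>R frechet_derivative (\<lambda>U. fv g k U (E_mat a b)) (at U) h)"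
proof -
  have d: "((\<lambda>U. fv g k U (E_mat a b)) has_derivative frechet_derivative (\<lambda>U. fv g k U (E_mat a b)) (at U)) (at U)" for a b
    using Ck_on_has_derivative[OF Ck_fv[of "Suc 0"] assms] .
  have "((\<lambda>U. \<Sum>a\<in>UNIV. \<Sum>b\<in>UNIV. A $ a $ b *\<^sub>R fv g k U (E_mat a b)) has_derivative
    (\<lambda>h. \<Sum>a\<in>UNIV. \<Sum>b\<in>UNIV. A $ a $ b *\<^sub>R frechet_derivative (\<lambda>U. fv g k U (E_mat a b)) (at U) h)) (at U)"
    by (intro has_derivative_sum has_derivative_scaleR_right d)
  then have "((\<lambda>U. fv g k U A) has_derivative
    (\<lambda>h. \<Sum>a\<in>UNIV. \<Sum>b\<in>UNIV. A $ a $ b *\<^sub>R frechet_derivative (\<lambda>U. fv g k U (E_mat a b)) (at U) h)) (at U)"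
    by (rule has_derivative_transform_within_open[OF _ open_Upos assms]) (rule fv_decomp[symmetric])
  from fun_cong[OF frechet_derivative_at[OF this], of h, symmetric] show ?thesis .
qed

text \<open>Both the state and its gradient vary in time. Expanding the viscous flux in matrix units
  separates the two contributions, and the gradient varies by the gradient of \<open>u'\<close>.\<close>

lemma flux_linearised:
  assumes x: "(0, x) \<in> Q"
  shows "shape_deriv (\<lambda>t. Ft t x) = lin_flux g (u 0) u1 x"
proof -
  define Fd where "Fd k = flux_u g (u 0) k x *v u1 x - fv g k (u 0 x) (Dm u1 x)" for k
  have kd: "((\<lambda>t. fc g k (u t x) - fv g k (u t x) (Dm (u t) x)) has_vector_derivative Fd k) (at 0)" for k
  proof -
    let ?d = "\<lambda>a b. frechet_derivative (\<lambda>U. fv g k U (E_mat a b)) (at (u 0 x)) (u1 x)"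
    have "((\<lambda>t. \<Sum>a\<in>UNIV. \<Sum>b\<in>UNIV. Dm (u t) x $ a $ b *\<^sub>R fv g k (u t x) (E_mat a b)) has_vector_derivative
       (\<Sum>a\<in>UNIV. \<Sum>b\<in>UNIV. Dm (u 0) x $ a $ b *\<^sub>R ?d a b + Dm u1 x $ a $ b *\<^sub>R fv g k (u 0 x) (E_mat a b))) (at 0)"
      by (intro has_vector_derivative_sum has_vector_derivative_scaleR along_t[OF x Ck_fv])
        (use Dm_t[OF x] in \<open>simp add: has_real_derivative_iff_has_vector_derivative\<close>)
    moreover have "(\<Sum>a\<in>UNIV. \<Sum>b\<in>UNIV. Dm (u 0) x $ a $ b *\<^sub>R ?d a b + Dm u1 x $ a $ b *\<^sub>R fv g k (u 0 x) (E_mat a b))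
      = frechet_derivative (\<lambda>U. fv g k U (Dm (u 0) x)) (at (u 0 x)) (u1 x) + fv g k (u 0 x) (Dm u1 x)"
      unfolding fv_frechet_decomp[OF upos[OF x], of k "Dm (u 0) x"] fv_decomp[OF upos[OF x], of g k "Dm u1 x"]
      by (simp add: sum.distrib)
    ultimately have fvd: "((\<lambda>t. \<Sum>a\<in>UNIV. \<Sum>b\<in>UNIV. Dm (u t) x $ a $ b *\<^sub>R fv g k (u t x) (E_mat a b)) has_vector_derivative
       frechet_derivative (\<lambda>U. fv g k U (Dm (u 0) x)) (at (u 0 x)) (u1 x) + fv g k (u 0 x) (Dm u1 x)) (at 0)"
      by simp
    have "((\<lambda>t. fv g k (u t x) (Dm (u t) x)) has_vector_derivative
       frechet_derivative (\<lambda>U. fv g k U (Dm (u 0) x)) (at (u 0 x)) (u1 x) + fv g k (u 0 x) (Dm u1 x)) (at 0)"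
    proof (rule has_vector_derivative_transform_within_open[OF fvd, of "{-\<epsilon><..<\<epsilon>}"])
      show "(\<Sum>a\<in>UNIV. \<Sum>b\<in>UNIV. Dm (u t) x $ a $ b *\<^sub>R fv g k (u t x) (E_mat a b)) = fv g k (u t x) (Dm (u t) x)"
        if "t \<in> {-\<epsilon><..<\<epsilon>}" for t
        using fv_decomp[OF upos, of t x g k "Dm (u t) x"] x that by simp
    qed (use \<epsilon> in auto)
    from has_vector_derivative_diff[OF along_t[OF x Ck_fc] this] show ?thesis
      by (simp add: Fd_def flux_u_mult[OF x] algebra_simps)
  qed
  have eqF: "shape_deriv (\<lambda>t. Ft t x) $ i $ k = Fd k $ i" for i k
  proof -
    have FD: "((\<lambda>t. Ft t x) has_vector_derivative shape_deriv (\<lambda>t. Ft t x)) (at 0)"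
      unfolding shape_deriv_eq[OF Ft_C2 open_Q x] by (rule slice_t[OF Ft_C2 open_Q x])
    have "((\<lambda>t. Ft t x $ i $ k) has_vector_derivative shape_deriv (\<lambda>t. Ft t x) $ i $ k) (at 0)"
      by (intro bounded_linear.has_vector_derivative[OF bounded_linear_vec_nth] FD)
    moreover have "((\<lambda>t. Ft t x $ i $ k) has_vector_derivative Fd k $ i) (at 0)"
      using bounded_linear.has_vector_derivative[OF bounded_linear_vec_nth kd] by (simp add: flux_at_def flux_def)
    ultimately show ?thesis by (rule vector_derivative_unique_at)
  qed
  show ?thesis
    unfolding vec_eq_iff eqF
    by (simp add: lin_flux_def Fd_def visc_G_grad[of "u 0" x, OF upos[OF x]])
qed

end

section \<open>The adjoint problem and the far field\<close>

lemma continuous_matrix_vector [continuous_intros]: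
  fixes A :: "'a::topological_space \<Rightarrow> real^'n^'m"
  assumes "continuous_on S A" "continuous_on S b"
  shows "continuous_on S (\<lambda>x. A x *v b x)"
  unfolding matrix_vector_mult_def
  by (intro continuous_on_vec_lambda continuous_intros continuous_on_component assms)

lemma continuous_vector_matrix [continuous_intros]:
  fixes A :: "'a::topological_space \<Rightarrow> real^'n^'m"
  assumes "continuous_on S A" "continuous_on S b"
  shows "continuous_on S (\<lambda>x. b x v* A x)"
  unfolding vector_matrix_mult_def
  by (intro continuous_on_vec_lambda continuous_intros continuous_on_component assms)

lemma pd_eq: "(f has_derivative D) (at x) \<Longrightarrow> pd l f x = D (axis l 1)"
  by (simp add: pd_def frechet_derivative_at[symmetric])

lemma column_linear: "bounded_linear (column k :: real^2^4 \<Rightarrow> real^4)"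
  unfolding linear_conv_bounded_linear[symmetric]
  by (rule linearI) (simp_all add: column_def vec_eq_iff)

lemma divm_eq:
  assumes "(B has_derivative D) (at x)"
  shows "divm B x = (\<Sum>k\<in>UNIV. column k (D (axis k 1)))"
  unfolding divm_def using pd_eq[OF bounded_linear.has_derivative[OF column_linear assms]] by simp

lemma divm_nth:
  assumes "(B has_derivative D) (at x)"
  shows "divm B x $ i = divg (\<lambda>y. B y $ i) x"
  using divg_eq[OF bounded_linear.has_derivative[OF bounded_linear_vec_nth assms]]
  by (simp add: divm_eq[OF assms] column_def sum_2)

lemma divg_product:
  fixes a :: "real^2 \<Rightarrow> real^4" and B :: "real^2 \<Rightarrow> real^2^4"
  assumes a: "(a has_derivative Da) (at x)" and B: "(B has_derivative DB) (at x)"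
  shows "divg (\<lambda>y. a y v* B y) x = a x \<bullet> divm B x + B x \<bullet> Dm a x"
proof -
  have eq: "a y v* B y = (\<Sum>i\<in>UNIV. a y $ i *\<^sub>R B y $ i)" for y
    by (simp add: vector_matrix_mult_def vec_eq_iff mult.commute)
  have "((\<lambda>y. a y v* B y) has_derivative (\<lambda>h. \<Sum>i\<in>UNIV. a x $ i *\<^sub>R DB h $ i + Da h $ i *\<^sub>R B x $ i)) (at x)"
    unfolding eq by (intro has_derivative_sum has_derivative_scaleR bounded_linear.has_derivative[OF bounded_linear_vec_nth] a B)
  from divg_eq[OF this] show ?thesis
    unfolding divm_eq[OF B] inner_matrix_2 column_Dm pd_eq[OF a]
    by (simp add: sum_2 sum_4 inner_vec_def column_def algebra_simps)
qed

lemma C1_continuous_divm: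
  assumes "Ck_on (Suc m) B N" "A \<subseteq> N" shows "continuous_on A (divm B)"
proof -
  have "continuous_on A (\<lambda>x. \<Sum>k\<in>UNIV. column k (frechet_derivative B (at x) (axis k 1)))"
    by (intro continuous_intros bounded_linear.continuous_on[OF column_linear]
        continuous_on_subset[OF Ck_on_imp_continuous_on[OF Ck_on_derivative[OF assms(1)]] assms(2)])
  then show ?thesis
    by (rule continuous_on_eq) (use divm_eq[OF Ck_on_has_derivative[OF assms(1)]] assms(2) in auto)
qed

lemma lin_flux_grad:
  assumes "u x \<in> Upos"
  shows "lin_flux g u w x \<bullet> Dm z x = w x \<bullet> flux_uT_grad g u z x - Dm w x \<bullet> visc_GT_grad g u z x"
proof -
  have col: "column k (lin_flux g u w x) = flux_u g u k x *v w x - fv g k (u x) (Dm w x)" for k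
    by (simp add: lin_flux_def column_def vec_eq_iff visc_G_grad[of u x, OF assms, symmetric])
  show ?thesis
    unfolding inner_grad_visc[of u x, OF assms] inner_matrix_2[of "lin_flux g u w x"] col column_Dm
    by (simp add: flux_uT_grad_def inner_sum_right inner_vector_matrix inner_diff_left sum_subtractf)
qed

context perturbed_boundary begin

lemma Ck_shape_deriv:
  assumes Y: "Ck_on (Suc m) (\<lambda>(t, x). Y t x) Q"
  shows "Ck_on m (\<lambda>x. shape_deriv (\<lambda>t. Y t x)) N"
proof -
  have P: "Ck_on m (Pair (0::real)) N"
  proof -
    have "Ck_on m (\<lambda>x::real^2. (0::real, x)) N"
      by (intro Ck_on_bounded_linear bounded_linear_Pair bounded_linear_zero bounded_linear_ident N)
    then show ?thesis .
  qed
  have "Ck_on m (\<lambda>x. frechet_derivative (\<lambda>(t, x). Y t x) (at (Pair 0 x)) (1, 0)) N"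
    by (rule Ck_on_compose[OF N(1) _ P Ck_on_derivative[OF Y]]) (use \<epsilon> in auto)
  then show ?thesis
    by (rule Ck_on_cong_imp[OF N(1), rotated]) (use \<epsilon> in \<open>auto simp: shape_deriv_eq[OF Y open_Q]\<close>)
qed

lemma slice_0: 
  assumes "Ck_on (Suc m) (\<lambda>(t, x). Y t x) Q" shows "Ck_on (Suc m) (Y 0) N"
  using slice_Ck[OF assms open_Q, of 0] \<epsilon> by simp

end

locale adjoint_flow = flow +
  fixes z :: "real^2 \<Rightarrow> real^4" and M :: "(real^2) set"
  assumes M: "open M" "closure (dom d) \<subseteq> M" "M \<subseteq> N"
    and zC: "Ck_on (Suc (Suc 0)) z M"
begin

abbreviation "u0 \<equiv> u 0"
abbreviation "Gz \<equiv> visc_GT_grad g u0 z"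

lemma in0: "x \<in> M \<Longrightarrow> (0, x) \<in> Q" using M \<epsilon> by auto

lemma u0pos: "x \<in> M \<Longrightarrow> u0 x \<in> Upos" using upos[OF in0] .

lemma wall_M: "wall d \<subseteq> M" and far_M: "farfield d \<subseteq> M" and dom_M: "dom d \<subseteq> M" and bdry_M: "bdry d \<subseteq> M"
  using wall_closure far_closure bdry_closure closure_subset M by blast+

lemma u0C: "Ck_on (Suc (Suc (Suc 0))) u0 M"
  using Ck_on_subset[OF slice_0[OF uC] M(3)] .

lemma u1C: "Ck_on (Suc (Suc 0)) u1 M"
  using Ck_on_subset[OF Ck_shape_deriv[OF uC] M(3)] .

lemma Ck_u0: 
  assumes "\<And>j. Ck_on j f Upos" shows "Ck_on (Suc (Suc (Suc 0))) (\<lambda>x. f (u0 x)) M"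
  by (rule Ck_on_compose[OF M(1) _ u0C assms]) (use u0pos in auto)

lemma Gz_C1: "Ck_on (Suc 0) Gz M"
proof -
  have eq: "Gz x $ i $ l = (\<Sum>k\<in>UNIV. fv g k (u0 x) (outer (axis i 1) (axis l 1)) \<bullet> pd k z x)" if "x \<in> M" for x i l
    using inner_visc_GT_grad[of u0 x "axis i 1" g z "axis l 1", OF u0pos[OF that]]
    by (simp add: inner_axis' matrix_vector_mult_basis column_def)
  have "Ck_on (Suc 0) (\<lambda>x. fv g k (u0 x) B) M" for k B
    using Ck_on_le[OF Ck_u0[OF Ck_fv], of "Suc 0" g k B] by simp
  moreover have "Ck_on (Suc 0) (pd k z) M" for k
    unfolding pd_def[abs_def] by (rule Ck_on_derivative[OF zC])
  ultimately have "Ck_on (Suc 0) (\<lambda>x. \<Sum>k\<in>UNIV. fv g k (u0 x) B \<bullet> pd k z x) M" for B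
    by (intro Ck_on_sum Ck_on_inner M)
  note sC = this
  have "Ck_on (Suc 0) (\<lambda>x. Gz x $ i $ l) M" for i l
    by (rule Ck_on_cong_imp[OF M(1) _ sC[of "outer (axis i 1) (axis l 1)"]]) (simp add: eq)
  then show ?thesis by (intro Ck_on_vec M)
qed

lemma flux_u_cont: "continuous_on M (flux_u g u0 k)"
proof -
  have c: "continuous_on M (\<lambda>x. frechet_derivative f (at (u0 x)) h)" if "\<And>j. Ck_on j f Upos"
    for f :: "real^4 \<Rightarrow> real^4" and h
    by (rule continuous_on_compose2[OF Ck_on_imp_continuous_on[OF Ck_on_derivative[OF that[of "Suc 0"]]]
          Ck_on_imp_continuous_on[OF u0C]]) (use u0pos in auto)
  have "continuous_on M (\<lambda>x. Dm u0 x $ a $ b)" for a b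
    unfolding Dm_nth_pd pd_def
    by (intro continuous_intros Ck_on_imp_continuous_on[OF Ck_on_derivative[OF u0C]])
  then have "continuous_on M (\<lambda>x. \<chi> a b. Dm u0 x $ a $ b)" by (intro continuous_on_vec_lambda)
  then have D: "continuous_on M (Dm u0)" by simp
  have "continuous_on M (\<lambda>x. \<chi> i j. (frechet_derivative (fc g k) (at (u0 x)) (axis j 1)
      - (\<Sum>a\<in>UNIV. \<Sum>b\<in>UNIV. Dm u0 x $ a $ b *\<^sub>R frechet_derivative (\<lambda>U. fv g k U (E_mat a b)) (at (u0 x)) (axis j 1))) $ i)"
    by (intro continuous_on_vec_lambda continuous_intros continuous_on_component c Ck_fc Ck_fv D)
  then show ?thesis
    by (rule continuous_on_eq) (simp add: vec_eq_iff flux_u_def Dm_nth fv_frechet_decomp[OF u0pos])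
qed

lemma z_cont: "continuous_on M z" and u1_cont: "continuous_on M u1" and Gz_cont: "continuous_on M Gz"
  using Ck_on_imp_continuous_on zC u1C Gz_C1 by blast+

lemma pd_z_cont: "continuous_on M (pd k z)"
  unfolding pd_def[abs_def] by (rule Ck_on_imp_continuous_on[OF Ck_on_derivative[OF zC]])

lemma flux_uT_grad_cont: "continuous_on M (flux_uT_grad g u0 z)"
  unfolding flux_uT_grad_def[abs_def]
  by (simp, intro continuous_intros flux_u_cont pd_z_cont)

lemma divm_Gz_cont: "continuous_on M (divm Gz)"
  by (rule C1_continuous_divm[OF Gz_C1 order_refl])

lemma dom_integrable:
  fixes f :: "real^2 \<Rightarrow> real"
  assumes "continuous_on M f" shows "set_integrable lborel (dom d) f"
proof -
  have "compact (closure (dom d))" using bounded_dom by simp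
  then have "set_integrable lborel (closure (dom d)) f"
    by (intro borel_integrable_compact[folded set_integrable_def] continuous_on_subset[OF assms M(2)])
  then show ?thesis
    by (rule set_integrable_subset) (use open_dom closure_subset in auto)
qed

definition far_terms :: real where
  "far_terms = bint d (farfield d) (\<lambda>x n. u1 x \<bullet> (Gz x *v n)) + bint d (farfield d) (\<lambda>x n. u1 x \<bullet> n_flux_uT g u0 z x n)
     - bint d (farfield d) (\<lambda>x n. Dm u1 x \<bullet> n_visc_GT g u0 z x n)"

lemma wall_collar:
  "\<exists>e>0. \<forall>p\<in>farfield d. \<forall>y\<in>wall d. e \<le> dist y p"
proof -
  have "open (- farfield d)" "wall d \<subseteq> - farfield d" using closed_far wall_far by auto
  from compact_subset_open_imp_ball_epsilon_subset[OF compact_wall this]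
  obtain e where e: "e > 0" "(\<Union>x\<in>wall d. ball x e) \<subseteq> - farfield d" .
  then show ?thesis by (intro exI[of _ e]) (auto simp: not_le[symmetric] subset_iff)
qed

lemma zero_derivative_open:
  fixes w :: "real^2 \<Rightarrow> real^4"
  assumes "open G" "x \<in> G" "\<And>y. y \<in> G \<Longrightarrow> w y = 0" shows "Dm w x = 0"
proof -
  have "(w has_derivative (\<lambda>h. 0)) (at x)"
    by (rule has_derivative_transform_within_open[OF has_derivative_const assms(1,2)]) (simp add: assms(3))
  then show ?thesis by (simp add: vec_eq_iff Dm_nth_pd pd_eq)
qed

text \<open>The local shape derivative itself need not be an admissible variation, but its products with
  smooth functions vanishing near the wall are. The far-field terms do not see these cut-offs, and
  the volume terms converge when the cut-offs tend to \<open>1\<close> on the domain.\<close>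

lemma adjoint_far_field:
  assumes sp: "\<And>i. suitable_space (dom d) (X i)"
    and test: "adjoint_test_space d (prod_space X) W" and adj: "adjoint_problem g C \<psi> d (prod_space X) W u0 z"
    and u1X: "u1 \<in> prod_space X"
  shows "(LINT x:dom d|lborel. u1 x \<bullet> flux_uT_grad g u0 z x) + (LINT x:dom d|lborel. u1 x \<bullet> divm Gz x) = far_terms"
proof -
  obtain e where e: "e > 0" "\<And>p y. p \<in> farfield d \<Longrightarrow> y \<in> wall d \<Longrightarrow> e \<le> dist y p"
    using wall_collar by blast
  define r where "r n = min (e / 2) (1 / (real n + 1))" for n :: nat
  have r: "r n > 0" for n using e by (simp add: r_def)
  define U where "U n = (\<Union>y\<in>wall d. ball y (r n))" for n
  have "\<exists>\<phi> G. (\<forall>k. Ck_on k \<phi> UNIV) \<and> open G \<and> wall d \<subseteq> G \<and> (\<forall>x\<in>G. \<phi> x = 0) \<and> (\<forall>x. x \<notin> U n \<longrightarrow> \<phi> x = 1)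
      \<and> (\<forall>x. 0 \<le> \<phi> x \<and> \<phi> x \<le> (1::real))" for n
  proof -
    have "open (U n)" "wall d \<subseteq> U n" using r by (auto simp: U_def)
    from smooth_cutoff[OF compact_wall this] show ?thesis by metis
  qed
  then obtain \<phi> G where \<phi>: "\<And>n k. Ck_on k (\<phi> n) UNIV" and G: "\<And>n. open (G n)" "\<And>n. wall d \<subseteq> G n"
    and \<phi>0: "\<And>n x. x \<in> G n \<Longrightarrow> \<phi> n x = 0" and \<phi>1: "\<And>n x. x \<notin> U n \<Longrightarrow> \<phi> n x = 1"
    and \<phi>b: "\<And>n x. 0 \<le> \<phi> n x \<and> \<phi> n x \<le> (1::real)" by metis
  let ?a = "\<lambda>x. u1 x \<bullet> flux_uT_grad g u0 z x" and ?b = "\<lambda>x. u1 x \<bullet> divm Gz x"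
  have eq: "(LINT x:dom d|lborel. \<phi> n x * ?a x) + (LINT x:dom d|lborel. \<phi> n x * ?b x) = far_terms" for n
  proof -
    define w where "w x = \<phi> n x *\<^sub>R u1 x" for x
    have "w \<in> prod_space X"
      unfolding prod_space_def w_def
      using u1X sp \<phi>[of _ n] unfolding prod_space_def suitable_space_def by simp
    moreover have w0: "w x = 0" if "x \<in> G n" for x using \<phi>0[OF that] by (simp add: w_def)
    ultimately have "w \<in> W" using test G unfolding adjoint_test_space_def by blast
    then have A: "- (LINT x:dom d|lborel. w x \<bullet> flux_uT_grad g u0 z x) - (LINT x:dom d|lborel. w x \<bullet> divm Gz x)
     + bint d (bdry d) (\<lambda>x n. w x \<bullet> (Gz x *v n)) + bint d (bdry d) (\<lambda>x n. w x \<bullet> n_flux_uT g u0 z x n)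
     - bint d (bdry d) (\<lambda>x n. Dm w x \<bullet> n_visc_GT g u0 z x n) = drag_lift_deriv g C \<psi> d u0 w"
      using adj unfolding adjoint_problem_def by blast
    have ww: "w x = 0 \<and> Dm w x = 0" if "x \<in> wall d" for x
      using w0 zero_derivative_open[OF G(1)[of n], of x w] G(2)[of n] that by blast
    have lin0: "frechet_derivative f (at U) 0 = 0" if "Ck_on (Suc 0) f Upos" "U \<in> Upos"
      for f :: "real^4 \<Rightarrow> 'c::euclidean_space" and U
      using has_derivative_linear[OF Ck_on_has_derivative[OF that]] linear_0 by blast
    have lin1: "frechet_derivative (tau g U) (at B) 0 = 0" for U B
    proof -
      have "(tau g U has_derivative tau g U) (at B)"
        using tau_linear linear_imp_has_derivative by blast
      from frechet_derivative_at[OF this] show ?thesis using tau_linear linear_0 by metis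
    qed
    have "drag_lift_deriv g C \<psi> d u0 w = bint d (wall d) (\<lambda>x n. 0) - bint d (wall d) (\<lambda>x n. 0)"
      unfolding drag_lift_deriv_def
    proof (intro arg_cong2[of _ _ _ _ "(-)"] bint_cong; unfold on_bdry_def; intro ballI allI impI)
      fix \<gamma> and s :: real assume "\<gamma> s \<in> wall d"
      note w = ww[OF this] and pos = u0pos[OF subsetD[OF wall_M this]]
      show "1 / C * ((frechet_derivative (pres g) (at (u0 (\<gamma> s))) (w (\<gamma> s)) *\<^sub>R curve_normal \<gamma> s
         - frechet_derivative (\<lambda>U. tau g U (Dm u0 (\<gamma> s))) (at (u0 (\<gamma> s))) (w (\<gamma> s)) *v curve_normal \<gamma> s) \<bullet> \<psi>) = 0"
        using w lin0[OF Ck_pres pos] lin0[OF Ck_tau pos] by simp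
      show "1 / C * ((frechet_derivative (tau g (u0 (\<gamma> s))) (at (Dm u0 (\<gamma> s))) (Dm w (\<gamma> s)) *v curve_normal \<gamma> s) \<bullet> \<psi>) = 0"
        using w lin1 by simp
    qed
    then have dl: "drag_lift_deriv g C \<psi> d u0 w = 0" by simp
    have split: "bint d (bdry d) f = bint d (farfield d) h"
      if "\<And>x n. x \<in> wall d \<Longrightarrow> f x n = 0" "\<And>x n. x \<in> farfield d \<Longrightarrow> f x n = h x n" for f h
    proof -
      have "bint d (wall d) f = bint d (wall d) (\<lambda>x n. 0)"
        by (rule bint_cong) (auto simp: on_bdry_def that)
      moreover have "bint d (farfield d) f = bint d (farfield d) h"
        by (rule bint_cong) (auto simp: on_bdry_def that)
      ultimately show ?thesis by (simp add: bint_bdry_split bint_0)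
    qed
    have wf: "w x = u1 x \<and> Dm w x = Dm u1 x" if x: "x \<in> farfield d" for x
    proof -
      have nU: "y \<notin> U n" if "y \<in> ball x (e / 2)" for y
      proof
        assume "y \<in> U n"
        then obtain p where p: "p \<in> wall d" "dist p y < r n" by (auto simp: U_def)
        have "dist p x \<le> dist p y + dist x y" using dist_triangle2 by metis
        also have "\<dots> < e / 2 + e / 2" using p that by (auto simp: r_def)
        finally show False using e(2)[OF x p(1)] by simp
      qed
      have wy: "w y = u1 y" if "y \<in> ball x (e / 2)" for y using \<phi>1[OF nU[OF that]] by (simp add: w_def)
      have du: "(u1 has_derivative frechet_derivative u1 (at x)) (at x)"
        using Ck_on_has_derivative[OF u1C] x far_M by blast
      have "(w has_derivative frechet_derivative u1 (at x)) (at x)"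
        by (rule has_derivative_transform_within_open[OF du, of "ball x (e / 2)"]) (use e wy in auto)
      then have "Dm w x = Dm u1 x" using du by (simp add: vec_eq_iff Dm_nth_pd pd_eq)
      moreover have "w x = u1 x" by (rule wy) (use e in auto)
      ultimately show ?thesis by simp
    qed
    have "bint d (bdry d) (\<lambda>x n. w x \<bullet> (Gz x *v n)) + bint d (bdry d) (\<lambda>x n. w x \<bullet> n_flux_uT g u0 z x n)
     - bint d (bdry d) (\<lambda>x n. Dm w x \<bullet> n_visc_GT g u0 z x n) = far_terms"
      unfolding far_terms_def
      by (intro arg_cong2[of _ _ _ _ "(-)"] arg_cong2[of _ _ _ _ "(+)"] split) (use ww wf in auto)
    with A dl show ?thesis by (simp add: w_def)
  qed
  have lim: "(\<lambda>n. LINT x:dom d|lborel. \<phi> n x * f x) \<longlonglongrightarrow> (LINT x:dom d|lborel. f x)"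
    if f: "continuous_on M f" for f :: "real^2 \<Rightarrow> real"
    unfolding set_lebesgue_integral_def
  proof (rule integral_dominated_convergence[where w="\<lambda>x. norm (indicator (dom d) x *\<^sub>R f x)"])
    have i: "integrable lborel (\<lambda>x. indicator (dom d) x *\<^sub>R f x)"
      using dom_integrable[OF f] by (simp add: set_integrable_def)
    then show m: "(\<lambda>x. indicator (dom d) x *\<^sub>R f x) \<in> borel_measurable lborel" by simp
    show "integrable lborel (\<lambda>x. norm (indicator (dom d) x *\<^sub>R f x))" using i by (rule integrable_norm)
    show "(\<lambda>x. indicator (dom d) x *\<^sub>R (\<phi> n x * f x)) \<in> borel_measurable lborel" for n
    proof -
      have "\<phi> n \<in> borel_measurable borel"
        using Ck_on_imp_continuous_on[OF \<phi>[of 0 n]] by (rule borel_measurable_continuous_onI)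
      then have "(\<lambda>x. \<phi> n x * (indicator (dom d) x *\<^sub>R f x)) \<in> borel_measurable lborel"
        using m by (intro borel_measurable_times) auto
      then show ?thesis by (simp add: mult.left_commute)
    qed
    show "AE x in lborel. (\<lambda>n. indicator (dom d) x *\<^sub>R (\<phi> n x * f x)) \<longlonglongrightarrow> indicator (dom d) x *\<^sub>R f x"
    proof (rule AE_I2)
      fix x
      show "(\<lambda>n. indicator (dom d) x *\<^sub>R (\<phi> n x * f x)) \<longlonglongrightarrow> indicator (dom d) x *\<^sub>R f x"
      proof (cases "x \<in> dom d")
        case True
        then have "x \<notin> wall d" using bdry_eq frontier_dom open_dom by (auto simp: frontier_def interior_open)
        then obtain s where s: "s > 0" "ball x s \<inter> wall d = {}"
          using closed_wall by (metis Compl_iff open_Compl open_contains_ball disjoint_eq_subset_Compl)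
        have "\<forall>\<^sub>F n in sequentially. 1 / (real n + 1) < s"
          using order_tendstoD(2)[OF LIMSEQ_inverse_real_of_nat s(1)] by (simp add: inverse_eq_divide add.commute)
        then have "\<forall>\<^sub>F n in sequentially. f x = \<phi> n x * f x"
        proof eventually_elim
          case (elim n)
          have "x \<notin> U n"
          proof
            assume "x \<in> U n"
            then obtain y where "y \<in> wall d" "dist y x < r n" by (auto simp: U_def)
            then have "y \<in> ball x s \<inter> wall d" using elim by (auto simp: r_def dist_commute)
            then show False using s by blast
          qed
          then show ?case using \<phi>1 by simp
        qed
        from Lim_transform_eventually[OF tendsto_const this] show ?thesis by (intro tendsto_intros)
      qed simp
    qed
    show "AE x in lborel. norm (indicator (dom d) x *\<^sub>R (\<phi> n x * f x)) \<le> norm (indicator (dom d) x *\<^sub>R f x)" for n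
    proof (rule AE_I2)
      fix x
      have "\<bar>\<phi> n x * f x\<bar> \<le> 1 * \<bar>f x\<bar>" unfolding abs_mult using \<phi>b[of n x] by (intro mult_right_mono) auto
      then show "norm (indicator (dom d) x *\<^sub>R (\<phi> n x * f x)) \<le> norm (indicator (dom d) x *\<^sub>R f x)"
        by (simp add: indicator_def)
    qed
  qed
  have "(\<lambda>n. (LINT x:dom d|lborel. \<phi> n x * ?a x) + (LINT x:dom d|lborel. \<phi> n x * ?b x)) \<longlonglongrightarrow>
      (LINT x:dom d|lborel. ?a x) + (LINT x:dom d|lborel. ?b x)"
    by (intro tendsto_add lim continuous_intros u1_cont flux_uT_grad_cont divm_Gz_cont)
  then show ?thesis unfolding eq using LIMSEQ_unique tendsto_const by blast
qed

end

section \<open>The wall\<close>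

lemma perturb_0: "perturb V 0 d = d"
  by (simp add: perturb_def Let_def o_def)

lemma joint_slices:
  fixes R :: "real \<Rightarrow> real^2 \<Rightarrow> 'b::real_normed_vector"
  assumes D: "((\<lambda>p. R (fst p) (snd p)) has_derivative D) (at (0, x))"
  shows "((\<lambda>t. R t x) has_vector_derivative D (1, 0)) (at 0)" and "(R 0 has_derivative (\<lambda>h. D (0, h))) (at x)"
proof -
  have lin: "linear D" using has_derivative_linear[OF D] .
  have 1: "((\<lambda>t. (t, x)) has_derivative (\<lambda>h. (h, 0))) (at 0)" by (auto intro!: derivative_eq_intros)
  have eq: "(\<lambda>h. D (h, 0)) = (\<lambda>h. h *\<^sub>R D (1, 0))"
  proof
    fix h
    have "(h, 0) = h *\<^sub>R (1::real, 0::real^2)" by simp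
    then show "D (h, 0) = h *\<^sub>R D (1, 0)" using linear_cmul[OF lin, of h "(1, 0)"] by metis
  qed
  have "((\<lambda>t. R t x) has_derivative (\<lambda>h. D (h, 0))) (at 0)"
    using has_derivative_compose[OF 1 D] by simp
  then show "((\<lambda>t. R t x) has_vector_derivative D (1, 0)) (at 0)"
    unfolding has_vector_derivative_def eq .
  have 2: "((\<lambda>x. (0, x)) has_derivative (\<lambda>h. (0, h))) (at x)" by (auto intro!: derivative_eq_intros)
  from has_derivative_compose[OF 2 D] show "(R 0 has_derivative (\<lambda>h. D (0, h))) (at x)" by simp
qed

lemma has_derivative_matrix_vector_zero:
  fixes A :: "'a::real_normed_vector \<Rightarrow> real^2^2"
  assumes "(A has_derivative DA) (at p)" "(b has_derivative Db) (at p)" "b p = 0"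
  shows "((\<lambda>y. A y *v b y) has_derivative (\<lambda>h. A p *v Db h)) (at p)"
proof -
  have eq: "B *v c = (\<Sum>j\<in>UNIV. c $ j *\<^sub>R column j B)" for B :: "real^2^2" and c
    by (simp add: matrix_vector_mult_def column_def vec_eq_iff mult.commute)
  have col: "bounded_linear (column j :: real^2^2 \<Rightarrow> real^2)" for j
    unfolding linear_conv_bounded_linear[symmetric] by (rule linearI) (simp_all add: column_def vec_eq_iff)
  have "((\<lambda>y. \<Sum>j\<in>UNIV. b y $ j *\<^sub>R column j (A y)) has_derivative
    (\<lambda>h. \<Sum>j\<in>UNIV. b p $ j *\<^sub>R column j (DA h) + Db h $ j *\<^sub>R column j (A p))) (at p)"
    by (intro has_derivative_sum has_derivative_scaleR bounded_linear.has_derivative[OF bounded_linear_vec_nth]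
        bounded_linear.has_derivative[OF col] assms)
  then show ?thesis using assms(3) by (simp add: eq[abs_def])
qed

lemma has_derivative_scaleR_zero:
  fixes f :: "'a::real_normed_vector \<Rightarrow> real"
  assumes "(f has_derivative Df) (at p)" "(b has_derivative Db) (at p)" "b p = 0"
  shows "((\<lambda>y. f y *\<^sub>R b y) has_derivative (\<lambda>h. f p *\<^sub>R Db h)) (at p)"
  using has_derivative_scaleR[OF assms(1,2)] assms(3) by simp

lemma matrix_vector_inner_4: "((A :: real^2^4) *v n) \<bullet> z = (\<Sum>i\<in>UNIV. z $ i * (A $ i \<bullet> n))"
  by (simp add: inner_vec_def[of "A *v n"] matrix_vector_mult_def inner_vec_def mult.commute)

context flow begin

lemma flux_rows:
  assumes "(t, x) \<in> Q"
  shows "Ft t x $ 1 = rho (u t x) *\<^sub>R vt t x"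
    and "Ft t x $ 4 = (rho (u t x) * enth g (u t x)) *\<^sub>R vt t x - tt t x *v vt t x - cond g *\<^sub>R qt t x"
  unfolding flux_at_def flux_def fc_def fv_def temp_grad_eq[OF assms]
  by (simp_all add: vec_eq_iff forall_2 vector_4 matrix_vector_mult_def algebra_simps)

lemma tt_sym: "tt t x $ i $ j = tt t x $ j $ i"
  unfolding tau_def by (rule stress_sym)

text \<open>The density of the drag or lift coefficient is the normal component of a field that differs
  from \<open>\<psi> \<bullet> (momentum flux)\<close> by terms quadratic in the velocity. On the wall these are negligible
  to first order, so pressure and stress never have to be differentiated separately.\<close>

definition drag_field :: "real^2 \<Rightarrow> real \<Rightarrow> real^2 \<Rightarrow> real^2" where
  "drag_field \<psi> t x = \<psi> $ 1 *\<^sub>R (Ft t x $ 2 - (rho (u t x) * vt t x $ 1) *\<^sub>R vt t x)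
     + \<psi> $ 2 *\<^sub>R (Ft t x $ 3 - (rho (u t x) * vt t x $ 2) *\<^sub>R vt t x)"

lemma drag_field_normal:
  "(pres g (u t x) *\<^sub>R n - tau g (u t x) (Dm (u t) x) *v n) \<bullet> \<psi> = drag_field \<psi> t x \<bullet> n"
  using tt_sym[of t x 1 2]
  by (simp add: drag_field_def flux_at_def flux_def fc_def fv_def vector_4 inner_2 matrix_vector_mult_def sum_2 algebra_simps)

lemma drag_field_C2: "Ck_on (Suc (Suc 0)) (\<lambda>(t, x). drag_field \<psi> t x) Q"
proof -
  have F: "Ck_on (Suc (Suc 0)) (\<lambda>p. Ft (fst p) (snd p) $ i) Q" for i
    using Ck_on_nth[OF open_Q Ft_C2] by (simp add: case_prod_beta')
  have v: "Ck_on (Suc (Suc 0)) (\<lambda>p. vt (fst p) (snd p)) Q"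
    using Ck_on_SucD[OF Ck_along[OF Ck_vel]] by (simp add: case_prod_beta')
  have r: "Ck_on (Suc (Suc 0)) (\<lambda>p. rho (u (fst p) (snd p))) Q"
    using Ck_on_SucD[OF Ck_along[OF Ck_rho]] by (simp add: case_prod_beta')
  show ?thesis
    unfolding case_prod_beta' drag_field_def
    by (intro Ck_on_add Ck_on_diff Ck_on_scaleR Ck_on_mult Ck_on_const Ck_on_nth open_Q F v r)
qed

lemma joint_has_derivative: 
  assumes "Ck_on (Suc m) (\<lambda>(t, x). Y t x) Q" "p \<in> Q"
  shows "((\<lambda>p. Y (fst p) (snd p)) has_derivative frechet_derivative (\<lambda>(t, x). Y t x) (at p)) (at p)"
  using Ck_on_has_derivative[OF assms] by (simp add: case_prod_beta')

text \<open>The velocity vanishes on the wall, so in every product with a factor \<open>v\<close> only the derivative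
  of that factor survives.\<close>

lemma wall_flux:
  assumes x: "(0, x) \<in> Q" and v0: "vel (u 0 x) = 0"
  defines "v' \<equiv> shape_deriv (\<lambda>t. vt t x)" and "q' \<equiv> shape_deriv (\<lambda>t. qt t x)"
    and "F' \<equiv> shape_deriv (\<lambda>t. Ft t x)"
  shows "F' $ 1 = rho (u 0 x) *\<^sub>R v'"
    and "divg (\<lambda>y. Ft 0 y $ 1) x = rho (u 0 x) * divg (vt 0) x"
    and "F' $ 4 = (rho (u 0 x) * enth g (u 0 x)) *\<^sub>R v' - tt 0 x *v v' - cond g *\<^sub>R q'"
    and "divg (\<lambda>y. Ft 0 y $ 4) x = rho (u 0 x) * enth g (u 0 x) * divg (vt 0) x
        - (\<Sum>i\<in>UNIV. \<Sum>j\<in>UNIV. tt 0 x $ i $ j * pd i (vt 0) x $ j) - cond g * divg (qt 0) x"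
    and "shape_deriv (\<lambda>t. drag_field \<psi> t x) = \<psi> $ 1 *\<^sub>R F' $ 2 + \<psi> $ 2 *\<^sub>R F' $ 3"
    and "divg (drag_field \<psi> 0) x = \<psi> $ 1 * divg (\<lambda>y. Ft 0 y $ 2) x + \<psi> $ 2 * divg (\<lambda>y. Ft 0 y $ 3) x"
proof -
  note dv = joint_has_derivative[OF Ck_along[OF Ck_vel] x]
  note dr = joint_has_derivative[OF Ck_along[OF Ck_rho] x]
  note dH = joint_has_derivative[OF Ck_along[OF Ck_enth] x, of g]
  note dt = joint_has_derivative[OF tt_C2 x]
  note dq = joint_has_derivative[OF qt_C2 x]
  note dF = joint_has_derivative[OF Ft_C2 x]
  define Dv where "Dv = frechet_derivative (\<lambda>(t, x). vt t x) (at (0, x))"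
  define Dq where "Dq = frechet_derivative (\<lambda>(t, x). qt t x) (at (0, x))"
  define DF where "DF = frechet_derivative (\<lambda>(t, x). Ft t x) (at (0, x))"
  note dv' = dv[folded Dv_def] and dq' = dq[folded Dq_def] and dF' = dF[folded DF_def]
  have v': "v' = Dv (1, 0)" unfolding v'_def by (rule shape_derivI[OF joint_slices(1)[OF dv']])
  have q': "q' = Dq (1, 0)" unfolding q'_def by (rule shape_derivI[OF joint_slices(1)[OF dq']])
  have F': "F' = DF (1, 0)" unfolding F'_def by (rule shape_derivI[OF joint_slices(1)[OF dF']])
  note xv = joint_slices(2)[OF dv'] and xq = joint_slices(2)[OF dq'] and xF = joint_slices(2)[OF dF']
  have dFi: "((\<lambda>p. Ft (fst p) (snd p) $ i) has_derivative (\<lambda>h. DF h $ i)) (at (0, x))" for i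
    by (rule bounded_linear.has_derivative[OF bounded_linear_vec_nth dF'])
  note xFi = joint_slices(2)[OF dFi]
  have v0': "(\<lambda>p. vt (fst p) (snd p)) (0, x) = 0" using v0 by simp
  have uniq: "DF h $ i = D h" if "((\<lambda>p. Ft (fst p) (snd p) $ i) has_derivative D) (at (0, x))" for i D h
    using has_derivative_unique[OF dFi that] by metis
  have near: "((\<lambda>p. Ft (fst p) (snd p) $ i) has_derivative D) (at (0, x))"
    if "(R has_derivative D) (at (0, x))" "\<And>t y. (t, y) \<in> Q \<Longrightarrow> R (t, y) = Ft t y $ i" for R D i
    by (rule has_derivative_transform_within_open[OF that(1) open_Q x]) (use that(2) in auto)
  have F1: "DF h $ 1 = rho (u 0 x) *\<^sub>R Dv h" for h
    using uniq[OF near[OF has_derivative_scaleR_zero[OF dr dv' v0']]] flux_rows(1) by simp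
  have F4: "DF h $ 4 = (rho (u 0 x) * enth g (u 0 x)) *\<^sub>R Dv h - tt 0 x *v Dv h - cond g *\<^sub>R Dq h" for h
    using uniq[OF near[OF has_derivative_diff[OF has_derivative_diff[OF
            has_derivative_scaleR_zero[OF has_derivative_mult[OF dr dH] dv' v0']
            has_derivative_matrix_vector_zero[OF dt dv' v0']] has_derivative_scaleR_right[OF dq', of "cond g"]]]] flux_rows(2)
    by simp
  show "F' $ 1 = rho (u 0 x) *\<^sub>R v'" "F' $ 4 = (rho (u 0 x) * enth g (u 0 x)) *\<^sub>R v' - tt 0 x *v v' - cond g *\<^sub>R q'"
    by (simp_all add: F' v' q' F1 F4)
  show "divg (\<lambda>y. Ft 0 y $ 1) x = rho (u 0 x) * divg (vt 0) x"
    unfolding divg_eq[OF xFi] divg_eq[OF xv] F1 by (simp add: algebra_simps)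
  have pdv: "pd i (vt 0) x = Dv (0, axis i 1)" for i by (rule pd_eq[OF xv])
  show "divg (\<lambda>y. Ft 0 y $ 4) x = rho (u 0 x) * enth g (u 0 x) * divg (vt 0) x
        - (\<Sum>i\<in>UNIV. \<Sum>j\<in>UNIV. tt 0 x $ i $ j * pd i (vt 0) x $ j) - cond g * divg (qt 0) x"
    unfolding divg_eq[OF xFi] divg_eq[OF xv] divg_eq[OF xq] F4 pdv
    by (simp add: matrix_vector_mult_def sum_2 algebra_simps)
  have dvi: "((\<lambda>p. rho (u (fst p) (snd p)) * vt (fst p) (snd p) $ i) has_derivative
     (\<lambda>h. rho (u 0 x) * Dv h $ i + frechet_derivative (\<lambda>(t, x). rho (u t x)) (at (0, x)) h * vt 0 x $ i)) (at (0, x))" for i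
    using has_derivative_mult[OF dr bounded_linear.has_derivative[OF bounded_linear_vec_nth dv', of i]] by simp
  have "((\<lambda>p. drag_field \<psi> (fst p) (snd p)) has_derivative (\<lambda>h. \<psi> $ 1 *\<^sub>R (DF h $ 2 - (rho (u 0 x) * vt 0 x $ 1) *\<^sub>R Dv h)
      + \<psi> $ 2 *\<^sub>R (DF h $ 3 - (rho (u 0 x) * vt 0 x $ 2) *\<^sub>R Dv h))) (at (0, x))"
    unfolding drag_field_def
    using has_derivative_scaleR_zero[OF dvi dv' v0']
    by (intro has_derivative_add has_derivative_scaleR_right has_derivative_diff dFi) simp_all
  then have dD: "((\<lambda>p. drag_field \<psi> (fst p) (snd p)) has_derivative (\<lambda>h. \<psi> $ 1 *\<^sub>R DF h $ 2 + \<psi> $ 2 *\<^sub>R DF h $ 3)) (at (0, x))"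
    using v0 by simp
  show "shape_deriv (\<lambda>t. drag_field \<psi> t x) = \<psi> $ 1 *\<^sub>R F' $ 2 + \<psi> $ 2 *\<^sub>R F' $ 3"
    unfolding F' by (rule shape_derivI[OF joint_slices(1)[OF dD]])
  show "divg (drag_field \<psi> 0) x = \<psi> $ 1 * divg (\<lambda>y. Ft 0 y $ 2) x + \<psi> $ 2 * divg (\<lambda>y. Ft 0 y $ 3) x"
    unfolding divg_eq[OF joint_slices(2)[OF dD]] divg_eq[OF xFi] by (simp add: algebra_simps)
qed

end

context adjoint_flow begin

abbreviation "F' x \<equiv> shape_deriv (\<lambda>t. Ft t x)"

lemma F'_C1: "Ck_on (Suc 0) F' M"
  by (rule Ck_on_subset[OF Ck_shape_deriv[OF Ft_C2] M(3)])

lemma F0_C1: "Ck_on (Suc (Suc 0)) (Ft 0) M"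
  by (rule Ck_on_subset[OF slice_0[OF Ft_C2] M(3)])

text \<open>The density that both approaches integrate to zero over the wall. Its last summand is the
  residual of the flow equations, which the variational approach retains.\<close>

definition wall_term :: "real^2 \<Rightarrow> real^2 \<Rightarrow> real" where
  "wall_term x n = (F' x *v n) \<bullet> z x + u1 x \<bullet> (Gz x *v n) + (V x \<bullet> n) * (z x \<bullet> divm (Ft 0) x)"

lemma continuous_on_fst: "continuous_on M f \<Longrightarrow> S \<subseteq> M \<Longrightarrow> continuous_on (S \<times> UNIV) (\<lambda>p. f (fst p))"
  by (rule continuous_on_compose2[of M f]) (auto intro: continuous_intros)

lemma wall_borel: "wall d \<in> sets borel" and far_borel: "farfield d \<in> sets borel"
  using closed_wall closed_far by auto

lemma F'_cont: "continuous_on M F'" and F0_cont: "continuous_on M (Ft 0)"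
  and divm_F0_cont: "continuous_on M (divm (Ft 0))"
  using Ck_on_imp_continuous_on[OF F'_C1] Ck_on_imp_continuous_on[OF F0_C1] C1_continuous_divm[OF F0_C1 order_refl] .

lemma bcont_wall_parts:
  "S \<subseteq> M \<Longrightarrow> bcont S (\<lambda>x n. (F' x *v n) \<bullet> z x)"
  "S \<subseteq> M \<Longrightarrow> bcont S (\<lambda>x n. u1 x \<bullet> (Gz x *v n))"
  "S \<subseteq> M \<Longrightarrow> bcont S (\<lambda>x n. (V x \<bullet> n) * (z x \<bullet> divm (Ft 0) x))"
  "S \<subseteq> M \<Longrightarrow> bcont S wall_term"
proof -
  assume S: "S \<subseteq> M"
  show 1: "bcont S (\<lambda>x n. (F' x *v n) \<bullet> z x)" unfolding bcont_def
    by (intro continuous_intros continuous_on_fst[OF _ S] F'_cont z_cont)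
  show 2: "bcont S (\<lambda>x n. u1 x \<bullet> (Gz x *v n))" unfolding bcont_def
    by (intro continuous_intros continuous_on_fst[OF _ S] u1_cont Gz_cont)
  show 3: "bcont S (\<lambda>x n. (V x \<bullet> n) * (z x \<bullet> divm (Ft 0) x))" unfolding bcont_def
    by (intro continuous_intros continuous_on_fst[OF _ S] V_continuous z_cont divm_F0_cont)
  show "bcont S wall_term" using 1 2 3 unfolding bcont_def wall_term_def by (intro continuous_on_add)
qed

lemma wall_term_split:
  "bint d (wall d) wall_term = bint d (wall d) (\<lambda>x n. (F' x *v n) \<bullet> z x) + bint d (wall d) (\<lambda>x n. u1 x \<bullet> (Gz x *v n))
     + bint d (wall d) (\<lambda>x n. (V x \<bullet> n) * (z x \<bullet> divm (Ft 0) x))"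
proof -
  note b = bcont_wall_parts[OF wall_M]
  have b12: "bcont (wall d) (\<lambda>x n. (F' x *v n) \<bullet> z x + u1 x \<bullet> (Gz x *v n))"
    using b(1,2) unfolding bcont_def by (intro continuous_on_add)
  note add = bint_add[OF disjI1[OF refl] order_refl wall_borel]
  show ?thesis
    unfolding wall_term_def[abs_def] add[OF b12 b(3)] add[OF b(1,2)] ..
qed

text \<open>Test with \<open>z\<close>: the volume terms and the far-field terms are those of the adjoint identity and
  cancel.\<close>

lemma wall_term_from_VSD:
  assumes far: "(LINT x:dom d|lborel. u1 x \<bullet> flux_uT_grad g u0 z x) + (LINT x:dom d|lborel. u1 x \<bullet> divm Gz x) = far_terms"
    and vsd: "VSD g d H V u u1" and zH: "z \<in> H"
  shows "bint d (wall d) wall_term = 0"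
proof -
  let ?P = "\<lambda>x n. ((V x \<bullet> n) *\<^sub>R Ft 0 x) \<bullet> Dm z x"
  have 1: "0 = - (LINT x:dom d|lborel. u1 x \<bullet> flux_uT_grad g u0 z x) - bint d (wall d) ?P
       - (LINT x:dom d|lborel. u1 x \<bullet> divm Gz x)
       + (bint d (wall d) (\<lambda>x n. u1 x \<bullet> (Gz x *v n)) + bint d (farfield d) (\<lambda>x n. u1 x \<bullet> (Gz x *v n)))
       + bint d (farfield d) (\<lambda>x n. u1 x \<bullet> n_flux_uT g u0 z x n)
       - bint d (farfield d) (\<lambda>x n. Dm u1 x \<bullet> n_visc_GT g u0 z x n)
       + bint d (wall d) (\<lambda>x n. (F' x *v n) \<bullet> z x)
       + bint d (wall d) (\<lambda>x n. (V x \<bullet> n) * divg (\<lambda>y. z y v* Ft 0 y) x)"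
    using vsd zH unfolding VSD_def bdry_minus_wall bint_bdry_split by blast
  have "bint d (wall d) (\<lambda>x n. (V x \<bullet> n) * divg (\<lambda>y. z y v* Ft 0 y) x)
     = bint d (wall d) (\<lambda>x n. (V x \<bullet> n) * (z x \<bullet> divm (Ft 0) x) + ?P x n)"
  proof (rule bint_cong, unfold on_bdry_def, intro ballI allI impI)
    fix \<gamma> and s :: real assume "\<gamma> s \<in> wall d"
    then have x: "\<gamma> s \<in> M" using wall_M by blast
    show "(V (\<gamma> s) \<bullet> curve_normal \<gamma> s) * divg (\<lambda>y. z y v* Ft 0 y) (\<gamma> s)
        = (V (\<gamma> s) \<bullet> curve_normal \<gamma> s) * (z (\<gamma> s) \<bullet> divm (Ft 0) (\<gamma> s)) + ?P (\<gamma> s) (curve_normal \<gamma> s)"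
      unfolding divg_product[OF Ck_on_has_derivative[OF zC x] Ck_on_has_derivative[OF F0_C1 x]]
      by (simp add: distrib_left)
  qed
  also have "\<dots> = bint d (wall d) (\<lambda>x n. (V x \<bullet> n) * (z x \<bullet> divm (Ft 0) x)) + bint d (wall d) ?P"
  proof (rule bint_add[OF disjI1[OF refl] order_refl wall_borel bcont_wall_parts(3)[OF wall_M]])
    have "continuous_on M (\<lambda>x. \<chi> i j. pd j z x $ i)"
      by (intro continuous_on_vec_lambda continuous_intros continuous_on_component pd_z_cont)
    then have "continuous_on M (Dm z)" by (rule continuous_on_eq) (simp add: vec_eq_iff Dm_nth_pd)
    then show "bcont (wall d) ?P" unfolding bcont_def
      by (intro continuous_intros continuous_on_fst[OF _ wall_M] V_continuous F0_cont)
  qed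
  finally show ?thesis using 1 far unfolding wall_term_split far_terms_def by linarith
qed

text \<open>The field \<open>z \<cdot> F' + u' \<cdot> (G\<^sup>T \<nabla>z)\<close> has the divergence \<open>u' \<cdot> (adjoint operator applied to z)\<close>,
  as the terms with \<open>\<nabla>u'\<close> cancel. Its flux through the whole boundary therefore equals the
  far-field terms, which leaves nothing on the wall.\<close>

lemma wall_term_from_PSD:
  assumes far: "(LINT x:dom d|lborel. u1 x \<bullet> flux_uT_grad g u0 z x) + (LINT x:dom d|lborel. u1 x \<bullet> divm Gz x) = far_terms"
    and psd: "PSD g d u0 u1" and div0: "\<And>x. x \<in> wall d \<Longrightarrow> divm (Ft 0) x = 0"
  shows "bint d (wall d) wall_term = 0"
proof -
  define X where "X x = z x v* F' x + u1 x v* Gz x" for x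
  have prodC: "Ck_on (Suc 0) (\<lambda>x. a x v* B x) M" if "Ck_on (Suc 0) a M" "Ck_on (Suc 0) B M"
    for a :: "real^2 \<Rightarrow> real^4" and B :: "real^2 \<Rightarrow> real^2^4"
  proof -
    have "(\<lambda>x. a x v* B x) = (\<lambda>x. \<Sum>i\<in>UNIV. a x $ i *\<^sub>R B x $ i)"
      by (simp add: vector_matrix_mult_def vec_eq_iff mult.commute fun_eq_iff)
    then show ?thesis using that by (simp only:) (intro Ck_on_sum Ck_on_scaleR Ck_on_nth M)
  qed
  have XC: "Ck_on (Suc 0) X M"
    unfolding X_def[abs_def]
    by (intro Ck_on_add M prodC Ck_on_SucD[OF zC] F'_C1 Ck_on_SucD[OF u1C] Gz_C1)
  have F'lin: "F' x = lin_flux g u0 u1 x" if "x \<in> M" for x by (rule flux_linearised[OF in0[OF that]])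
  have div: "divg X x = u1 x \<bullet> flux_uT_grad g u0 z x + u1 x \<bullet> divm Gz x" if x: "x \<in> dom d" for x
  proof -
    have xM: "x \<in> M" using x dom_M by blast
    note dz = Ck_on_has_derivative[OF zC xM] and dF = Ck_on_has_derivative[OF F'_C1 xM]
      and du = Ck_on_has_derivative[OF u1C xM] and dG = Ck_on_has_derivative[OF Gz_C1 xM]
    have dlin: "(lin_flux g u0 u1 has_derivative frechet_derivative F' (at x)) (at x)"
      by (rule has_derivative_transform_within_open[OF dF M(1) xM]) (rule F'lin)
    have "divm F' x = divm (lin_flux g u0 u1) x" by (simp add: divm_eq[OF dF] divm_eq[OF dlin])
    then have dF0: "divm F' x = 0" using psd x by (simp add: PSD_def)
    have dsum: "divg X x = divg (\<lambda>y. z y v* F' y) x + divg (\<lambda>y. u1 y v* Gz y) x"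
    proof -
      note 1 = Ck_on_has_derivative[OF prodC[OF Ck_on_SucD[OF zC] F'_C1] xM]
      note 2 = Ck_on_has_derivative[OF prodC[OF Ck_on_SucD[OF u1C] Gz_C1] xM]
      have 3: "(X has_derivative (\<lambda>h. frechet_derivative (\<lambda>x. z x v* F' x) (at x) h + frechet_derivative (\<lambda>x. u1 x v* Gz x) (at x) h)) (at x)"
        unfolding X_def[abs_def] by (rule has_derivative_add[OF 1 2])
      show ?thesis unfolding divg_eq[OF 1] divg_eq[OF 2] divg_eq[OF 3] by simp
    qed
    show ?thesis
      unfolding dsum divg_product[OF dz dF] divg_product[OF du dG] dF0 F'lin[OF xM]
        lin_flux_grad[of u0 x, OF u0pos[OF xM]]
      by (simp add: inner_commute[of "Gz x"])
  qed
  have ia: "set_integrable lborel (dom d) (\<lambda>x. u1 x \<bullet> flux_uT_grad g u0 z x)"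
    by (intro dom_integrable continuous_intros u1_cont flux_uT_grad_cont)
  have ib: "set_integrable lborel (dom d) (\<lambda>x. u1 x \<bullet> divm Gz x)"
    by (intro dom_integrable continuous_intros u1_cont divm_Gz_cont)
  have "(\<Sum>\<gamma>\<leftarrow>curves d. flux_int \<gamma> X) = integral (dom d) (divg X)"
    by (rule integral_unique[symmetric, OF divergence_theorem[OF reg k1 M(1,2) XC]])
  also have "\<dots> = integral (dom d) (\<lambda>x. u1 x \<bullet> flux_uT_grad g u0 z x + u1 x \<bullet> divm Gz x)"
    by (rule integral_cong) (rule div)
  also have "\<dots> = far_terms"
    using set_borel_integral_eq_integral(2)[OF set_integral_add(1)[OF ia ib]] set_integral_add(2)[OF ia ib] far by simp
  finally have 1: "bint d (bdry d) (\<lambda>x n. X x \<bullet> n) = far_terms"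
    using bint_flux_bdry[OF continuous_on_subset[OF Ck_on_imp_continuous_on[OF XC] bdry_M]] by simp
  have Xn: "X x \<bullet> n = (F' x *v n) \<bullet> z x + u1 x \<bullet> (Gz x *v n)" for x n
    by (simp add: X_def inner_add_left dot_lmul_matrix inner_commute[of "z x"])
  note b = bcont_wall_parts(1,2)
  have w: "bint d (wall d) (\<lambda>x n. X x \<bullet> n) = bint d (wall d) (\<lambda>x n. (F' x *v n) \<bullet> z x) + bint d (wall d) (\<lambda>x n. u1 x \<bullet> (Gz x *v n))"
    unfolding Xn by (rule bint_add[OF disjI1[OF refl] order_refl wall_borel b[OF wall_M]])
  have f: "bint d (farfield d) (\<lambda>x n. X x \<bullet> n) = bint d (farfield d) (\<lambda>x n. (F' x *v n) \<bullet> z x) + bint d (farfield d) (\<lambda>x n. u1 x \<bullet> (Gz x *v n))"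
    unfolding Xn by (rule bint_add[OF disjI2[OF refl] order_refl far_borel b[OF far_M]])
  have nf: "bcont (farfield d) (\<lambda>x n. u1 x \<bullet> n_flux_uT g u0 z x n)"
    unfolding bcont_def n_flux_uT_def
    by (simp, intro continuous_intros continuous_on_fst[OF _ far_M] flux_u_cont u1_cont z_cont)
  have eqf: "Dm u1 x \<bullet> n_visc_GT g u0 z x n = u1 x \<bullet> n_flux_uT g u0 z x n - (F' x *v n) \<bullet> z x" if "x \<in> farfield d" for x n
  proof -
    have "x \<in> M" using that far_M by blast
    then show ?thesis using lin_flux_normal[of u0 x g u1 n z, OF u0pos] F'lin by simp
  qed
  have "bint d (farfield d) (\<lambda>x n. Dm u1 x \<bullet> n_visc_GT g u0 z x n)
      = bint d (farfield d) (\<lambda>x n. u1 x \<bullet> n_flux_uT g u0 z x n - (F' x *v n) \<bullet> z x)"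
    by (rule bint_cong) (auto simp: on_bdry_def eqf)
  also have "\<dots> = bint d (farfield d) (\<lambda>x n. u1 x \<bullet> n_flux_uT g u0 z x n) - bint d (farfield d) (\<lambda>x n. (F' x *v n) \<bullet> z x)"
    by (rule bint_diff[OF disjI2[OF refl] order_refl far_borel nf b(1)[OF far_M]])
  finally have 2: "far_terms = bint d (farfield d) (\<lambda>x n. X x \<bullet> n)"
    unfolding f far_terms_def by simp
  have "bint d (wall d) (\<lambda>x n. (V x \<bullet> n) * (z x \<bullet> divm (Ft 0) x)) = bint d (wall d) (\<lambda>x n. 0)"
    by (rule bint_cong) (auto simp: on_bdry_def div0)
  then show ?thesis using 1 2 w unfolding wall_term_split bint_bdry_split by (simp add: bint_0)
qed

text \<open>At zero velocity the viscous flux of \<open>u' \<otimes> n\<close> consists of the stress of \<open>v' \<otimes> n\<close> and the heat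
  flux \<open>\<kappa> T' n\<close>; moving the symmetric stress operator to \<open>\<nabla>z\<close> produces \<open>\<Sigma>\<close>.\<close>

lemma wall_pairing:
  assumes x: "x \<in> M" and v0: "vel (u0 x) = 0"
  shows "u1 x \<bullet> (Gz x *v n) = shape_deriv (\<lambda>t. vt t x) \<bullet> (n v* stress (visc g) (Dm (z23 z) x))
    + cond g * shape_deriv (\<lambda>t. Tt t x) * (n \<bullet> grad (\<lambda>y. z y $ 4) x)"
proof -
  define v' where "v' = shape_deriv (\<lambda>t. vt t x)"
  define T' where "T' = shape_deriv (\<lambda>t. Tt t x)"
  have v': "v' = frechet_derivative vel (at (u0 x)) (u1 x)"
    unfolding v'_def by (rule shape_derivI[OF along_t[OF in0[OF x] Ck_vel]])
  have T': "T' = frechet_derivative (temp g) (at (u0 x)) (u1 x)"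
    unfolding T'_def by (rule shape_derivI[OF along_t[OF in0[OF x] Ck_temp]])
  note dz = Ck_on_has_derivative[OF zC x]
  have lint: "linear (frechet_derivative (temp g) (at (u0 x)))"
    using has_derivative_linear[OF temp_derivative[OF u0pos[OF x]]] .
  have tg: "temp_grad g (u0 x) (outer (u1 x) n) $ l = n $ l * T'" for l
  proof -
    have "column l (outer (u1 x) n) = n $ l *\<^sub>R u1 x" by (simp add: column_def outer_def vec_eq_iff mult.commute)
    then show ?thesis by (simp add: temp_grad_def T' linear_cmul[OF lint])
  qed
  have "A ** outer h n = (\<chi> i j. (A *v h) $ i * n $ j)" for A :: "real^4^2" and h
    by (simp add: vec_eq_iff matrix_matrix_mult_def outer_def matrix_vector_mult_def sum_distrib_right mult.assoc)
  then have "Dm vel (u0 x) ** outer (u1 x) n = (\<chi> i j. v' $ i * n $ j)"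
    using Dm_mult[OF vel_derivative[OF u0pos[OF x]], of "u1 x"] by (simp add: v')
  then have ta: "tau g (u0 x) (outer (u1 x) n) = stress (visc g) (\<chi> i j. v' $ i * n $ j)" by (simp add: tau_def)
  have fv: "fv g k (u0 x) (outer (u1 x) n) = vector [0, stress (visc g) (\<chi> i j. v' $ i * n $ j) $ k $ 1,
      stress (visc g) (\<chi> i j. v' $ i * n $ j) $ k $ 2, cond g * (n $ k * T')]" for k
    by (simp add: fv_def ta tg v0)
  have dzi: "((\<lambda>y. z y $ i) has_derivative (\<lambda>h. frechet_derivative z (at x) h $ i)) (at x)" for i
    by (rule bounded_linear.has_derivative[OF bounded_linear_vec_nth dz])
  have d23: "(z23 z has_derivative (\<lambda>h. vector [frechet_derivative z (at x) h $ 2, frechet_derivative z (at x) h $ 3])) (at x)"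
  proof -
    have eq: "vector [a, b] = a *\<^sub>R axis 1 1 + b *\<^sub>R (axis 2 1 :: real^2)" for a b
      by (simp add: vec_eq_2 axis_def)
    show ?thesis unfolding z23_def[abs_def] eq
      by (intro has_derivative_add has_derivative_scaleR_left dzi)
  qed
  have p23: "Dm (z23 z) x $ 1 $ k = pd k z x $ 2" "Dm (z23 z) x $ 2 $ k = pd k z x $ 3" for k
    by (simp_all add: Dm_nth_pd pd_eq[OF d23] pd_eq[OF dz])
  have p4: "grad (\<lambda>y. z y $ 4) x $ k = pd k z x $ 4" for k
    by (simp add: grad_def pd_eq[OF dzi] pd_eq[OF dz])
  show ?thesis
    unfolding inner_visc_GT_grad[of u0 x, OF u0pos[OF x]] fv v'_def[symmetric] T'_def[symmetric]
    by (simp add: sum_2 sum_4 inner_vec_def vector_4 vector_matrix_mult_def stress_nth trace_def p23 p4 algebra_simps)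
qed

end

section \<open>The Hadamard formula\<close>

locale hadamard = adjoint_flow +
  fixes C :: real and \<psi> :: "real^2" and TW :: "real^2 \<Rightarrow> real" and NW :: "(real^2) set"
  assumes C: "C \<noteq> 0"
    and Vn: "on_bdry d (wall d) (\<lambda>x n. V x = (V x \<bullet> n) *\<^sub>R n)"
    and TW: "open NW" "wall d \<subseteq> NW" "Ck_on (Suc 0) TW NW"
    and v_wall: "\<And>t. 0 \<le> t \<Longrightarrow> t < \<epsilon> \<Longrightarrow> on_bdry (perturb V t d) (wall (perturb V t d)) (\<lambda>x n. vt t x = 0)"
    and q_adia: "\<And>t. 0 \<le> t \<Longrightarrow> t < \<epsilon> \<Longrightarrow> on_bdry (perturb V t d) (adia (perturb V t d)) (\<lambda>x n. qt t x \<bullet> n = 0)"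
    and T_iso: "\<And>t. 0 \<le> t \<Longrightarrow> t < \<epsilon> \<Longrightarrow> on_bdry (perturb V t d) (iso (perturb V t d)) (\<lambda>x n. Tt t x = TW x)"
    and z_bc: "adjoint_conditions C \<psi> d z"
begin

lemma wall_curve_point: "x \<in> wall d \<Longrightarrow> \<exists>\<gamma>\<in>set (curves d). \<exists>s. x = \<gamma> s"
  using bdry_eq by (force simp: bdry_def)

lemma v_zero: "x \<in> wall d \<Longrightarrow> vel (u0 x) = 0"
  using wall_curve_point[of x] v_wall[of 0] \<epsilon> unfolding perturb_0 on_bdry_def by auto

lemma z4_iso: "x \<in> iso d \<Longrightarrow> z x $ 4 = 0"
  using wall_curve_point[of x] z_bc unfolding adjoint_conditions_def on_bdry_def wall_def by auto

lemma z23_wall: "x \<in> wall d \<Longrightarrow> z x $ 2 = \<psi> $ 1 / C \<and> z x $ 3 = \<psi> $ 2 / C"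
proof -
  assume "x \<in> wall d"
  then have "z23 z x = (1 / C) *\<^sub>R \<psi>"
    using wall_curve_point[of x] z_bc unfolding adjoint_conditions_def on_bdry_def by auto
  then show ?thesis by (simp add: z23_def vec_eq_2)
qed

text \<open>Since \<open>v = 0\<close> on every perturbed wall and \<open>V\<close> is normal, \<open>v' = - (V \<cdot> n) \<partial>\<^sub>n v\<close>.\<close>

lemma v_transport:
  assumes \<gamma>: "\<gamma> \<in> set (curves d)" "\<gamma> s \<in> wall d"
  shows "shape_deriv (\<lambda>t. vt t (\<gamma> s)) = - (V (\<gamma> s) \<bullet> curve_normal \<gamma> s) *\<^sub>R normal_deriv (vt 0) (\<gamma> s) (curve_normal \<gamma> s)"
proof -
  have C1: "Ck_on (Suc 0) (\<lambda>(t, x). vt t x) Q"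
    by (rule Ck_on_le[OF Ck_along[OF Ck_vel]]) simp
  have z: "vt t (\<gamma> s + t *\<^sub>R V (\<gamma> s)) = 0" if "0 \<le> t" "t < \<epsilon>" for t
    by (rule on_bdry_pert[OF v_wall[OF that, unfolded wall_pert] \<gamma>])
  have x: "\<gamma> s \<in> N" using \<gamma>(2) wall_N by blast
  have lin: "linear (frechet_derivative (vt 0) (at (\<gamma> s)))"
    using has_derivative_linear[OF Ck_on_has_derivative[OF slice_0[OF C1] x]] .
  have "V (\<gamma> s) = (V (\<gamma> s) \<bullet> curve_normal \<gamma> s) *\<^sub>R curve_normal \<gamma> s"
    using Vn \<gamma> by (simp add: on_bdry_def)
  then have "frechet_derivative (vt 0) (at (\<gamma> s)) (V (\<gamma> s))
      = (V (\<gamma> s) \<bullet> curve_normal \<gamma> s) *\<^sub>R frechet_derivative (vt 0) (at (\<gamma> s)) (curve_normal \<gamma> s)"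
    using linear_cmul[OF lin] by metis
  moreover have "shape_deriv (\<lambda>t. vt t (\<gamma> s)) = - frechet_derivative (vt 0) (at (\<gamma> s)) (V (\<gamma> s))"
    by (rule wall_zero_derivative[OF C1 \<gamma>(2) z])
  ultimately show ?thesis unfolding normal_deriv_def by simp
qed

lemma T_transport:
  assumes \<gamma>: "\<gamma> \<in> set (curves d)" "\<gamma> s \<in> iso d"
  shows "shape_deriv (\<lambda>t. Tt t (\<gamma> s)) = (V (\<gamma> s) \<bullet> curve_normal \<gamma> s) * normal_deriv (\<lambda>y. TW y - Tt 0 y) (\<gamma> s) (curve_normal \<gamma> s)"
proof -
  let ?x = "\<gamma> s" and ?n = "curve_normal \<gamma> s"
  have wx: "?x \<in> wall d" using \<gamma>(2) by (simp add: wall_def)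
  have in0: "(0, ?x) \<in> Q" using wx wall_N \<epsilon> by auto
  have C1: "Ck_on (Suc 0) (\<lambda>(t, x). Tt t x) Q"
    by (rule Ck_on_le[OF Ck_along[OF Ck_temp]]) simp
  note sx = slice_x[OF C1 open_Q in0]
  have dTW: "(TW has_derivative frechet_derivative TW (at ?x)) (at ?x)"
    using Ck_on_has_derivative[OF TW(3)] TW(2) wx by blast
  have linTW: "linear (frechet_derivative TW (at ?x))" using has_derivative_linear[OF dTW] .
  have 1: "((\<lambda>t. Tt t (?x + t *\<^sub>R V ?x)) has_vector_derivative frechet_derivative (\<lambda>(t, x). Tt t x) (at (0, ?x)) (1, V ?x)) (at 0)"
    using moving_point[OF C1 open_Q, of 0 ?x "V ?x" UNIV] in0 by simp
  have 2: "((\<lambda>t. TW (?x + t *\<^sub>R V ?x)) has_vector_derivative frechet_derivative TW (at ?x) (V ?x)) (at 0)"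
  proof -
    have l: "((\<lambda>t. ?x + t *\<^sub>R V ?x) has_derivative (\<lambda>h. h *\<^sub>R V ?x)) (at 0)" by (auto intro!: derivative_eq_intros)
    have dTW': "(TW has_derivative frechet_derivative TW (at ?x)) (at (?x + 0 *\<^sub>R V ?x))" using dTW by simp
    show ?thesis
      using has_derivative_compose[OF l dTW'] unfolding has_vector_derivative_def linear_cmul[OF linTW] .
  qed
  have eq: "frechet_derivative (\<lambda>(t, x). Tt t x) (at (0, ?x)) (1, V ?x) - frechet_derivative TW (at ?x) (V ?x) = 0"
  proof (rule right_constant_derivative[OF has_vector_derivative_diff[OF 1 2] \<epsilon>])
    fix t assume t: "0 \<le> t" "t < \<epsilon>"
    have "Tt t (?x + t *\<^sub>R V ?x) = TW (?x + t *\<^sub>R V ?x)"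
      by (rule on_bdry_pert[OF T_iso[OF t, unfolded iso_pert] \<gamma>])
    then show "Tt t (?x + t *\<^sub>R V ?x) - TW (?x + t *\<^sub>R V ?x) = 0" by simp
  qed
  have d: "((\<lambda>y. TW y - Tt 0 y) has_derivative (\<lambda>h. frechet_derivative TW (at ?x) h
      - frechet_derivative (\<lambda>(t, x). Tt t x) (at (0, ?x)) (0, h))) (at ?x)"
    by (rule has_derivative_diff[OF dTW sx])
  have lin: "linear (frechet_derivative (\<lambda>y. TW y - Tt 0 y) (at ?x))"
    unfolding frechet_derivative_at[OF d, symmetric] by (rule has_derivative_linear[OF d])
  have "V ?x = (V ?x \<bullet> ?n) *\<^sub>R ?n"
    using Vn \<gamma>(1) wx by (simp add: on_bdry_def)
  then have "frechet_derivative (\<lambda>y. TW y - Tt 0 y) (at ?x) (V ?x)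
      = (V ?x \<bullet> ?n) *\<^sub>R frechet_derivative (\<lambda>y. TW y - Tt 0 y) (at ?x) ?n"
    using linear_cmul[OF lin] by metis
  then show ?thesis
    using eq DY_split[OF C1 open_Q in0, of "V ?x"] fun_cong[OF frechet_derivative_at[OF d], of "V ?x"]
    unfolding shape_deriv_eq[OF C1 open_Q in0] normal_deriv_def by simp
qed

text \<open>The integrands of the Hadamard formula, followed by three auxiliary ones: \<open>b_heat\<close>
  and \<open>b_temp\<close> contain boundary values of the linearised state, which the wall conditions trade
  for \<open>b_adia\<close> and \<open>b_iso\<close>, and \<open>b_drag\<close> is the density of the shape derivative.\<close>

definition "b_visc x n = (V x \<bullet> n) * (normal_deriv (vt 0) x n \<bullet> (n v* stress (visc g) (Dm (z23 z) x)))"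
definition "b_conv x n = (V x \<bullet> n) * (normal_deriv (vt 0) x n \<bullet>
      ((rho (u0 x) * z x $ 1) *\<^sub>R n + z x $ 4 *\<^sub>R ((rho (u0 x) * enth g (u0 x)) *\<^sub>R n - tt 0 x *v n)))"
definition "b_iso x n = (V x \<bullet> n) * normal_deriv (\<lambda>y. TW y - Tt 0 y) x n * cond g * (n \<bullet> grad (\<lambda>y. z y $ 4) x)"
definition "b_adia x n = (V x \<bullet> n) * (normal_deriv2 (Tt 0) x n * cond g * z x $ 4
      + div_tan (\<lambda>y. (cond g * z y $ 4) *\<^sub>R qt 0 y) x n)"
definition "b_mass x n = (V x \<bullet> n) * rho (u0 x) * divg (vt 0) x * z x $ 1"
definition "b_energy x n = (V x \<bullet> n) * (rho (u0 x) * enth g (u0 x) * divg (vt 0) x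
      - (\<Sum>i\<in>UNIV. \<Sum>j\<in>UNIV. tt 0 x $ i $ j * pd i (vt 0) x $ j) - cond g * divg (qt 0) x) * z x $ 4"
definition "b_heat x n = cond g * z x $ 4 * (shape_deriv (\<lambda>t. qt t x) \<bullet> n)"
definition "b_temp x n = cond g * shape_deriv (\<lambda>t. Tt t x) * (n \<bullet> grad (\<lambda>y. z y $ 4) x)"
definition "b_drag x n = 1 / C * (shape_deriv (\<lambda>t. drag_field \<psi> t x) \<bullet> n + (V x \<bullet> n) * divg (drag_field \<psi> 0) x)"

text \<open>The adjoint values \<open>z\<^sub>2\<^sub>,\<^sub>3 = \<psi>/C\<close> make the momentum part of \<open>wall_term\<close> equal to \<open>b_drag\<close>,
  including its divergence term; what is left over comes from the mass and energy rows and from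
  the pairing with \<open>\<Sigma>\<close>.\<close>

lemma wall_identity:
  assumes \<gamma>: "\<gamma> \<in> set (curves d)" "\<gamma> s \<in> wall d"
  defines "x \<equiv> \<gamma> s" and "n \<equiv> curve_normal \<gamma> s"
  shows "b_drag x n = wall_term x n + b_visc x n + b_conv x n + b_heat x n - b_temp x n - b_mass x n - b_energy x n"
proof -
  have xM: "x \<in> M" using \<gamma>(2) wall_M by (auto simp: x_def)
  have v0: "vel (u0 x) = 0" using v_zero \<gamma>(2) by (simp add: x_def)
  have zw: "z x $ 2 = \<psi> $ 1 / C" "z x $ 3 = \<psi> $ 2 / C" using z23_wall \<gamma>(2) by (auto simp: x_def)
  define \<nu> where "\<nu> = V x \<bullet> n"
  define w where "w = normal_deriv (vt 0) x n"
  have v': "shape_deriv (\<lambda>t. vt t x) = - \<nu> *\<^sub>R w"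
    using v_transport[OF \<gamma>] by (simp add: \<nu>_def w_def x_def n_def)
  note F = wall_flux[OF in0[OF xM] v0]
  have dm: "divm (Ft 0) x $ i = divg (\<lambda>y. Ft 0 y $ i) x" for i
    by (rule divm_nth[OF Ck_on_has_derivative[OF F0_C1 xM]])
  have Fz: "(F' x *v n) \<bullet> z x = z x $ 1 * (F' x $ 1 \<bullet> n) + (\<psi> $ 1 * (F' x $ 2 \<bullet> n) + \<psi> $ 2 * (F' x $ 3 \<bullet> n)) / C + z x $ 4 * (F' x $ 4 \<bullet> n)"
    unfolding matrix_vector_inner_4 by (simp add: sum_4 zw add_divide_distrib)
  have dz: "z x \<bullet> divm (Ft 0) x = z x $ 1 * divg (\<lambda>y. Ft 0 y $ 1) x + divg (drag_field \<psi> 0) x / C + z x $ 4 * divg (\<lambda>y. Ft 0 y $ 4) x"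
    unfolding F(6) by (simp add: inner_vec_def sum_4 dm zw add_divide_distrib)
  have t: "(tt 0 x *v w) \<bullet> n = w \<bullet> (tt 0 x *v n)"
    using tt_sym[of 0 x 1 2] by (simp add: inner_2 matrix_vector_mult_def sum_2 algebra_simps)
  have sc: "tt 0 x *v (c *\<^sub>R w) = c *\<^sub>R (tt 0 x *v w)" for c
    by (simp add: matrix_vector_mult_scaleR)
  have E: "wall_term x n = - \<nu> * rho (u0 x) * z x $ 1 * (w \<bullet> n) + (shape_deriv (\<lambda>t. drag_field \<psi> t x) \<bullet> n) / C
     + z x $ 4 * (- \<nu> * (rho (u0 x) * enth g (u0 x)) * (w \<bullet> n) + \<nu> * (w \<bullet> (tt 0 x *v n)) - cond g * (shape_deriv (\<lambda>t. qt t x) \<bullet> n))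
     - b_visc x n + b_temp x n + \<nu> * divg (drag_field \<psi> 0) x / C + b_mass x n + b_energy x n"
    unfolding wall_term_def Fz dz wall_pairing[OF xM v0] F(1-5) v' sc \<nu>_def[symmetric]
      b_visc_def b_temp_def b_mass_def b_energy_def w_def[symmetric]
    by (simp add: inner_diff_left inner_add_left t algebra_simps)
  show ?thesis
    unfolding E b_drag_def b_conv_def b_heat_def \<nu>_def[symmetric] w_def[symmetric]
    using C by (simp add: inner_diff_right inner_add_right field_simps)
qed

lemma vt0_C: "Ck_on (Suc (Suc (Suc 0))) (vt 0) M"
  by (rule Ck_u0[OF Ck_vel])

lemma Dm_cont:
  fixes Y :: "real^2 \<Rightarrow> real^'m"
  assumes "Ck_on (Suc m) Y M" shows "continuous_on M (Dm Y)"
proof -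
  have "continuous_on M (\<lambda>x. \<chi> i j. frechet_derivative Y (at x) (axis j 1) $ i)"
    by (intro continuous_on_vec_lambda continuous_on_component Ck_on_imp_continuous_on[OF Ck_on_derivative[OF assms]])
  then show ?thesis by (rule continuous_on_eq) (simp add: vec_eq_iff Dm_nth)
qed

lemma normal_deriv_cont:
  assumes "Ck_on (Suc 0) Y M"
  shows "continuous_on (wall d \<times> UNIV) (\<lambda>p. normal_deriv Y (fst p) (snd p))"
  unfolding normal_deriv_def
  by (rule Ck_on_continuous_derivative[OF assms]) (use wall_M in \<open>auto intro!: continuous_intros\<close>)

lemma z4_C: "Ck_on (Suc (Suc 0)) (\<lambda>y. z y $ 4) M"
  by (rule Ck_on_nth[OF M(1) zC])

lemma grad_cont:
  assumes "Ck_on (Suc m) Y M" shows "continuous_on M (grad Y)"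
  unfolding grad_def[abs_def] pd_def
  by (intro continuous_on_vec_lambda Ck_on_imp_continuous_on[OF Ck_on_derivative[OF assms]])

lemma qt0_C: "Ck_on (Suc (Suc 0)) (qt 0) M"
  by (rule Ck_on_subset[OF slice_0[OF qt_C2] M(3)])

lemma tt0_cont: "continuous_on M (tt 0)"
  by (rule Ck_on_imp_continuous_on[OF Ck_on_subset[OF slice_0[OF tt_C2] M(3)]])

lemma z23_C: "Ck_on (Suc (Suc 0)) (z23 z) M"
  unfolding z23_def[abs_def] by (intro Ck_on_vector2 Ck_on_nth M zC)

lemma rho_cont: "continuous_on M (\<lambda>x. rho (u0 x))" and enth_cont: "continuous_on M (\<lambda>x. enth g (u0 x))"
  using Ck_on_imp_continuous_on[OF Ck_u0[OF Ck_rho]] Ck_on_imp_continuous_on[OF Ck_u0[OF Ck_enth]] .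

lemma W_C: "Ck_on (Suc 0) (\<lambda>y. (cond g * z y $ 4) *\<^sub>R qt 0 y) M"
  by (intro Ck_on_scaleR Ck_on_mult Ck_on_const M Ck_on_SucD[OF z4_C] Ck_on_SucD[OF qt0_C])

lemma integrands_bcont:
  "bcont (wall d) b_visc" "bcont (wall d) b_conv" "bcont (wall d) b_heat" "bcont (wall d) b_temp"
  "bcont (wall d) b_mass" "bcont (wall d) b_energy" "bcont (wall d) b_adia"
proof -
  note c = continuous_on_fst[OF _ wall_M]
  note nd = normal_deriv_cont[OF Ck_on_le[OF vt0_C, of "Suc 0", simplified]]
  have st: "continuous_on M (\<lambda>x. stress (visc g) (Dm (z23 z) x))"
    using stress_linear linear_conv_bounded_linear bounded_linear.continuous_on[OF _ Dm_cont[OF z23_C]] by blast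
  have sq: "continuous_on M (\<lambda>x. shape_deriv (\<lambda>t. qt t x))"
    by (rule Ck_on_imp_continuous_on[OF Ck_on_subset[OF Ck_shape_deriv[OF qt_C2] M(3)]])
  have sT: "continuous_on M (\<lambda>x. shape_deriv (\<lambda>t. Tt t x))"
    by (rule Ck_on_imp_continuous_on[OF Ck_on_subset[OF Ck_shape_deriv[OF Ck_along[OF Ck_temp]] M(3)]])
  have pdv: "continuous_on M (pd i (vt 0))" for i
    unfolding pd_def[abs_def] by (rule Ck_on_imp_continuous_on[OF Ck_on_derivative[OF vt0_C]])
  show "bcont (wall d) b_visc" unfolding bcont_def b_visc_def
    by (intro continuous_intros nd c[OF st] c V_continuous)
  show "bcont (wall d) b_conv" unfolding bcont_def b_conv_def
    by (intro continuous_intros nd c[OF tt0_cont] c[OF rho_cont] c[OF enth_cont] c[OF z_cont] c V_continuous)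
  show "bcont (wall d) b_heat" unfolding bcont_def b_heat_def
    by (intro continuous_intros c[OF sq] c[OF z_cont])
  show "bcont (wall d) b_temp" unfolding bcont_def b_temp_def
    by (intro continuous_intros c[OF sT] c[OF grad_cont[OF z4_C]])
  show "bcont (wall d) b_mass" unfolding bcont_def b_mass_def
    by (intro continuous_intros c[OF rho_cont] c[OF z_cont] c[OF C1_continuous_divg[OF vt0_C order_refl]] c V_continuous)
  show "bcont (wall d) b_energy" unfolding bcont_def b_energy_def
    by (intro continuous_intros c[OF rho_cont] c[OF enth_cont] c[OF z_cont] c[OF tt0_cont] c[OF pdv]
        c[OF C1_continuous_divg[OF vt0_C order_refl]] c[OF C1_continuous_divg[OF qt0_C order_refl]] c V_continuous)
  show "bcont (wall d) b_adia" unfolding bcont_def b_adia_def normal_deriv2_def div_tan_def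
    by (intro continuous_intros c[OF Dm_cont[OF qt0_C]] c[OF z_cont] c[OF Dm_cont[OF W_C]]
        c[OF C1_continuous_divg[OF W_C order_refl]] c V_continuous)
qed

lemma adia_heat: "bint d (adia d) b_heat = - bint d (adia d) b_adia"
proof -
  have adw: "adia d \<subseteq> wall d" by (auto simp: wall_def)
  have mC: "Ck_on (Suc 0) (\<lambda>y. cond g * z y $ 4) M"
    by (intro Ck_on_mult Ck_on_const M Ck_on_SucD[OF z4_C])
  have "bint d (adia d) (\<lambda>x n. cond g * z x $ 4 * (shape_deriv (\<lambda>t. qt t x) \<bullet> n)
       + (V x \<bullet> n) * (cond g * z x $ 4 * ((Dm (qt 0) x *v n) \<bullet> n) + div_tan (\<lambda>y. (cond g * z y $ 4) *\<^sub>R qt 0 y) x n)) = 0"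
    by (rule adiabatic_by_parts[OF Ck_on_SucD[OF qt_C2] mC M(1) wall_M Vn _ q_adia]) (simp add: z4_iso)
  moreover have "(\<lambda>x n. cond g * z x $ 4 * (shape_deriv (\<lambda>t. qt t x) \<bullet> n)
       + (V x \<bullet> n) * (cond g * z x $ 4 * ((Dm (qt 0) x *v n) \<bullet> n) + div_tan (\<lambda>y. (cond g * z y $ 4) *\<^sub>R qt 0 y) x n))
       = (\<lambda>x n. b_heat x n + b_adia x n)"
    unfolding b_heat_def b_adia_def normal_deriv2_def by (simp add: fun_eq_iff mult.commute mult.left_commute)
  ultimately show ?thesis
    using bint_add[OF disjI1[OF refl] adw adia_borel integrands_bcont(3,7)] by simp
qed

lemma bint_zero_on:
  assumes "\<And>\<gamma> s. \<gamma> \<in> set (curves d) \<Longrightarrow> \<gamma> s \<in> S \<Longrightarrow> f (\<gamma> s) (curve_normal \<gamma> s) = h (\<gamma> s) (curve_normal \<gamma> s)"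
  shows "bint d S f = bint d S h"
  by (rule bint_cong) (simp add: on_bdry_def assms)

lemma drag_value:
  assumes wt: "bint d (wall d) wall_term = 0"
  shows "bint d (wall d) b_drag = bint d (wall d) b_visc - bint d (iso d) b_iso + bint d (wall d) b_conv
     - bint d (adia d) b_adia - bint d (wall d) b_mass - bint d (adia d) b_energy"
proof -
  note add = bint_add[OF disjI1[OF refl] order_refl wall_borel] and diff = bint_diff[OF disjI1[OF refl] order_refl wall_borel]
  have badd: "bcont (wall d) (\<lambda>x n. f x n + h x n)" and bdiff: "bcont (wall d) (\<lambda>x n. f x n - h x n)"
    if "bcont (wall d) f" "bcont (wall d) h" for f h
    using that unfolding bcont_def by (auto intro: continuous_on_add continuous_on_diff)
  note b = integrands_bcont
  have c1: "bcont (wall d) (\<lambda>x n. wall_term x n + b_visc x n)" by (rule badd[OF bcont_wall_parts(4)[OF wall_M] b(1)])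
  have c2: "bcont (wall d) (\<lambda>x n. wall_term x n + b_visc x n + b_conv x n)" by (rule badd[OF c1 b(2)])
  have c3: "bcont (wall d) (\<lambda>x n. wall_term x n + b_visc x n + b_conv x n + b_heat x n)" by (rule badd[OF c2 b(3)])
  have c4: "bcont (wall d) (\<lambda>x n. wall_term x n + b_visc x n + b_conv x n + b_heat x n - b_temp x n)" by (rule bdiff[OF c3 b(4)])
  have c5: "bcont (wall d) (\<lambda>x n. wall_term x n + b_visc x n + b_conv x n + b_heat x n - b_temp x n - b_mass x n)" by (rule bdiff[OF c4 b(5)])
  have "bint d (wall d) b_drag = bint d (wall d) (\<lambda>x n. wall_term x n + b_visc x n + b_conv x n + b_heat x n - b_temp x n - b_mass x n - b_energy x n)"
    by (rule bint_zero_on) (rule wall_identity)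
  also have "\<dots> = bint d (wall d) b_visc + bint d (wall d) b_conv + bint d (wall d) b_heat - bint d (wall d) b_temp
      - bint d (wall d) b_mass - bint d (wall d) b_energy"
    unfolding diff[OF c5 b(6)] diff[OF c4 b(5)] diff[OF c3 b(4)] add[OF c2 b(3)] add[OF c1 b(2)]
      add[OF bcont_wall_parts(4)[OF wall_M] b(1)] wt by simp
  also have "bint d (wall d) b_heat = - bint d (adia d) b_adia"
  proof -
    have "bint d (iso d) b_heat = bint d (iso d) (\<lambda>x n. 0)"
      by (rule bint_zero_on) (simp add: b_heat_def z4_iso)
    then show ?thesis by (simp add: bint_wall_split[OF b(3)] bint_0 adia_heat)
  qed
  also have "bint d (wall d) b_temp = bint d (iso d) b_iso"
  proof -
    have "bint d (adia d) b_temp = bint d (adia d) (\<lambda>x n. 0)"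
    proof (rule bint_zero_on)
      fix \<gamma> and s :: real assume "\<gamma> \<in> set (curves d)" "\<gamma> s \<in> adia d"
      then have "grad (\<lambda>y. z y $ 4) (\<gamma> s) \<bullet> curve_normal \<gamma> s = 0"
        using z_bc unfolding adjoint_conditions_def on_bdry_def by blast
      then show "b_temp (\<gamma> s) (curve_normal \<gamma> s) = 0" by (simp add: b_temp_def inner_commute)
    qed
    moreover have "bint d (iso d) b_temp = bint d (iso d) b_iso"
      by (rule bint_zero_on) (simp add: b_temp_def b_iso_def T_transport)
    ultimately show ?thesis by (simp add: bint_wall_split[OF b(4)] bint_0)
  qed
  also have "bint d (wall d) b_energy = bint d (adia d) b_energy"
  proof -
    have "bint d (iso d) b_energy = bint d (iso d) (\<lambda>x n. 0)"
      by (rule bint_zero_on) (simp add: b_energy_def z4_iso)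
    then show ?thesis by (simp add: bint_wall_split[OF b(6)] bint_0)
  qed
  finally show ?thesis by simp
qed

lemma drag_limit:
  "((\<lambda>t. (drag_lift g C \<psi> (perturb V t d) (u t) - drag_lift g C \<psi> d (u 0)) / t) \<longlongrightarrow> bint d (wall d) b_drag) (at_right 0)"
proof -
  let ?I = "\<lambda>t. bint (perturb V t d) (wall (perturb V t d)) (\<lambda>x n. drag_field \<psi> t x \<bullet> n)"
  have dl: "drag_lift g C \<psi> (perturb V t d) (u t) = 1 / C * ?I t" for t
    unfolding drag_lift_def drag_field_normal ..
  have dl0: "drag_lift g C \<psi> d (u 0) = 1 / C * bint d (wall d) (\<lambda>x n. drag_field \<psi> 0 x \<bullet> n)"
    unfolding drag_lift_def drag_field_normal ..
  have "((\<lambda>t. 1 / C * ((?I t - bint d (wall d) (\<lambda>x n. drag_field \<psi> 0 x \<bullet> n)) / t))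
    \<longlongrightarrow> 1 / C * bint d (wall d) (\<lambda>x n. shape_deriv (\<lambda>t. drag_field \<psi> t x) \<bullet> n + (V x \<bullet> n) * divg (drag_field \<psi> 0) x)) (at_right 0)"
    by (intro tendsto_mult_left flux_shape_derivative Ck_on_SucD[OF drag_field_C2])
  moreover have "1 / C * bint d (wall d) (\<lambda>x n. shape_deriv (\<lambda>t. drag_field \<psi> t x) \<bullet> n + (V x \<bullet> n) * divg (drag_field \<psi> 0) x)
      = bint d (wall d) b_drag"
    unfolding b_drag_def[abs_def] by (rule bint_cmult[symmetric])
  ultimately show ?thesis unfolding dl dl0 by (simp add: right_diff_distrib diff_divide_distrib)
qed

text \<open>The residual is continuous up to the boundary.\<close>

lemma strong_wall:
  assumes "NS_strong g d u0" "x \<in> wall d" shows "divm (Ft 0) x = 0"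
proof -
  have "x \<in> closure (dom d)" using assms(2) wall_closure by blast
  moreover have "closure (dom d) \<subseteq> {y \<in> closure (dom d). divm (Ft 0) y = 0}"
  proof (rule closure_minimal)
    show "dom d \<subseteq> {y \<in> closure (dom d). divm (Ft 0) y = 0}"
      using assms(1) closure_subset unfolding NS_strong_def by blast
    show "closed {y \<in> closure (dom d). divm (Ft 0) y = 0}"
      using continuous_closed_preimage_constant[OF continuous_on_subset[OF divm_F0_cont M(2)], of 0] by simp
  qed
  ultimately show ?thesis by blast
qed

text \<open>On the wall the two integrands are, up to \<open>V \<cdot> n\<close> and \<open>z\<close>, the residuals of the mass and energy
  equations.\<close>

lemma last_line_zero:
  assumes "NS_strong g d u0"
  shows "bint d (wall d) b_mass = 0" "bint d (adia d) b_energy = 0"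
proof -
  have *: "b_mass x n = 0 \<and> b_energy x n = 0" if x: "x \<in> wall d" for x n
  proof -
    have xM: "x \<in> M" using x wall_M by blast
    have "divg (\<lambda>y. Ft 0 y $ i) x = 0" for i
      unfolding divm_nth[OF Ck_on_has_derivative[OF F0_C1 xM], symmetric] strong_wall[OF assms x] by simp
    then show ?thesis
      using wall_flux(2,4)[OF in0[OF xM] v_zero[OF x]] by (simp add: b_mass_def b_energy_def)
  qed
  have "bint d (wall d) b_mass = bint d (wall d) (\<lambda>x n. 0)" "bint d (adia d) b_energy = bint d (adia d) (\<lambda>x n. 0)"
    using * by (auto intro!: bint_zero_on simp: wall_def)
  then show "bint d (wall d) b_mass = 0" "bint d (adia d) b_energy = 0" by (simp_all add: bint_0)
qed

end

text \<open>Collects neighbourhoods on which all functions are regular. At \<open>t = 0\<close> the perturbation is the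
  identity, so the common neighbourhood of the family contains the closure of the domain.\<close>

lemma hadamard_setting:
  assumes domain: "regular_domain k d" "1 \<le> k"
    and V: "perturbation_field k D d V" and C: "C \<noteq> 0"
    and TW: "Ck_near 1 TW (wall d)"
    and family: "regular_family \<epsilon> N d V u"
    and space: "\<And>i. suitable_space (dom d) (X i)"
    and wall: "\<And>t. 0 \<le> t \<Longrightarrow> t < \<epsilon> \<Longrightarrow> wall_conditions g (perturb V t d) TW (u t)"
    and z: "z \<in> prod_space X" and adjoint_bc: "adjoint_conditions C \<psi> d z"
  obtains M NW where "hadamard k d V \<epsilon> N g u z M C \<psi> TW NW"
proof -
  obtain NW where NW: "open NW" "wall d \<subseteq> NW" "Ck_on (Suc 0) TW NW"
    using TW by (auto simp: Ck_near_def)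
  have eps: "0 < \<epsilon>" and N: "open N" using family by (auto simp: regular_family_def)
  then have dN: "closure (dom d) \<subseteq> N"
    using family perturb_0[of V d] by (force simp: regular_family_def)
  have "\<exists>Ni. open Ni \<and> closure (dom d) \<subseteq> Ni \<and> Ck_on 2 (\<lambda>x. z x $ i) Ni" for i
    using z space[of i] unfolding prod_space_def suitable_space_def Ck_near_def by blast
  then obtain Ni where Ni: "\<And>i. open (Ni i)" "\<And>i. closure (dom d) \<subseteq> Ni i" "\<And>i. Ck_on 2 (\<lambda>x. z x $ i) (Ni i)"
    by metis
  define M where "M = N \<inter> (\<Inter>i. Ni i)"
  have M: "open M" "closure (dom d) \<subseteq> M" "M \<subseteq> N" using N dN Ni by (auto simp: M_def intro!: open_Int open_INT)
  have zC: "Ck_on (Suc (Suc 0)) z M"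
  proof (rule Ck_on_vec[OF M(1)])
    show "Ck_on (Suc (Suc 0)) (\<lambda>x. z x $ i) M" for i
      using Ck_on_subset[OF Ni(3)[of i], of M] by (auto simp: M_def numeral_2_eq_2)
  qed
  have VC: "Ck_on (Suc 0) V UNIV"
    using V domain(2) Ck_on_le[of k V UNIV "Suc 0"] by (auto simp: perturbation_field_def)
  have "hadamard k d V \<epsilon> N g u z M C \<psi> TW NW"
  proof unfold_locales
    show "Ck_on (Suc (Suc (Suc 0))) (\<lambda>(t, x). u t x) ({-\<epsilon><..<\<epsilon>} \<times> N)"
      using family by (simp add: regular_family_def numeral_3_eq_3)
    show "u t x \<in> Upos" if "(t, x) \<in> {-\<epsilon><..<\<epsilon>} \<times> N" for t x
      using family that by (auto simp: regular_family_def rho_def)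
    show "V x = 0" if "x \<in> farfield d" for x
      using V that by (auto simp: perturbation_field_def)
    show "on_bdry d (wall d) (\<lambda>x n. V x = (V x \<bullet> n) *\<^sub>R n)"
      using V by (simp add: perturbation_field_def)
    fix t assume "0 \<le> t" "t < \<epsilon>"
    from wall[OF this]
    show "on_bdry (perturb V t d) (wall (perturb V t d)) (\<lambda>x n. vel (u t x) = 0)"
      "on_bdry (perturb V t d) (adia (perturb V t d)) (\<lambda>x n. grad (\<lambda>x. temp g (u t x)) x \<bullet> n = 0)"
      "on_bdry (perturb V t d) (iso (perturb V t d)) (\<lambda>x n. temp g (u t x) = TW x)"
      by (simp_all add: wall_conditions_def)
  qed (use domain VC eps N dN M zC C NW adjoint_bc in simp_all)
  then show ?thesis by (rule that)
qed

theorem mainTheorem1: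
  fixes g :: gas and d :: fluid_domain and D N :: "(real^2) set"
    and C \<alpha> \<epsilon> :: real and \<psi> :: "real^2" and k :: nat
    and V :: "real^2 \<Rightarrow> real^2" and TW :: "real^2 \<Rightarrow> real"
    and X :: "real \<Rightarrow> 4 \<Rightarrow> (real^2 \<Rightarrow> real) set"
    and ip :: "real \<Rightarrow> 4 \<Rightarrow> (real^2 \<Rightarrow> real) \<Rightarrow> (real^2 \<Rightarrow> real) \<Rightarrow> real"
    and W :: "(real^2 \<Rightarrow> real^4) set"
    and u :: "real \<Rightarrow> real^2 \<Rightarrow> real^4" and u' z :: "real^2 \<Rightarrow> real^4"
    and v :: "real^2 \<Rightarrow> real^2" and T \<rho> H :: "real^2 \<Rightarrow> real"
    and \<tau> \<Sigma> :: "real^2 \<Rightarrow> real^2^2" and \<kappa> :: real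
  assumes gas: "perfect_gas g"
    and k: "1 \<le> k"
    and domain: "regular_domain k d" "open D" "dom d \<subseteq> D"
    and V: "perturbation_field k D d V"
    and C: "C \<noteq> 0"
    and psi: "\<psi> = vector [cos \<alpha>, sin \<alpha>] \<or> \<psi> = vector [- sin \<alpha>, cos \<alpha>]"
    and TW: "Ck_near 1 TW (wall d)"
    and family: "regular_family \<epsilon> N d V u"
    and spaces: "\<And>t i. 0 \<le> t \<Longrightarrow> t < \<epsilon> \<Longrightarrow>
        hilbert_function_space (dom (perturb V t d)) (ip t i) (X t i) \<and>
        suitable_space (dom (perturb V t d)) (X t i)"
    and wall: "\<And>t. 0 \<le> t \<Longrightarrow> t < \<epsilon> \<Longrightarrow> wall_conditions g (perturb V t d) TW (u t)"
    and u': "u' = (\<lambda>x. shape_deriv (\<lambda>t. u t x))" "u' \<in> prod_space (X 0)"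
    and adjoint: "adjoint_test_space d (prod_space (X 0)) W"
      "adjoint_problem g C \<psi> d (prod_space (X 0)) W (u 0) z"
    and adjoint_bc: "adjoint_conditions C \<psi> d z"
    and v_eq: "v = (\<lambda>x. vel (u 0 x))" and T_eq: "T = (\<lambda>x. temp g (u 0 x))"
    and \<rho>_eq: "\<rho> = (\<lambda>x. rho (u 0 x))" and H_eq: "H = (\<lambda>x. enth g (u 0 x))"
    and \<tau>_eq: "\<tau> = (\<lambda>x. tau g (u 0 x) (Dm (u 0) x))"
    and \<Sigma>_eq: "\<Sigma> = (\<lambda>x. stress (visc g) (Dm (z23 z) x))"
    and \<kappa>_eq: "\<kappa> = cond g"
  shows
      "((\<forall>t\<in>{0..<\<epsilon>}. NS_variational g (perturb V t d) (prod_space (X t)) (u t)) \<and>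
       VSD g d (prod_space (X 0)) V u u' \<longrightarrow>
       ((\<lambda>t. (drag_lift g C \<psi> (perturb V t d) (u t) - drag_lift g C \<psi> d (u 0)) / t) \<longlongrightarrow>
          bint d (wall d) (\<lambda>x n. (V x \<bullet> n) * (normal_deriv v x n \<bullet> (n v* \<Sigma> x)))
        - bint d (iso d) (\<lambda>x n. (V x \<bullet> n) * normal_deriv (\<lambda>y. TW y - T y) x n
              * \<kappa> * (n \<bullet> grad (\<lambda>y. z y $ 4) x))
        + bint d (wall d) (\<lambda>x n. (V x \<bullet> n) * (normal_deriv v x n \<bullet>
              ((\<rho> x * z x $ 1) *\<^sub>R n + z x $ 4 *\<^sub>R ((\<rho> x * H x) *\<^sub>R n - \<tau> x *v n))))
        - bint d (adia d) (\<lambda>x n. (V x \<bullet> n) * (normal_deriv2 T x n * \<kappa> * z x $ 4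
              + div_tan (\<lambda>y. (\<kappa> * z y $ 4) *\<^sub>R grad T y) x n))
        - bint d (wall d) (\<lambda>x n. (V x \<bullet> n) * \<rho> x * divg v x * z x $ 1)
        - bint d (adia d) (\<lambda>x n. (V x \<bullet> n) * (\<rho> x * H x * divg v x
              - (\<Sum>i\<in>UNIV. \<Sum>j\<in>UNIV. \<tau> x $ i $ j * pd i v x $ j)
              - \<kappa> * divg (grad T) x) * z x $ 4))
       (at_right 0))
     \<and>
      ((\<forall>t\<in>{0..<\<epsilon>}. NS_strong g (perturb V t d) (u t)) \<and>
       PSD g d (u 0) u' \<longrightarrow>
       ((\<lambda>t. (drag_lift g C \<psi> (perturb V t d) (u t) - drag_lift g C \<psi> d (u 0)) / t) \<longlongrightarrow>
          bint d (wall d) (\<lambda>x n. (V x \<bullet> n) * (normal_deriv v x n \<bullet> (n v* \<Sigma> x)))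
        - bint d (iso d) (\<lambda>x n. (V x \<bullet> n) * normal_deriv (\<lambda>y. TW y - T y) x n
              * \<kappa> * (n \<bullet> grad (\<lambda>y. z y $ 4) x))
        + bint d (wall d) (\<lambda>x n. (V x \<bullet> n) * (normal_deriv v x n \<bullet>
              ((\<rho> x * z x $ 1) *\<^sub>R n + z x $ 4 *\<^sub>R ((\<rho> x * H x) *\<^sub>R n - \<tau> x *v n))))
        - bint d (adia d) (\<lambda>x n. (V x \<bullet> n) * (normal_deriv2 T x n * \<kappa> * z x $ 4
              + div_tan (\<lambda>y. (\<kappa> * z y $ 4) *\<^sub>R grad T y) x n)))
       (at_right 0))"
proof -
  have eps: "0 < \<epsilon>" using family by (simp add: regular_family_def)
  have space: "suitable_space (dom d) (X 0 i)" for i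
    using spaces[of 0 i] eps unfolding perturb_0 by blast
  have zH: "z \<in> prod_space (X 0)" using adjoint(2) by (simp add: adjoint_problem_def)
  obtain M NW where "hadamard k d V \<epsilon> N g u z M C \<psi> TW NW"
    by (rule hadamard_setting[OF domain(1) k V C TW family space wall zH adjoint_bc])
  then interpret hadamard k d V \<epsilon> N g u z M C \<psi> TW NW .
  note far = adjoint_far_field[OF space adjoint u'(2)[unfolded u'(1)]]
  note integrands = b_visc_def[abs_def] b_iso_def[abs_def] b_conv_def[abs_def] b_adia_def[abs_def]
    b_mass_def[abs_def] b_energy_def[abs_def]
  show ?thesis
    unfolding v_eq T_eq \<rho>_eq H_eq \<tau>_eq \<Sigma>_eq \<kappa>_eq u'(1)
  proof ((rule conjI; rule impI; elim conjE), goal_cases)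
    case 1
    from drag_limit[unfolded drag_value[OF wall_term_from_VSD[OF far 1(2) zH]] integrands]
    show ?case .
  next
    case 2
    have s0: "NS_strong g d u0" using 2(1)[rule_format, of 0] eps by (simp add: perturb_0)
    have "bint d (wall d) wall_term = 0"
      by (rule wall_term_from_PSD[OF far 2(2)]) (rule strong_wall[OF s0])
    from drag_limit[unfolded drag_value[OF this]]
    have "((\<lambda>t. (drag_lift g C \<psi> (perturb V t d) (u t) - drag_lift g C \<psi> d (u 0)) / t) \<longlongrightarrow>
      bint d (wall d) b_visc - bint d (iso d) b_iso + bint d (wall d) b_conv - bint d (adia d) b_adia) (at_right 0)"
      by (simp add: last_line_zero[OF s0])
    from this[unfolded integrands] show ?case .
  qed
qed

end
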